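(* Let $\sigma \subseteq \mathbb{R}^n$ be a full-dimensional simplicial strongly convex rational polyhedral cone, and let $R = k[\sigma^\vee \cap \mathbb{Z}^n]$ be the corresponding toric ring over an algebraically closed field $k$. Let $D$ be the volume of the $n$-parallelotope spanned by the primitive generators of $\sigma$. Then for all ideals $\mathfrak{q} \subseteq R$ of pure height one and all integers $a > 0$, the symbolic power satisfies $\mathfrak{q}^{(Da)} \subseteq \mathfrak{q}^a$.
   Context: A strongly convex rational polyhedral cone in $\mathbb{R}^n$ is a set $\sigma = \operatorname{Cone}(G) = \{\sum_{v\in G} a_v v : a_v \in \mathbb{R}_{\ge 0}\}$ generated by a finite set $G$ of nonzero vectors of $\mathbb{Z}^n$ and containing no line through the origin. It is full-dimensional if $G$ spans $\mathbb{R}^n$ over $\mathbb{R}$, and simplicial if it can be generated by an $\mathbb{R}$-linearly independent set $G \subseteq \mathbb{Z}^n$. A vector of $\mathbb{Z}^n$ is primitive if its coordinates have gcd one. A full-dimensional simplicial cone $\sigma$ is generated by exactly $n$ linearly independent primitive vectors $v_1,\dots,v_n$, one on each ray (one-dimensional face) of $\sigma$; these are its primitive generators, and $D$ is the absolute value of the determinant of the $n\times n$ integer matrix with rows $v_1,\dots,v_n$. The dual cone is $\sigma^\vee = \{w \in \mathbb{R}^n : \langle w, v\rangle \ge 0 \text{ for all } v \in \sigma\}$, with $\langle\cdot,\cdot\rangle$ the dot product, and $k[\sigma^\vee \cap \mathbb{Z}^n]$ is the semigroup ring over $k$ of the additive semigroup $\sigma^\vee\cap\mathbb{Z}^n$;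 it has $k$-basis the characters $\chi^m$, $m \in \sigma^\vee \cap \mathbb{Z}^n$, with $\chi^m\chi^{m'} = \chi^{m+m'}$. For a proper ideal $I$ of a Noetherian ring $R$ and an integer $a>0$, the $a$-th symbolic power is $I^{(a)} := I^a W^{-1}R \cap R$, where $W = R - \bigcup\{P : P \in \operatorname{Ass}_R(R/I)\}$. A proper ideal $I$ has pure height $h$ if all of its associated primes (the elements of $\operatorname{Ass}_R(R/I)$) have height $h$. *)

theory Defs
  imports
    "HOL-Analysis.Analysis"
    "HOL-Algebra.Ideal_Product"
    "HOL-Algebra.QuotRing"
    "HOL-Library.Poly_Mapping"
    "HOL-Library.Extended_Nat"
begin

section \<open>Rational polyhedral cones\<close>

text \<open>The lattice of integer vectors is the type \<^typ>\<open>int ^ 'n\<close>; \<open>of_lattice\<close> is its inclusion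
  into \<^typ>\<open>real ^ 'n\<close>.\<close>

definition of_lattice :: "int ^ 'n \<Rightarrow> real ^ 'n" where
  "of_lattice m = (\<chi> i. real_of_int (m $ i))"

definition Cone :: "(real ^ 'n) set \<Rightarrow> (real ^ 'n) set" where
  "Cone G = {(\<Sum>v\<in>G. a v *\<^sub>R v) |a. \<forall>v\<in>G. 0 \<le> a v}"

definition lattice_generators :: "(int ^ 'n) set \<Rightarrow> (real ^ 'n) set \<Rightarrow> bool" where
  "lattice_generators G \<sigma> \<longleftrightarrow> finite G \<and> 0 \<notin> G \<and> \<sigma> = Cone (of_lattice ` G)"

definition strongly_convex_rational_polyhedral_cone :: "(real ^ 'n) set \<Rightarrow> bool" where
  "strongly_convex_rational_polyhedral_cone \<sigma> \<longleftrightarrow>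
     (\<exists>G. lattice_generators G \<sigma>) \<and> \<not> (\<exists>x. x \<noteq> 0 \<and> range (\<lambda>t. t *\<^sub>R x) \<subseteq> \<sigma>)"

definition full_dimensional_cone :: "(real ^ 'n) set \<Rightarrow> bool" where
  "full_dimensional_cone \<sigma> \<longleftrightarrow> (\<exists>G. lattice_generators G \<sigma> \<and> span (of_lattice ` G) = UNIV)"

definition simplicial_cone :: "(real ^ 'n) set \<Rightarrow> bool" where
  "simplicial_cone \<sigma> \<longleftrightarrow> (\<exists>G. lattice_generators G \<sigma> \<and> independent (of_lattice ` G))"

definition primitive_vector :: "int ^ 'n \<Rightarrow> bool" where
  "primitive_vector v \<longleftrightarrow> (GCD i\<in>UNIV. v $ i) = 1"

definition rays :: "(real ^ 'n) set \<Rightarrow> (real ^ 'n) set set" where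
  "rays \<sigma> = {F. F face_of \<sigma> \<and> aff_dim F = 1}"

definition primitive_generators :: "(real ^ 'n) set \<Rightarrow> (int ^ 'n) set" where
  "primitive_generators \<sigma> = {v. primitive_vector v \<and> (\<exists>F\<in>rays \<sigma>. of_lattice v \<in> F)}"

definition dual_cone :: "(real ^ 'n) set \<Rightarrow> (real ^ 'n) set" where
  "dual_cone \<sigma> = {w. \<forall>v\<in>\<sigma>. 0 \<le> w \<bullet> v}"


section \<open>Toric rings\<close>

text \<open>Multiplication on \<^typ>\<open>'a \<Rightarrow>\<^sub>0 'k\<close> is convolution, so \<^term>\<open>Poly_Mapping.single m 1\<close> is the
  character of exponent \<open>m\<close>.\<close>

definition semigroup_ring :: "'a::comm_monoid_add set \<Rightarrow> ('a \<Rightarrow>\<^sub>0 'k::comm_ring_1) ring" where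
  "semigroup_ring S =
     \<lparr>carrier = {p. Poly_Mapping.keys p \<subseteq> S}, mult = (*), one = 1, zero = 0, add = (+)\<rparr>"

definition toric_ring :: "(real ^ 'n) set \<Rightarrow> (int ^ 'n \<Rightarrow>\<^sub>0 'k::comm_ring_1) ring" where
  "toric_ring \<sigma> = semigroup_ring {m. of_lattice m \<in> dual_cone \<sigma>}"


section \<open>Associated primes and height\<close>

text \<open>\<open>Ass R I\<close> is the set of associated primes of the \<open>R\<close>-module \<open>R/I\<close>, i.e. the primes that are
  annihilators of an element \<open>m\<close> of \<open>R/I\<close>; the scalar \<open>r\<close> acts on \<open>R/I\<close> as multiplication by its
  residue class.\<close>

definition Ass :: "('a, 'b) ring_scheme \<Rightarrow> 'a set \<Rightarrow> 'a set set" where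
  "Ass R I = {P. primeideal P R \<and>
     (\<exists>m\<in>carrier (R Quot I).
        P = {r \<in> carrier R. (I +>\<^bsub>R\<^esub> r) \<otimes>\<^bsub>R Quot I\<^esub> m = \<zero>\<^bsub>R Quot I\<^esub>})}"

definition height :: "('a, 'b) ring_scheme \<Rightarrow> 'a set \<Rightarrow> enat" where
  "height R P = Sup {enat l |l. \<exists>Q. (\<forall>i\<le>l. primeideal (Q i) R) \<and>
                                   (\<forall>i<l. Q i \<subset> Q (Suc i)) \<and> Q l = P}"

definition pure_height :: "('a, 'b) ring_scheme \<Rightarrow> 'a set \<Rightarrow> nat \<Rightarrow> bool" where
  "pure_height R I h \<longleftrightarrow> ideal I R \<and> I \<noteq> carrier R \<and> (\<forall>P\<in>Ass R I. height R P = enat h)"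


section \<open>Localization and symbolic powers\<close>

definition frac_rel :: "('a, 'b) ring_scheme \<Rightarrow> 'a set \<Rightarrow> (('a \<times> 'a) \<times> ('a \<times> 'a)) set" where
  "frac_rel R W = {((r, s), (r', s')). r \<in> carrier R \<and> r' \<in> carrier R \<and> s \<in> W \<and> s' \<in> W \<and>
     (\<exists>t\<in>W. t \<otimes>\<^bsub>R\<^esub> (s' \<otimes>\<^bsub>R\<^esub> r) = t \<otimes>\<^bsub>R\<^esub> (s \<otimes>\<^bsub>R\<^esub> r'))}"

definition frac :: "('a, 'b) ring_scheme \<Rightarrow> 'a set \<Rightarrow> 'a \<Rightarrow> 'a \<Rightarrow> ('a \<times> 'a) set" where
  "frac R W r s = frac_rel R W `` {(r, s)}"

text \<open>The operations are computed on representatives; the unions collapse because the result does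
  not depend on the representatives (see \<open>localization_cring\<close> below).\<close>

definition localization :: "('a, 'b) ring_scheme \<Rightarrow> 'a set \<Rightarrow> ('a \<times> 'a) set ring" where
  "localization R W =
     \<lparr>carrier = (carrier R \<times> W) // frac_rel R W,
      mult = (\<lambda>X Y. \<Union>(r, s)\<in>X. \<Union>(r', s')\<in>Y. frac R W (r \<otimes>\<^bsub>R\<^esub> r') (s \<otimes>\<^bsub>R\<^esub> s')),
      one = frac R W \<one>\<^bsub>R\<^esub> \<one>\<^bsub>R\<^esub>,
      zero = frac R W \<zero>\<^bsub>R\<^esub> \<one>\<^bsub>R\<^esub>,
      add = (\<lambda>X Y. \<Union>(r, s)\<in>X. \<Union>(r', s')\<in>Y.
               frac R W (r \<otimes>\<^bsub>R\<^esub> s' \<oplus>\<^bsub>R\<^esub> r' \<otimes>\<^bsub>R\<^esub> s) (s \<otimes>\<^bsub>R\<^esub> s'))\<rparr>"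

abbreviation ideal_power :: "('a, 'b) ring_scheme \<Rightarrow> 'a set \<Rightarrow> nat \<Rightarrow> 'a set" where
  "ideal_power R I a \<equiv> I [^]\<^bsub>ideals_set R\<^esub> a"

text \<open>\<open>I\<^sup>a W\<^sup>-\<^sup>1R \<inter> R\<close>: the contraction along \<open>r \<mapsto> r/1\<close> of the ideal that \<open>I\<^sup>a\<close> generates in the
  localization.\<close>

definition symbolic_power :: "('a, 'b) ring_scheme \<Rightarrow> 'a set \<Rightarrow> nat \<Rightarrow> 'a set" where
  "symbolic_power R I a =
     (let W = carrier R - \<Union>(Ass R I); \<phi> = (\<lambda>r. frac R W r \<one>\<^bsub>R\<^esub>)
      in {r \<in> carrier R. \<phi> r \<in> Idl\<^bsub>localization R W\<^esub> (\<phi> ` ideal_power R I a)})"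

lemma semigroup_ring_cring:
  assumes "0 \<in> S" "\<And>x y. x \<in> S \<Longrightarrow> y \<in> S \<Longrightarrow> x + y \<in> S"
  shows "cring (semigroup_ring S :: ('a::comm_monoid_add \<Rightarrow>\<^sub>0 'k::comm_ring_1) ring)"
proof (rule cringI)
  let ?R = "semigroup_ring S :: ('a \<Rightarrow>\<^sub>0 'k) ring"
  show "abelian_group ?R"
  proof (rule abelian_groupI)
    fix x y assume "x \<in> carrier ?R" "y \<in> carrier ?R"
    then show "x \<oplus>\<^bsub>?R\<^esub> y \<in> carrier ?R"
      using keys_add[of x y] by (auto simp: semigroup_ring_def)
  next
    fix x assume "x \<in> carrier ?R"
    then show "\<exists>y\<in>carrier ?R. y \<oplus>\<^bsub>?R\<^esub> x = \<zero>\<^bsub>?R\<^esub>"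
      by (intro bexI[of _ "-x"]) (auto simp: semigroup_ring_def in_keys_iff)
  qed (auto simp: semigroup_ring_def algebra_simps)
  show "Group.comm_monoid ?R"
  proof (rule comm_monoidI)
    fix x y assume "x \<in> carrier ?R" "y \<in> carrier ?R"
    then show "x \<otimes>\<^bsub>?R\<^esub> y \<in> carrier ?R"
      using keys_mult[of x y] assms(2) by (fastforce simp: semigroup_ring_def)
  qed (auto simp: semigroup_ring_def algebra_simps assms(1))
qed (auto simp: semigroup_ring_def algebra_simps)

lemma toric_ring_cring:
  fixes \<sigma> :: "(real ^ 'n) set"
  shows "cring (toric_ring \<sigma>)"
  unfolding toric_ring_def
proof (rule semigroup_ring_cring)
  have "of_lattice (x + y) = of_lattice x + of_lattice y" for x y :: "int ^ 'n"
    by (simp add: of_lattice_def vec_eq_iff)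
  then show "x + y \<in> {m. of_lattice m \<in> dual_cone \<sigma>}"
    if "x \<in> {m. of_lattice m \<in> dual_cone \<sigma>}" "y \<in> {m. of_lattice m \<in> dual_cone \<sigma>}" for x y
    using that by (auto simp: dual_cone_def inner_add_left)
  have "of_lattice 0 = (0 :: real ^ 'n)"
    by (simp add: of_lattice_def vec_eq_iff)
  then show "0 \<in> {m. of_lattice m \<in> dual_cone \<sigma>}"
    by (simp add: dual_cone_def)
qed

lemma frac_rel_equiv:
  assumes "cring R" and W: "W \<subseteq> carrier R" "\<one>\<^bsub>R\<^esub> \<in> W" "\<And>s t. s \<in> W \<Longrightarrow> t \<in> W \<Longrightarrow> s \<otimes>\<^bsub>R\<^esub> t \<in> W"
  shows "equiv (carrier R \<times> W) (frac_rel R W)"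
proof -
  interpret cring R by fact
  show ?thesis
  proof (rule equivI)
    show "frac_rel R W \<subseteq> (carrier R \<times> W) \<times> (carrier R \<times> W)"
      by (auto simp: frac_rel_def)
    show "refl_on (carrier R \<times> W) (frac_rel R W)"
      using W(2) by (auto simp: refl_on_def frac_rel_def)
    show "sym (frac_rel R W)"
      by (auto simp: sym_def frac_rel_def) metis
    show "Relation.trans (frac_rel R W)"
    proof (rule transI, clarsimp simp: frac_rel_def)
      fix r1 s1 r2 s2 r3 s3 t u
      assume h: "r1 \<in> carrier R" "r2 \<in> carrier R" "r3 \<in> carrier R"
        "s1 \<in> W" "s2 \<in> W" "s3 \<in> W" "t \<in> W" "u \<in> W"
        "t \<otimes>\<^bsub>R\<^esub> (s2 \<otimes>\<^bsub>R\<^esub> r1) = t \<otimes>\<^bsub>R\<^esub> (s1 \<otimes>\<^bsub>R\<^esub> r2)"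
        "u \<otimes>\<^bsub>R\<^esub> (s3 \<otimes>\<^bsub>R\<^esub> r2) = u \<otimes>\<^bsub>R\<^esub> (s2 \<otimes>\<^bsub>R\<^esub> r3)"
      then have c: "s1 \<in> carrier R" "s2 \<in> carrier R" "s3 \<in> carrier R" "t \<in> carrier R" "u \<in> carrier R"
        using W(1) by auto
      have "(t \<otimes>\<^bsub>R\<^esub> u \<otimes>\<^bsub>R\<^esub> s2) \<otimes>\<^bsub>R\<^esub> (s3 \<otimes>\<^bsub>R\<^esub> r1)
            = (u \<otimes>\<^bsub>R\<^esub> s3) \<otimes>\<^bsub>R\<^esub> (t \<otimes>\<^bsub>R\<^esub> (s2 \<otimes>\<^bsub>R\<^esub> r1))"
        using h(1-3) c by (simp add: m_ac)
      also have "\<dots> = (t \<otimes>\<^bsub>R\<^esub> s1) \<otimes>\<^bsub>R\<^esub> (u \<otimes>\<^bsub>R\<^esub> (s3 \<otimes>\<^bsub>R\<^esub> r2))"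
        unfolding h(9) using h(1-3) c by (simp add: m_ac)
      also have "\<dots> = (t \<otimes>\<^bsub>R\<^esub> u \<otimes>\<^bsub>R\<^esub> s2) \<otimes>\<^bsub>R\<^esub> (s1 \<otimes>\<^bsub>R\<^esub> r3)"
        unfolding h(10) using h(1-3) c by (simp add: m_ac)
      finally show "\<exists>t\<in>W. t \<otimes>\<^bsub>R\<^esub> (s3 \<otimes>\<^bsub>R\<^esub> r1) = t \<otimes>\<^bsub>R\<^esub> (s1 \<otimes>\<^bsub>R\<^esub> r3)"
        using h W(3) by blast
    qed
  qed
qed

lemma localization_cring:
  assumes "cring R" and W: "W \<subseteq> carrier R" "\<one>\<^bsub>R\<^esub> \<in> W" "\<And>s t. s \<in> W \<Longrightarrow> t \<in> W \<Longrightarrow> s \<otimes>\<^bsub>R\<^esub> t \<in> W"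
  shows "cring (localization R W)"
    and "(\<lambda>r. frac R W r \<one>\<^bsub>R\<^esub>) \<in> ring_hom R (localization R W)"
proof -
  interpret cring R by fact
  let ?L = "localization R W"
  note eq = frac_rel_equiv[OF assms]
  have Wc: "s \<in> carrier R" if "s \<in> W" for s
    using that W(1) by auto
  have frac_eqI: "frac R W r s = frac R W r' s'"
    if "r \<in> carrier R" "r' \<in> carrier R" "s \<in> W" "s' \<in> W" "t \<in> W"
      "t \<otimes>\<^bsub>R\<^esub> (s' \<otimes>\<^bsub>R\<^esub> r) = t \<otimes>\<^bsub>R\<^esub> (s \<otimes>\<^bsub>R\<^esub> r')" for r s r' s' t
    unfolding frac_def using that
    by (intro equiv_class_eq[OF eq]) (auto simp: frac_rel_def)
  have frac_eqI1: "frac R W r s = frac R W r' s'"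
    if "r \<in> carrier R" "r' \<in> carrier R" "s \<in> W" "s' \<in> W" "s' \<otimes>\<^bsub>R\<^esub> r = s \<otimes>\<^bsub>R\<^esub> r'" for r s r' s'
    using that W(2) by (intro frac_eqI[of _ _ _ _ "\<one>\<^bsub>R\<^esub>"]) auto
  have mult: "frac R W r s \<otimes>\<^bsub>?L\<^esub> frac R W r' s' = frac R W (r \<otimes>\<^bsub>R\<^esub> r') (s \<otimes>\<^bsub>R\<^esub> s')"
    if h: "r \<in> carrier R" "r' \<in> carrier R" "s \<in> W" "s' \<in> W" for r s r' s'
  proof -
    have "congruent2 (frac_rel R W) (frac_rel R W)
            (\<lambda>x y. frac R W (fst x \<otimes>\<^bsub>R\<^esub> fst y) (snd x \<otimes>\<^bsub>R\<^esub> snd y))"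
    proof (rule congruent2_commuteI[OF eq])
      fix y z u assume "(y, z) \<in> frac_rel R W" "u \<in> carrier R \<times> W"
      then obtain a b c d e f t where x: "y = (a,b)" "z = (c,d)" "u = (e,f)" "t \<in> W"
        "a \<in> carrier R" "c \<in> carrier R" "e \<in> carrier R" "b \<in> W" "d \<in> W" "f \<in> W"
        "t \<otimes>\<^bsub>R\<^esub> (d \<otimes>\<^bsub>R\<^esub> a) = t \<otimes>\<^bsub>R\<^esub> (b \<otimes>\<^bsub>R\<^esub> c)"
        by (auto simp: frac_rel_def)
      have "t \<otimes>\<^bsub>R\<^esub> (f \<otimes>\<^bsub>R\<^esub> d \<otimes>\<^bsub>R\<^esub> (e \<otimes>\<^bsub>R\<^esub> a)) = f \<otimes>\<^bsub>R\<^esub> e \<otimes>\<^bsub>R\<^esub> (t \<otimes>\<^bsub>R\<^esub> (d \<otimes>\<^bsub>R\<^esub> a))"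
        using x(4-10) Wc by (simp add: m_ac)
      also have "\<dots> = t \<otimes>\<^bsub>R\<^esub> (f \<otimes>\<^bsub>R\<^esub> b \<otimes>\<^bsub>R\<^esub> (e \<otimes>\<^bsub>R\<^esub> c))"
        unfolding x(11) using x(4-10) Wc by (simp add: m_ac)
      finally show "frac R W (fst u \<otimes>\<^bsub>R\<^esub> fst y) (snd u \<otimes>\<^bsub>R\<^esub> snd y)
                  = frac R W (fst u \<otimes>\<^bsub>R\<^esub> fst z) (snd u \<otimes>\<^bsub>R\<^esub> snd z)"
        using x W(3) by (intro frac_eqI[of _ _ _ _ t]) auto
    qed (auto simp: m_comm Wc)
    from UN_equiv_class2[OF eq eq this, of "(r, s)" "(r', s')"] h
    show ?thesis by (simp add: localization_def frac_def case_prod_beta)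
  qed
  have add: "frac R W r s \<oplus>\<^bsub>?L\<^esub> frac R W r' s'
             = frac R W (r \<otimes>\<^bsub>R\<^esub> s' \<oplus>\<^bsub>R\<^esub> r' \<otimes>\<^bsub>R\<^esub> s) (s \<otimes>\<^bsub>R\<^esub> s')"
    if h: "r \<in> carrier R" "r' \<in> carrier R" "s \<in> W" "s' \<in> W" for r s r' s'
  proof -
    have "congruent2 (frac_rel R W) (frac_rel R W)
            (\<lambda>x y. frac R W (fst x \<otimes>\<^bsub>R\<^esub> snd y \<oplus>\<^bsub>R\<^esub> fst y \<otimes>\<^bsub>R\<^esub> snd x) (snd x \<otimes>\<^bsub>R\<^esub> snd y))"
    proof (rule congruent2_commuteI[OF eq])
      fix y z u assume "(y, z) \<in> frac_rel R W" "u \<in> carrier R \<times> W"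
      then obtain a b c d e f t where x: "y = (a,b)" "z = (c,d)" "u = (e,f)" "t \<in> W"
        "a \<in> carrier R" "c \<in> carrier R" "e \<in> carrier R" "b \<in> W" "d \<in> W" "f \<in> W"
        "t \<otimes>\<^bsub>R\<^esub> (d \<otimes>\<^bsub>R\<^esub> a) = t \<otimes>\<^bsub>R\<^esub> (b \<otimes>\<^bsub>R\<^esub> c)"
        by (auto simp: frac_rel_def)
      have "t \<otimes>\<^bsub>R\<^esub> (f \<otimes>\<^bsub>R\<^esub> d \<otimes>\<^bsub>R\<^esub> (e \<otimes>\<^bsub>R\<^esub> b \<oplus>\<^bsub>R\<^esub> a \<otimes>\<^bsub>R\<^esub> f))
          = t \<otimes>\<^bsub>R\<^esub> f \<otimes>\<^bsub>R\<^esub> d \<otimes>\<^bsub>R\<^esub> e \<otimes>\<^bsub>R\<^esub> b \<oplus>\<^bsub>R\<^esub> f \<otimes>\<^bsub>R\<^esub> f \<otimes>\<^bsub>R\<^esub> (t \<otimes>\<^bsub>R\<^esub> (d \<otimes>\<^bsub>R\<^esub> a))"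
        using x(4-10) Wc by (simp add: m_ac r_distr)
      also have "\<dots> = t \<otimes>\<^bsub>R\<^esub> (f \<otimes>\<^bsub>R\<^esub> b \<otimes>\<^bsub>R\<^esub> (e \<otimes>\<^bsub>R\<^esub> d \<oplus>\<^bsub>R\<^esub> c \<otimes>\<^bsub>R\<^esub> f))"
        unfolding x(11) using x(4-10) Wc by (simp add: m_ac r_distr)
      finally show "frac R W (fst u \<otimes>\<^bsub>R\<^esub> snd y \<oplus>\<^bsub>R\<^esub> fst y \<otimes>\<^bsub>R\<^esub> snd u) (snd u \<otimes>\<^bsub>R\<^esub> snd y)
                  = frac R W (fst u \<otimes>\<^bsub>R\<^esub> snd z \<oplus>\<^bsub>R\<^esub> fst z \<otimes>\<^bsub>R\<^esub> snd u) (snd u \<otimes>\<^bsub>R\<^esub> snd z)"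
        using x W(3) Wc by (intro frac_eqI[of _ _ _ _ t]) auto
    qed (auto simp: m_comm a_comm Wc)
    from UN_equiv_class2[OF eq eq this, of "(r, s)" "(r', s')"] h
    show ?thesis by (simp add: localization_def frac_def case_prod_beta)
  qed
  have zero: "\<zero>\<^bsub>?L\<^esub> = frac R W \<zero>\<^bsub>R\<^esub> \<one>\<^bsub>R\<^esub>" and one: "\<one>\<^bsub>?L\<^esub> = frac R W \<one>\<^bsub>R\<^esub> \<one>\<^bsub>R\<^esub>"
    by (simp_all add: localization_def)
  have closed: "frac R W r s \<in> carrier ?L" if "r \<in> carrier R" "s \<in> W" for r s
    using that by (auto simp: localization_def frac_def quotient_def)
  have elim: "\<exists>r s. r \<in> carrier R \<and> s \<in> W \<and> x = frac R W r s" if "x \<in> carrier ?L" for x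
    using that by (auto simp: localization_def frac_def quotient_def)
  note simps = mult add zero one closed W(2,3) Wc
  show "cring ?L"
  proof (rule cringI)
    show "abelian_group ?L"
    proof (rule abelian_groupI)
      fix x y assume "x \<in> carrier ?L" "y \<in> carrier ?L"
      then obtain a s b t where h: "a \<in> carrier R" "s \<in> W" "x = frac R W a s"
        "b \<in> carrier R" "t \<in> W" "y = frac R W b t" by (meson elim)
      show "x \<oplus>\<^bsub>?L\<^esub> y \<in> carrier ?L" using h by (simp add: simps)
      show "x \<oplus>\<^bsub>?L\<^esub> y = y \<oplus>\<^bsub>?L\<^esub> x"
        using h by (simp add: simps a_comm m_comm)
      fix z assume "z \<in> carrier ?L"
      then obtain c u where h': "c \<in> carrier R" "u \<in> W" "z = frac R W c u" by (meson elim)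
      show "x \<oplus>\<^bsub>?L\<^esub> y \<oplus>\<^bsub>?L\<^esub> z = x \<oplus>\<^bsub>?L\<^esub> (y \<oplus>\<^bsub>?L\<^esub> z)"
        using h h' by (simp add: simps) (intro frac_eqI1, auto simp: simps m_ac a_ac l_distr r_distr)
    next
      show "\<zero>\<^bsub>?L\<^esub> \<in> carrier ?L" by (simp add: simps)
      fix x assume "x \<in> carrier ?L"
      then obtain a s where h: "a \<in> carrier R" "s \<in> W" "x = frac R W a s" by (meson elim)
      show "\<zero>\<^bsub>?L\<^esub> \<oplus>\<^bsub>?L\<^esub> x = x" using h by (simp add: simps)
      show "\<exists>y\<in>carrier ?L. y \<oplus>\<^bsub>?L\<^esub> x = \<zero>\<^bsub>?L\<^esub>"
      proof (rule bexI)
        show "frac R W (\<ominus>\<^bsub>R\<^esub> a) s \<oplus>\<^bsub>?L\<^esub> x = \<zero>\<^bsub>?L\<^esub>"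
          using h by (simp add: simps) (intro frac_eqI1, auto simp: simps l_minus l_neg)
      qed (use h in \<open>simp add: simps\<close>)
    qed
    show "Group.comm_monoid ?L"
    proof (rule comm_monoidI)
      show "\<one>\<^bsub>?L\<^esub> \<in> carrier ?L" by (simp add: simps)
      fix x y assume "x \<in> carrier ?L" "y \<in> carrier ?L"
      then obtain a s b t where h: "a \<in> carrier R" "s \<in> W" "x = frac R W a s"
        "b \<in> carrier R" "t \<in> W" "y = frac R W b t" by (meson elim)
      show "x \<otimes>\<^bsub>?L\<^esub> y \<in> carrier ?L" using h by (simp add: simps)
      show "x \<otimes>\<^bsub>?L\<^esub> y = y \<otimes>\<^bsub>?L\<^esub> x" using h by (simp add: simps m_comm)
      show "\<one>\<^bsub>?L\<^esub> \<otimes>\<^bsub>?L\<^esub> x = x" using h by (simp add: simps)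
      fix z assume "z \<in> carrier ?L"
      then obtain c u where h': "c \<in> carrier R" "u \<in> W" "z = frac R W c u" by (meson elim)
      show "x \<otimes>\<^bsub>?L\<^esub> y \<otimes>\<^bsub>?L\<^esub> z = x \<otimes>\<^bsub>?L\<^esub> (y \<otimes>\<^bsub>?L\<^esub> z)"
        using h h' by (simp add: simps m_assoc)
    qed
    fix x y z assume "x \<in> carrier ?L" "y \<in> carrier ?L" "z \<in> carrier ?L"
    then obtain a s b t c u where h: "a \<in> carrier R" "s \<in> W" "x = frac R W a s"
      "b \<in> carrier R" "t \<in> W" "y = frac R W b t" "c \<in> carrier R" "u \<in> W" "z = frac R W c u"
      by (meson elim)
    show "(x \<oplus>\<^bsub>?L\<^esub> y) \<otimes>\<^bsub>?L\<^esub> z = x \<otimes>\<^bsub>?L\<^esub> z \<oplus>\<^bsub>?L\<^esub> y \<otimes>\<^bsub>?L\<^esub> z"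
      using h by (simp add: simps) (intro frac_eqI1, auto simp: simps m_ac a_ac l_distr r_distr)
  qed
  show "(\<lambda>r. frac R W r \<one>\<^bsub>R\<^esub>) \<in> ring_hom R ?L"
    by (rule ring_hom_memI) (simp_all add: simps)
qed

end

theory Submission
  imports Defs
begin

text \<open>
  Writing \<open>m\<close> in the coordinates \<open>\<langle>m, v\<^sub>i\<rangle>\<close> embeds \<open>R\<close> into the polynomial ring
  \<open>S = k[x\<^sub>1, \<dots>, x\<^sub>n]\<close> as the part of degree \<open>0\<close> for the grading of \<open>S\<close> by \<open>\<int>\<^sup>n / V \<int>\<^sup>n\<close>, a
  group killed by \<open>D\<close>. The homogeneous elements of \<open>S\<close> form a factorial monoid \<open>H\<close>: this is
  Gauss's lemma, applied one variable at a time. Since \<open>h\<^sup>D \<in> R\<close> for every \<open>h \<in> H\<close>, the primes of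
  \<open>R\<close> of height one are of the form \<open>p S \<inter> R\<close> with \<open>p\<close> prime in \<open>H\<close>. Let \<open>g \<in> H\<close> be a
  greatest common divisor of \<open>q\<close>. If \<open>q\<close> has pure height one then \<open>q = g S \<inter> R\<close>, and no prime of
  \<open>H\<close> divides both \<open>g\<close> and an element outside the associated primes of \<open>q\<close>. Hence
  the symbolic power \<open>q^(Da)\<close> is contained in \<open>g\<^bsup>Da\<^esup>S \<inter> R = g\<^bsup>Da\<^esup>R\<close>, which lies in \<open>q\<^sup>a\<close> because
  \<open>g\<^sup>D \<in> g S \<inter> R = q\<close>.
\<close>

section \<open>Polynomials as finitely supported functions on exponent vectors\<close>

text \<open>In general \<open>R\<close> is not factorial, so an ideal of pure height one need not be
  principal; factorization has to take place outside \<open>R\<close>. The whole polynomial ring is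
  too large for this: a prime of it need not have a power in \<open>R\<close>, and such a power is
  what links it to the primes of \<open>R\<close>. Hence only homogeneous elements are factored, and
  only into homogeneous factors. A prime of \<open>H\<close> may split further in the polynomial
  ring: if \<open>V\<close> has rows (1,0) and (1,3), then x^3 - y^3 is prime in \<open>H\<close>
  although it is reducible. So factoriality of \<open>H\<close> cannot be read off from that of the
  polynomial ring, and the argument of Gauss is repeated with degrees carried along. Working with a
  grading instead of the invariants of a group action avoids any condition on the characteristic of
  the field. Purity enters through annihilators: each element outside \<open>q\<close> has a
  multiple whose annihilator modulo \<open>q\<close> is an associated prime, hence of height one,
  hence the contraction of a prime of \<open>H\<close>. The number \<open>D\<close> enters only as
  an exponent killing the grading group, which is Cramer's rule.\<close>

abbreviation keys :: "('a \<Rightarrow>\<^sub>0 'b::zero) \<Rightarrow> 'a set"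
  where "keys \<equiv> Poly_Mapping.keys"

abbreviation lookup :: "('a \<Rightarrow>\<^sub>0 'b::zero) \<Rightarrow> 'a \<Rightarrow> 'b"
  where "lookup \<equiv> Poly_Mapping.lookup"

definition restr :: "'a set \<Rightarrow> ('a \<Rightarrow>\<^sub>0 'k::comm_ring_1) \<Rightarrow> 'a \<Rightarrow>\<^sub>0 'k" where
  "restr T p = Poly_Mapping.mapp (\<lambda>e c. c when e \<in> T) p"

lemma lookup_restr: "lookup (restr T p) e = (if e \<in> T then lookup p e else 0)"
  by (auto simp: restr_def lookup_mapp in_keys_iff when_def)

lemma keys_restr: "keys (restr T p) = keys p \<inter> T"
  by (auto simp: in_keys_iff lookup_restr split: if_splits)

lemma restr_add: "restr T (p + q) = restr T p + restr T q"
  by (rule poly_mapping_eqI) (simp add: lookup_restr lookup_add)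

lemma restr_id: "keys p \<subseteq> T \<Longrightarrow> restr T p = p"
  by (rule poly_mapping_eqI) (auto simp: lookup_restr in_keys_iff)

lemma restr_0: "keys p \<inter> T = {} \<Longrightarrow> restr T p = 0"
  by (rule poly_mapping_eqI) (auto simp: lookup_restr in_keys_iff)

lemma keys_mult_subset:
  assumes "\<And>e f. e \<in> keys p \<Longrightarrow> f \<in> keys q \<Longrightarrow> e + f \<in> T"
  shows "keys (p * q) \<subseteq> T"
  using keys_mult[of p q] assms by fastforce

text \<open>Split \<open>s\<close> into \<open>restr T s\<close> and the rest: multiplication by
  \<open>a\<close> sends the first part into \<open>B\<close> and the second off \<open>B\<close>.
  Depending on the sets, this is linearity of a coefficient over constants or of a graded component
  over homogeneous elements.\<close>

lemma restr_mult:
  assumes "\<And>e f. e \<in> keys a \<Longrightarrow> e + f \<in> B \<longleftrightarrow> f \<in> T"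
  shows "restr B (a * s) = a * restr T s"
proof -
  have "keys (a * restr T s) \<subseteq> B" "keys (a * (s - restr T s)) \<subseteq> - B"
    using assms by (auto intro!: keys_mult_subset simp: keys_restr)
      (auto simp: in_keys_iff lookup_minus lookup_restr)
  then have "restr B (a * restr T s + a * (s - restr T s)) = a * restr T s + 0"
    unfolding restr_add by (intro arg_cong2[of _ _ _ _ "(+)"] restr_id restr_0) auto
  then show ?thesis
    by (simp add: algebra_simps)
qed

section \<open>Subrings in some of the variables; degrees and coefficients in one variable\<close>

definition polys_in :: "'n set \<Rightarrow> (nat ^ 'n \<Rightarrow>\<^sub>0 'k::comm_ring_1) set" where
  "polys_in I = {p. \<forall>e\<in>keys p. \<forall>j. j \<notin> I \<longrightarrow> e $ j = 0}"

text \<open>The bound is strict so that bound 0 means the zero polynomial, which then needs no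
  degree of its own.\<close>

definition deg_less :: "'n \<Rightarrow> nat \<Rightarrow> (nat ^ 'n \<Rightarrow>\<^sub>0 'k::comm_ring_1) set" where
  "deg_less i d = {p. \<forall>e\<in>keys p. e $ i < d}"

definition var_pow :: "'n \<Rightarrow> nat \<Rightarrow> nat ^ 'n \<Rightarrow>\<^sub>0 'k::comm_ring_1" where
  "var_pow i d = Poly_Mapping.single (axis i d) 1"

text \<open>The coefficient of the \<open>d\<close>-th power of variable \<open>i\<close>, a
  polynomial in the other variables. The restriction comes first because shifting exponents alone
  would keep higher powers too.\<close>

definition coeff_at :: "'n \<Rightarrow> nat \<Rightarrow> (nat ^ 'n \<Rightarrow>\<^sub>0 'k::comm_ring_1) \<Rightarrow> nat ^ 'n \<Rightarrow>\<^sub>0 'k" where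
  "coeff_at i d p = Poly_Mapping.map_key (\<lambda>e. e + axis i d) (restr {e. e $ i = d} p)"

lemma polys_in_add: "p \<in> polys_in I \<Longrightarrow> q \<in> polys_in I \<Longrightarrow> p + q \<in> polys_in I"
  using keys_add[of p q] by (auto simp: polys_in_def)

lemma polys_in_uminus: "p \<in> polys_in I \<Longrightarrow> - p \<in> polys_in I"
  by (auto simp: polys_in_def in_keys_iff)

lemma polys_in_diff: "p \<in> polys_in I \<Longrightarrow> q \<in> polys_in I \<Longrightarrow> p - q \<in> polys_in I"
  using polys_in_add[of p I "- q"] polys_in_uminus[of q I] by simp

lemma polys_in_mult: "p \<in> polys_in I \<Longrightarrow> q \<in> polys_in I \<Longrightarrow> p * q \<in> polys_in I"
  using keys_mult[of p q] by (fastforce simp: polys_in_def)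

lemma polys_in_0: "0 \<in> polys_in I" and polys_in_1: "1 \<in> polys_in I"
  by (auto simp: polys_in_def)

lemma polys_in_mono: "I \<subseteq> J \<Longrightarrow> polys_in I \<subseteq> polys_in J"
  by (auto simp: polys_in_def)

lemma polys_in_UNIV: "polys_in UNIV = UNIV"
  by (auto simp: polys_in_def)

lemmas polys_in_closed = polys_in_add polys_in_uminus polys_in_diff polys_in_mult polys_in_0 polys_in_1

lemma var_pow_in: "i \<in> I \<Longrightarrow> var_pow i d \<in> polys_in I"
  by (auto simp: polys_in_def var_pow_def axis_def split: if_splits)

lemma deg_less_add: "p \<in> deg_less i d \<Longrightarrow> q \<in> deg_less i d \<Longrightarrow> p + q \<in> deg_less i d"
  using keys_add[of p q] by (auto simp: deg_less_def)

lemma deg_less_diff: "p \<in> deg_less i d \<Longrightarrow> q \<in> deg_less i d \<Longrightarrow> p - q \<in> deg_less i d"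
  using keys_diff[of p q] by (auto simp: deg_less_def)

lemma deg_less_mult:
  assumes "p \<in> deg_less i d" "\<And>e. e \<in> keys q \<Longrightarrow> e $ i \<le> d'"
  shows "p * q \<in> deg_less i (d + d')"
  using assms keys_mult[of p q] by (fastforce simp: deg_less_def)

lemma deg_less_0: "0 \<in> deg_less i d"
  by (auto simp: deg_less_def)

lemma deg_less_zero_iff: "p \<in> deg_less i 0 \<longleftrightarrow> p = 0"
  by (auto simp: deg_less_def)

lemma deg_less_exists: "\<exists>d. p \<in> deg_less i d"
proof -
  have "e $ i < Suc (Max ((\<lambda>e. e $ i) ` keys p))" if "e \<in> keys p" for e
    using that by (auto simp: less_Suc_eq_le intro!: Max_ge)
  then show ?thesis by (auto simp: deg_less_def)
qed

lemma deg_less_Suc_cases: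
  assumes "p \<noteq> 0"
  obtains d where "p \<in> deg_less i (Suc d)" "p \<notin> deg_less i d"
proof -
  obtain d where d: "p \<in> deg_less i d" "\<And>d'. p \<in> deg_less i d' \<Longrightarrow> d \<le> d'"
    using deg_less_exists[of p i] LeastI_ex[of "\<lambda>d. p \<in> deg_less i d"] Least_le[of "\<lambda>d. p \<in> deg_less i d"]
    by metis
  show thesis
  proof (cases d)
    case 0
    then show ?thesis using d(1) assms by (simp add: deg_less_zero_iff)
  next
    case (Suc d'')
    then show ?thesis using d that by force
  qed
qed

lemma inj_add_axis: "inj (\<lambda>e::nat ^ 'n. e + axis i d)"
  by (auto simp: inj_def)

lemma lookup_coeff_at:
  "lookup (coeff_at i d p) e = (if e $ i = 0 then lookup p (e + axis i d) else 0)"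
  by (simp add: coeff_at_def map_key.rep_eq inj_add_axis lookup_restr axis_def)

lemma coeff_at_add: "coeff_at i d (p + q) = coeff_at i d p + coeff_at i d q"
  by (rule poly_mapping_eqI) (simp add: lookup_coeff_at lookup_add)

lemma coeff_at_diff: "coeff_at i d (p - q) = coeff_at i d p - coeff_at i d q"
  by (rule poly_mapping_eqI) (simp add: lookup_coeff_at lookup_minus)

lemma coeff_at_zero: "coeff_at i d 0 = 0"
  by (rule poly_mapping_eqI) (simp add: lookup_coeff_at)

lemma coeff_at_deg_less: "p \<in> deg_less i d \<Longrightarrow> coeff_at i d p = 0"
  by (rule poly_mapping_eqI) (force simp: lookup_coeff_at deg_less_def in_keys_iff axis_def)

lemma keys_coeff_at: "e \<in> keys (coeff_at i d p) \<longleftrightarrow> e $ i = 0 \<and> e + axis i d \<in> keys p"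
  by (auto simp: in_keys_iff lookup_coeff_at)

lemma coeff_at_keys: "e \<in> keys (coeff_at i d p) \<Longrightarrow> e $ i = 0"
  by (simp add: keys_coeff_at)

lemma coeff_at_in:
  assumes "p \<in> polys_in (insert i I)" shows "coeff_at i d p \<in> polys_in I"
proof -
  have "e $ j = 0" if "j \<notin> I" "e \<in> keys (coeff_at i d p)" for e j
  proof (cases "j = i")
    case False
    have "(e + axis i d) $ j = 0"
      using assms that False by (auto simp: polys_in_def keys_coeff_at)
    then show ?thesis by simp
  qed (use that in \<open>simp add: keys_coeff_at\<close>)
  then show ?thesis by (auto simp: polys_in_def)
qed

lemma lookup_mult_single_add:
  fixes p :: "'a::cancel_comm_monoid_add \<Rightarrow>\<^sub>0 'k::comm_ring_1"
  shows "lookup (p * Poly_Mapping.single t 1) (e + t) = lookup p e"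
proof -
  have inner: "(\<Sum>q. lookup (Poly_Mapping.single t (1::'k)) q when e + t = l + q) = (1 when e = l)" for l
  proof -
    have "(\<lambda>q. lookup (Poly_Mapping.single t (1::'k)) q when e + t = l + q)
        = (\<lambda>q. (1 when e = l) when q = t)"
      by (auto simp: fun_eq_iff lookup_single when_def)
    then show ?thesis by (simp only: Sum_any_when_equal)
  qed
  show ?thesis
    by (simp only: lookup_mult inner mult_when mult_1_right Sum_any_when_equal')
qed

lemma coeff_at_var_pow:
  assumes "\<And>e. e \<in> keys c \<Longrightarrow> e $ i = 0"
  shows "coeff_at i d (c * var_pow i d) = c"
proof (rule poly_mapping_eqI)
  fix e
  show "lookup (coeff_at i d (c * var_pow i d)) e = lookup c e"
    using assms[of e] by (cases "e \<in> keys c") (auto simp: lookup_coeff_at var_pow_def lookup_mult_single_add in_keys_iff)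
qed

lemma restr_eq_coeff_at:
  fixes p :: "nat ^ 'n \<Rightarrow>\<^sub>0 'k::comm_ring_1"
  shows "restr {e. e $ i = d} p = coeff_at i d p * var_pow i d"
proof (rule poly_mapping_eqI)
  fix e :: "nat ^ 'n"
  let ?q = "coeff_at i d p * var_pow i d"
  show "lookup (restr {e. e $ i = d} p) e = lookup ?q e"
  proof (cases "e $ i = d")
    case True
    define f where "f = (\<chi> j. if j = i then 0 else e $ j)"
    have e: "e = f + axis i d" and f: "f $ i = 0"
      using True by (auto simp: f_def vec_eq_iff axis_def)
    show ?thesis
      unfolding e var_pow_def lookup_mult_single_add using f
      by (simp add: lookup_restr lookup_coeff_at axis_def)
  next
    case False
    have "keys ?q \<subseteq> {e. e $ i = d}"
      by (rule keys_mult_subset) (auto simp: keys_coeff_at var_pow_def axis_def split: if_splits)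
    then show ?thesis using False by (auto simp: lookup_restr in_keys_iff)
  qed
qed

lemma deg_less_decomp:
  assumes "p \<in> deg_less i (Suc d)"
  shows "p - coeff_at i d p * var_pow i d \<in> deg_less i d"
  using assms unfolding restr_eq_coeff_at[symmetric]
  by (force simp: deg_less_def in_keys_iff lookup_minus lookup_restr less_Suc_eq split: if_splits)

lemma coeff_at_mult_const:
  assumes "\<And>e. e \<in> keys c \<Longrightarrow> e $ i = 0"
  shows "coeff_at i d (c * p) = c * coeff_at i d p"
proof -
  have "coeff_at i d (c * p) * var_pow i d = restr {e. e $ i = d} (c * p)"
    by (simp add: restr_eq_coeff_at)
  also have "\<dots> = c * restr {e. e $ i = d} p"
    using assms by (intro restr_mult) auto
  also have "\<dots> = c * coeff_at i d p * var_pow i d"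
    by (simp add: restr_eq_coeff_at mult.assoc)
  finally have "coeff_at i d (coeff_at i d (c * p) * var_pow i d)
      = coeff_at i d (c * coeff_at i d p * var_pow i d)" by simp
  moreover have "e $ i = 0" if "e \<in> keys (c * coeff_at i d p)" for e
    using that assms keys_mult[of c "coeff_at i d p"] by (fastforce simp: keys_coeff_at)
  ultimately show ?thesis
    by (metis coeff_at_var_pow coeff_at_keys)
qed

lemma polys_in_keys: "p \<in> polys_in I \<Longrightarrow> i \<notin> I \<Longrightarrow> e \<in> keys p \<Longrightarrow> e $ i = 0"
  by (auto simp: polys_in_def)

lemma keys_var_pow: "e \<in> keys (var_pow i d) \<Longrightarrow> e = axis i d"
  by (simp add: var_pow_def split: if_splits)

lemma var_pow_mult: "var_pow i d * var_pow i d' = var_pow i (d + d')"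
proof -
  have "axis i d + axis i d' = axis i (d + d')" by (simp add: axis_def vec_eq_iff)
  then show ?thesis by (simp add: var_pow_def mult_single)
qed

text \<open>Write each factor as its top term plus a rest of lower degree: only the product of the
  top terms reaches degree \<open>d + d'\<close>.\<close>

lemma coeff_at_mult:
  assumes "a \<in> deg_less i (Suc d)" "b \<in> deg_less i (Suc d')"
  shows "coeff_at i (d + d') (a * b) = coeff_at i d a * coeff_at i d' b"
proof -
  define c t where "c = coeff_at i d a" and "t = a - c * var_pow i d"
  define c' t' where "c' = coeff_at i d' b" and "t' = b - c' * var_pow i d'"
  have t: "t \<in> deg_less i d" and t': "t' \<in> deg_less i d'"
    using assms deg_less_decomp by (auto simp: t_def t'_def c_def c'_def)
  have "a * b = (c * c') * (var_pow i d * var_pow i d') + (t * b + t' * (c * var_pow i d))"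
    by (simp add: t_def t'_def algebra_simps)
  moreover have "e $ i = 0" if "e \<in> keys (c * c')" for e
    using that keys_mult[of c c'] by (fastforce simp: keys_coeff_at c_def c'_def)
  moreover have "t * b + t' * (c * var_pow i d) \<in> deg_less i (d + d')"
  proof (rule deg_less_add)
    show "t * b \<in> deg_less i (d + d')"
      using assms(2) by (intro deg_less_mult[OF t]) (auto simp: deg_less_def)
    have "e $ i \<le> d" if "e \<in> keys (c * var_pow i d)" for e
      using that keys_mult[of c "var_pow i d"]
      by (fastforce simp: c_def keys_coeff_at axis_def dest!: keys_var_pow)
    from deg_less_mult[OF t' this] show "t' * (c * var_pow i d) \<in> deg_less i (d + d')"
      by (simp add: add.commute)
  qed
  ultimately show ?thesis
    by (metis (no_types, lifting) add.right_neutral coeff_at_add coeff_at_deg_less coeff_at_var_pow var_pow_mult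
        c_def c'_def)
qed

lemma polys_in_empty:
  assumes "c \<in> polys_in {}"
  shows "c = Poly_Mapping.single 0 (lookup c 0)"
proof (rule poly_mapping_eqI)
  fix e
  show "lookup c e = lookup (Poly_Mapping.single 0 (lookup c 0)) e"
  proof (cases "e = 0")
    case False
    then have "e \<notin> keys c" using assms by (auto simp: polys_in_def vec_eq_iff)
    then show ?thesis using False by (simp add: in_keys_iff lookup_single)
  qed simp
qed

text \<open>With \<open>d\<close> and \<open>d'\<close> the exact degrees in variable
  \<open>i\<close>, the top coefficients are nonzero and involve one variable less, and their
  product is a coefficient of \<open>a * b\<close>.\<close>

lemma polys_in_no_zero_divisors:
  fixes a b :: "nat ^ 'n \<Rightarrow>\<^sub>0 'k::idom"
  assumes "finite I" "a \<in> polys_in I" "b \<in> polys_in I" "a * b = 0"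
  shows "a = 0 \<or> b = 0"
  using assms
proof (induction I arbitrary: a b rule: finite_induct)
  case empty
  note eq = polys_in_empty
  have "lookup a 0 * lookup b 0 = 0"
    using empty eq[of a] eq[of b] by (metis add_0 lookup_single_eq lookup_zero mult_single)
  then show ?case
    using empty eq[of a] eq[of b] by (metis mult_eq_0_iff single_zero)
next
  case (insert i I)
  show ?case
  proof (rule ccontr)
    assume "\<not> ?case"
    then have "a \<noteq> 0" "b \<noteq> 0" by auto
    then obtain d d' where d: "a \<in> deg_less i (Suc d)" "a \<notin> deg_less i d"
      and d': "b \<in> deg_less i (Suc d')" "b \<notin> deg_less i d'"
      by (metis deg_less_Suc_cases)
    have "coeff_at i d a * coeff_at i d' b = 0"
      using coeff_at_mult[OF d(1) d'(1)] insert.prems(3) by (simp add: coeff_at_zero)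
    then have "coeff_at i d a = 0 \<or> coeff_at i d' b = 0"
      using insert.prems by (intro insert.IH) (auto intro: coeff_at_in)
    then show False
      using deg_less_decomp[OF d(1)] deg_less_decomp[OF d'(1)] d(2) d'(2) by auto
  qed
qed

lemma poly_mult_eq_0_iff:
  fixes a b :: "nat ^ 'n \<Rightarrow>\<^sub>0 'k::idom"
  shows "a * b = 0 \<longleftrightarrow> a = 0 \<or> b = 0"
  using polys_in_no_zero_divisors[of UNIV a b] by (auto simp: polys_in_UNIV)

section \<open>Hilbert's basis theorem\<close>

definition ideal_of :: "'a::comm_ring_1 set \<Rightarrow> 'a set \<Rightarrow> bool" where
  "ideal_of A J \<longleftrightarrow> J \<subseteq> A \<and> 0 \<in> J \<and> (\<forall>x\<in>J. \<forall>y\<in>J. x + y \<in> J) \<and> (\<forall>r\<in>A. \<forall>x\<in>J. r * x \<in> J)"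

text \<open>Stated for a subset \<open>A\<close>, so that the rings \<open>polys_in I\<close> share
  one type and the variables can be adjoined by induction on \<open>I\<close>.\<close>

definition noetherian_on :: "'a::comm_ring_1 set \<Rightarrow> bool" where
  "noetherian_on A \<longleftrightarrow>
     (\<forall>J. (\<forall>k::nat. ideal_of A (J k)) \<and> (\<forall>k. J k \<subseteq> J (Suc k)) \<longrightarrow> (\<exists>N. \<forall>k\<ge>N. J k = J N))"

lemma noetherian_onD:
  assumes "noetherian_on A" "\<And>k::nat. ideal_of A (J k)" "\<And>k. J k \<subseteq> J (Suc k)"
  shows "\<exists>N. \<forall>k\<ge>N. J k = J N"
  using assms unfolding noetherian_on_def by simp

text \<open>The leading coefficients of members of \<open>J\<close> of degree \<open>d\<close> in
  variable \<open>i\<close>, together with 0, which arises from the members of lower degree.\<close>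

definition lead_ideal :: "'n \<Rightarrow> nat \<Rightarrow> (nat ^ 'n \<Rightarrow>\<^sub>0 'k::comm_ring_1) set \<Rightarrow> (nat ^ 'n \<Rightarrow>\<^sub>0 'k) set" where
  "lead_ideal i d J = coeff_at i d ` (J \<inter> deg_less i (Suc d))"

lemma lead_ideal_mono:
  fixes J :: "(nat ^ 'n \<Rightarrow>\<^sub>0 'k::comm_ring_1) set"
  shows "J \<subseteq> J' \<Longrightarrow> lead_ideal i d J \<subseteq> lead_ideal i d J'"
  by (auto simp: lead_ideal_def)

lemma coeff_at_mult_in:
  assumes "c \<in> polys_in I" "i \<notin> I"
  shows "coeff_at i d (c * p) = c * coeff_at i d p"
  using assms by (intro coeff_at_mult_const) (auto intro: polys_in_keys)

lemma mult_const_deg_less: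
  assumes "c \<in> polys_in I" "i \<notin> I" "p \<in> deg_less i d"
  shows "c * p \<in> deg_less i d"
  using deg_less_mult[OF assms(3), of c 0] polys_in_keys[OF assms(1,2)] by (simp add: mult.commute)

lemma lead_ideal_ideal:
  fixes J :: "(nat ^ 'n \<Rightarrow>\<^sub>0 'k::comm_ring_1) set"
  assumes "i \<notin> I" "ideal_of (polys_in (insert i I)) J"
  shows "ideal_of (polys_in I) (lead_ideal i d J)"
  unfolding ideal_of_def
proof (intro conjI ballI)
  show "lead_ideal i d J \<subseteq> polys_in I"
    using assms by (auto simp: lead_ideal_def ideal_of_def intro!: coeff_at_in)
  show "0 \<in> lead_ideal i d J"
    using assms by (auto simp: lead_ideal_def ideal_of_def coeff_at_zero deg_less_0 intro!: image_eqI[of _ _ 0])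
next
  fix x y assume "x \<in> lead_ideal i d J" "y \<in> lead_ideal i d J"
  then obtain p q where "x = coeff_at i d p" "y = coeff_at i d q" "p \<in> J" "q \<in> J"
    "p \<in> deg_less i (Suc d)" "q \<in> deg_less i (Suc d)" by (auto simp: lead_ideal_def)
  then show "x + y \<in> lead_ideal i d J"
    using assms(2) unfolding lead_ideal_def
    by (intro image_eqI[of _ _ "p + q"]) (auto simp: coeff_at_add deg_less_add ideal_of_def)
next
  fix c x :: "nat ^ 'n \<Rightarrow>\<^sub>0 'k" assume c: "c \<in> polys_in I" and "x \<in> lead_ideal i d J"
  then obtain p where "x = coeff_at i d p" "p \<in> J" "p \<in> deg_less i (Suc d)"
    by (auto simp: lead_ideal_def)
  moreover have "c \<in> polys_in (insert i I)"
    using c polys_in_mono[of I "insert i I"] by auto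
  ultimately show "c * x \<in> lead_ideal i d J"
    using assms c unfolding lead_ideal_def
    by (intro image_eqI[of _ _ "c * p"]) (auto simp: coeff_at_mult_in mult_const_deg_less ideal_of_def)
qed

lemma ideal_of_uminus: "ideal_of A J \<Longrightarrow> - 1 \<in> A \<Longrightarrow> x \<in> J \<Longrightarrow> - x \<in> J"
  unfolding ideal_of_def by (metis mult_minus1)

text \<open>Some member of \<open>J\<close> has the same coefficient of degree \<open>d\<close> as a
  given member of \<open>J'\<close>; the difference lies in \<open>J'\<close> again and has lower
  degree.\<close>

lemma lead_ideal_determines:
  assumes "- 1 \<in> A" and J: "ideal_of A J" "ideal_of A J'" "J \<subseteq> J'"
    and lead: "\<And>d. lead_ideal i d J' \<subseteq> lead_ideal i d J"
  shows "J' = J"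
proof -
  have "p \<in> J" if "p \<in> J'" "p \<in> deg_less i d" for p d
    using that
  proof (induction d arbitrary: p)
    case 0
    then show ?case using J by (simp add: deg_less_zero_iff ideal_of_def)
  next
    case (Suc d)
    then obtain q where q: "q \<in> J" "q \<in> deg_less i (Suc d)" "coeff_at i d p = coeff_at i d q"
      using lead[of d] by (force simp: lead_ideal_def)
    have "p - q \<in> J'"
      using Suc.prems q J ideal_of_uminus[OF J(2) assms(1), of q] unfolding ideal_of_def
      by (metis diff_conv_add_uminus subsetD)
    moreover have "p - q \<in> deg_less i d"
      using deg_less_diff[OF deg_less_decomp[OF Suc.prems(2)] deg_less_decomp[OF q(2)]] q(3) by simp
    ultimately have "p - q \<in> J" by (rule Suc.IH)
    then have "p - q + q \<in> J" using q J by (simp only: ideal_of_def)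
    then show ?case by simp
  qed
  then show ?thesis using deg_less_exists J(3) by blast
qed

text \<open>Multiplication by the variable raises the degree by one and keeps the leading
  coefficient.\<close>

lemma lead_ideal_Suc:
  assumes "ideal_of (polys_in (insert i I)) J"
  shows "lead_ideal i d J \<subseteq> lead_ideal i (Suc d) J"
proof
  fix c assume "c \<in> lead_ideal i d J"
  then obtain p where p: "p \<in> J" "p \<in> deg_less i (Suc d)" "c = coeff_at i d p"
    by (auto simp: lead_ideal_def)
  have "var_pow i 1 \<in> deg_less i (Suc 1)"
    by (auto simp: deg_less_def dest!: keys_var_pow)
  from coeff_at_mult[OF p(2) this] have "coeff_at i (Suc d) (p * var_pow i 1) = c * coeff_at i 1 (1 * var_pow i 1)"
    using p by simp
  also have "coeff_at i 1 (1 * var_pow i 1) = 1"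
    by (intro coeff_at_var_pow) auto
  finally have "c = coeff_at i (Suc d) (var_pow i 1 * p)" by (simp add: mult.commute)
  moreover have "var_pow i 1 * p \<in> J"
    using assms p(1) var_pow_in[of i "insert i I" 1] by (auto simp: ideal_of_def)
  moreover have "p * var_pow i 1 \<in> deg_less i (Suc d + 1)"
    using p(2) by (intro deg_less_mult) (auto dest!: keys_var_pow)
  ultimately show "c \<in> lead_ideal i (Suc d) J"
    by (auto simp: lead_ideal_def mult.commute)
qed

lemma noetherian_polys_in:
  assumes "finite I"
  shows "noetherian_on (polys_in I :: (nat ^ 'n \<Rightarrow>\<^sub>0 'k::field) set)"
  using assms
proof (induction I rule: finite_induct)
  case empty
  have J01: "J = {0} \<or> J = polys_in {}" if J: "ideal_of (polys_in {}) J" for J :: "(nat ^ 'n \<Rightarrow>\<^sub>0 'k) set"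
  proof (rule disjCI)
    assume "J \<noteq> polys_in {}"
    show "J = {0}"
    proof (rule ccontr)
      assume "J \<noteq> {0}"
      then obtain c where c: "c \<in> J" "c \<noteq> 0" using J by (auto simp: ideal_of_def)
      have "c = Poly_Mapping.single 0 (lookup c 0)"
        using c J by (intro polys_in_empty) (auto simp: ideal_of_def)
      then obtain k where k: "c = Poly_Mapping.single 0 k" "k \<noteq> 0" using c(2) by (metis single_zero)
      have "r \<in> J" if "r \<in> polys_in {}" for r
      proof -
        have "r * Poly_Mapping.single 0 (inverse k) \<in> polys_in {}"
          using that by (intro polys_in_mult) (auto simp: polys_in_def)
        then have "r * Poly_Mapping.single 0 (inverse k) * c \<in> J"
          using J c by (auto simp: ideal_of_def)
        then show ?thesis
          using k by (simp add: mult.assoc mult_single)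
      qed
      with \<open>J \<noteq> polys_in {}\<close> J show False by (auto simp: ideal_of_def)
    qed
  qed
  show ?case
    unfolding noetherian_on_def
  proof (intro allI impI)
    fix J :: "nat \<Rightarrow> (nat ^ 'n \<Rightarrow>\<^sub>0 'k) set"
    assume *: "(\<forall>k. ideal_of (polys_in {}) (J k)) \<and> (\<forall>k. J k \<subseteq> J (Suc k))"
    then have mono: "J k \<subseteq> J l" if "k \<le> l" for k l using that lift_Suc_mono_le[of J] by blast
    have sub: "{0} \<subseteq> J k" "J k \<subseteq> polys_in {}" for k using * by (auto simp: ideal_of_def)
    show "\<exists>N. \<forall>k\<ge>N. J k = J N"
    proof (cases "\<exists>N. J N = polys_in {}")
      case True
      then show ?thesis using mono sub by (metis subset_antisym)
    next
      case False
      then show ?thesis using J01 * by metis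
    qed
  qed
next
  case (insert i I)
  show ?case
    unfolding noetherian_on_def
  proof (intro allI impI)
    fix J :: "nat \<Rightarrow> (nat ^ 'n \<Rightarrow>\<^sub>0 'k) set"
    assume *: "(\<forall>k. ideal_of (polys_in (insert i I)) (J k)) \<and> (\<forall>k. J k \<subseteq> J (Suc k))"
    then have mono: "J k \<subseteq> J l" if "k \<le> l" for k l using that lift_Suc_mono_le[of J] by blast
    define L where "L d k = lead_ideal i d (J k)" for d k
    have L: "ideal_of (polys_in I) (L d k)" for d k
      using * insert.hyps by (auto simp: L_def intro: lead_ideal_ideal)
    have Lk: "L d k \<subseteq> L d l" if "k \<le> l" for d k l
      using mono[OF that] by (simp add: L_def lead_ideal_mono)
    have Ld: "L d k \<subseteq> L d' k" if "d \<le> d'" for d d' k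
    proof (rule lift_Suc_mono_le[of "\<lambda>d. L d k", OF _ that])
      show "L d k \<subseteq> L (Suc d) k" for d using lead_ideal_Suc * unfolding L_def by blast
    qed
    \<comment> \<open>\<open>L\<close> grows in both indices, so its diagonal is an ascending chain.
      Its stabilization settles all degrees above \<open>N\<close> at once; the finitely many
      degrees up to \<open>N\<close> are treated separately through \<open>M\<close>.\<close>
    have "\<exists>N. \<forall>k\<ge>N. L k k = L N N"
    proof (rule noetherian_onD[OF insert.IH])
      show "L k k \<subseteq> L (Suc k) (Suc k)" for k
        using Lk[of k "Suc k" k] Ld[of k "Suc k" "Suc k"] by auto
    qed (rule L)
    then obtain N where N: "\<And>k. k \<ge> N \<Longrightarrow> L k k = L N N" by blast
    have "\<exists>M. \<forall>k\<ge>M. L d k = L d M" for d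
      by (rule noetherian_onD[OF insert.IH L Lk]) simp
    then obtain M where M: "\<And>d k. k \<ge> M d \<Longrightarrow> L d k = L d (M d)" by metis
    define K where "K = Max (insert N (M ` {..N}))"
    have K: "N \<le> K" "\<And>d. d \<le> N \<Longrightarrow> M d \<le> K" unfolding K_def by (intro Max_ge; simp)+
    have "L d k \<subseteq> L d K" if "K \<le> k" for d k
    proof (cases "d \<le> N")
      case True
      then show ?thesis using M[of d k] M[of d K] K(2)[of d] that by auto
    next
      case False
      have "L d k \<subseteq> L (max d k) (max d k)" using Ld Lk by (meson max.cobounded1 max.cobounded2 subset_trans)
      also have "\<dots> = L N N" using False by (intro N) simp
      also have "\<dots> \<subseteq> L d K" using Ld[of N d N] Lk[of N K d] False K by auto
      finally show ?thesis .
    qed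
    then have "J k = J K" if "K \<le> k" for k
      using * mono that by (intro lead_ideal_determines[of "polys_in (insert i I)" _ _ i])
        (auto simp: L_def polys_in_closed)
    then show "\<exists>N. \<forall>k\<ge>N. J k = J N" by blast
  qed
qed

section \<open>Factorial monoids\<close>

text \<open>Here \<open>dvd\<close> is divisibility in the ambient domain, and
  \<open>quotient_mem\<close> makes it agree with divisibility inside \<open>H\<close>. The last
  assumption is the ascending chain condition on principal ideals, with proper divisors below their
  multiples.\<close>

locale divisibility_monoid =
  fixes H :: "'b::comm_ring_1 set"
  assumes one_mem: "1 \<in> H"
    and mult_mem: "a \<in> H \<Longrightarrow> b \<in> H \<Longrightarrow> a * b \<in> H"
    and no_zero_div: "a * b = 0 \<Longrightarrow> a = 0 \<or> b = (0::'b)"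
    and quotient_mem: "a \<in> H \<Longrightarrow> b \<in> H \<Longrightarrow> a \<noteq> 0 \<Longrightarrow> a dvd b \<Longrightarrow> \<exists>c\<in>H. b = a * c"
    and wf_strict_dvd: "wf {(b, a::'b). b dvd a \<and> \<not> a dvd b}"
begin

text \<open>The factors range over \<open>H\<close> only, so an irreducible element may still factor
  in the ambient ring.\<close>

definition irred :: "'b \<Rightarrow> bool" where
  "irred f \<longleftrightarrow> f \<in> H \<and> f \<noteq> 0 \<and> \<not> f dvd 1 \<and> (\<forall>a\<in>H. \<forall>b\<in>H. f = a * b \<longrightarrow> a dvd 1 \<or> b dvd 1)"

definition is_prime :: "'b \<Rightarrow> bool" where
  "is_prime f \<longleftrightarrow> f \<in> H \<and> f \<noteq> 0 \<and> \<not> f dvd 1 \<and> (\<forall>a\<in>H. \<forall>b\<in>H. f dvd a * b \<longrightarrow> f dvd a \<or> f dvd b)"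

lemma cancel: "a \<noteq> 0 \<Longrightarrow> a * b = a * c \<longleftrightarrow> b = (c::'b)"
  using no_zero_div[of a "b - c"] by (auto simp: algebra_simps)

lemma strict_dvd_mult:
  assumes "a \<noteq> 0" "\<not> p dvd 1" shows "\<not> p * a dvd (a::'b)"
proof
  assume "p * a dvd a"
  then obtain k where "a * 1 = a * (p * k)" by (metis dvdE mult.assoc mult.commute mult.right_neutral)
  then have "1 = p * k" unfolding cancel[OF assms(1)] .
  then show False using assms(2) by (metis dvd_triv_left)
qed

text \<open>Pass to proper factors until one is irreducible. The clause
  \<open>\<not> c dvd c'\<close> lets later inductions descend from \<open>c\<close> to its
  cofactor.\<close>

lemma irred_divisor:
  assumes "c \<in> H" "c \<noteq> 0" "\<not> c dvd 1"
  shows "\<exists>p c'. irred p \<and> c' \<in> H \<and> c' \<noteq> 0 \<and> c = p * c' \<and> \<not> c dvd c'"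
  using wf_strict_dvd assms
proof (induction c rule: wf_induct_rule)
  case (less c)
  show ?case
  proof (cases "irred c")
    case True
    then show ?thesis using less.prems one_mem by (intro exI[of _ c] exI[of _ 1]) auto
  next
    case False
    then obtain a b where ab: "a \<in> H" "b \<in> H" "c = a * b" "\<not> a dvd 1" "\<not> b dvd 1"
      using less.prems by (auto simp: irred_def)
    have nz: "a \<noteq> 0" "b \<noteq> 0" using ab(3) less.prems by auto
    have "\<not> c dvd a" using strict_dvd_mult[OF nz(1) ab(5)] ab(3) by (simp add: mult.commute)
    then obtain p a' where p: "irred p" "a' \<in> H" "a' \<noteq> 0" "a = p * a'"
      using less.IH[of a] ab nz by auto
    have "a' * b \<noteq> 0" using no_zero_div p nz by blast
    then have "\<not> p * (a' * b) dvd a' * b" using p(1) by (intro strict_dvd_mult) (auto simp: irred_def)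
    then show ?thesis
      using p ab mult_mem \<open>a' * b \<noteq> 0\<close>
      by (intro exI[of _ p] exI[of _ "a' * b"]) (auto simp: mult.assoc)
  qed
qed

lemma prime_nonzero: "is_prime p \<Longrightarrow> p \<noteq> 0"
  and prime_mem: "is_prime p \<Longrightarrow> p \<in> H"
  and prime_not_unit: "is_prime p \<Longrightarrow> \<not> p dvd 1"
  and prime_dvd_multD: "is_prime p \<Longrightarrow> a \<in> H \<Longrightarrow> b \<in> H \<Longrightarrow> p dvd a * b \<Longrightarrow> p dvd a \<or> p dvd b"
  by (simp_all add: is_prime_def)

lemma power_mem: "a \<in> H \<Longrightarrow> a ^ n \<in> H"
  by (induction n) (auto simp: one_mem mult_mem)

lemma power_nonzero: "(a::'b) \<noteq> 0 \<Longrightarrow> (1::'b) \<noteq> 0 \<Longrightarrow> a ^ n \<noteq> 0"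
  by (induction n) (use no_zero_div in auto)

lemma prime_dvd_powerD: "is_prime p \<Longrightarrow> a \<in> H \<Longrightarrow> p dvd a ^ n \<Longrightarrow> p dvd a"
proof (induction n)
  case (Suc n)
  then show ?case using prime_dvd_multD[of p a "a ^ n"] power_mem by auto
qed (simp add: prime_not_unit)

lemma prime_of_associated:
  assumes "is_prime p" "f \<in> H" "p dvd f" "f dvd p"
  shows "is_prime f"
  unfolding is_prime_def
proof (intro conjI ballI impI)
  show "f \<noteq> 0" using assms(1,4) prime_nonzero by fastforce
  show "\<not> f dvd 1" using assms(1,3) prime_not_unit dvd_trans by blast
  fix a b assume "a \<in> H" "b \<in> H" "f dvd a * b"
  then have "p dvd a \<or> p dvd b" using assms(1,3) by (meson dvd_trans prime_dvd_multD)
  then show "f dvd a \<or> f dvd b" using assms(4) dvd_trans by blast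
qed (rule assms)

end

locale factorial_monoid = divisibility_monoid +
  assumes prime_of_irred: "irred f \<Longrightarrow> is_prime f"
begin

lemma prime_divisor:
  assumes "c \<in> H" "c \<noteq> 0" "\<not> c dvd 1"
  obtains p c' where "is_prime p" "c' \<in> H" "c' \<noteq> 0" "c = p * c'" "\<not> c dvd c'"
  using irred_divisor[OF assms] prime_of_irred by blast

text \<open>Existence of prime factorizations in the form of an induction rule. Uniqueness is never
  stated; primality of the factors does its work.\<close>

lemma factor_induct [consumes 2, case_names unit prime]:
  assumes "c \<in> H" "c \<noteq> 0"
    and unit: "\<And>c. c \<in> H \<Longrightarrow> c dvd 1 \<Longrightarrow> P c"
    and prime: "\<And>p c. is_prime p \<Longrightarrow> c \<in> H \<Longrightarrow> c \<noteq> 0 \<Longrightarrow> P c \<Longrightarrow> P (p * c)"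
  shows "P c"
  using wf_strict_dvd assms(1,2)
proof (induction c rule: wf_induct_rule)
  case (less c)
  show ?case
  proof (cases "c dvd 1")
    case False
    with less.prems obtain p c' where "is_prime p" "c' \<in> H" "c' \<noteq> 0" "c = p * c'" "\<not> c dvd c'"
      by (rule prime_divisor)
    then show ?thesis using less.IH[of c'] prime by auto
  qed (use unit less in auto)
qed

text \<open>Strip the primes of \<open>c\<close> one at a time: each divides \<open>w * r\<close>
  but not \<open>w\<close>, hence divides \<open>r\<close> and cancels on both sides.\<close>

lemma dvd_of_coprime:
  assumes "c \<in> H" "c \<noteq> 0" "w \<in> H" "r \<in> H" "c dvd w * r"
    and "\<And>p. is_prime p \<Longrightarrow> p dvd c \<Longrightarrow> \<not> p dvd w"
  shows "c dvd r"
  using assms(1,2,4-)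
proof (induction c arbitrary: r rule: factor_induct)
  case (unit c)
  then show ?case by (meson dvd_trans one_dvd)
next
  case (prime p c)
  have "p dvd w * r" using prime.prems(2) by (rule dvd_mult_left)
  moreover have "\<not> p dvd w" using prime.prems(3)[OF prime.hyps(1)] by simp
  ultimately have "p dvd r"
    using prime_dvd_multD[OF prime.hyps(1) assms(3) prime.prems(1)] by blast
  then obtain r' where r': "r' \<in> H" "r = p * r'"
    using quotient_mem[of p r] prime.hyps(1) prime.prems(1) prime_mem prime_nonzero by blast
  have "p * c dvd p * (w * r')" using prime.prems(2) unfolding r'(2) by (simp only: mult.left_commute)
  then obtain k where "p * (w * r') = p * (c * k)" by (auto simp: mult.assoc)
  then have "c dvd w * r'" unfolding cancel[OF prime_nonzero[OF prime.hyps(1)]] by simp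
  moreover have "\<not> q dvd w" if "is_prime q" "q dvd c" for q
    using prime.prems(3)[OF that(1) dvd_mult[OF that(2)]] .
  ultimately have "c dvd r'" using prime.IH[OF r'(1)] by simp
  then show ?case unfolding r'(2) by (rule mult_dvd_mono[OF dvd_refl])
qed

lemma maximal_common_divisor:
  assumes X: "X \<subseteq> H" "x0 \<in> X" "x0 \<noteq> 0"
  obtains g where "g \<in> H" "g \<noteq> 0" "\<And>x. x \<in> X \<Longrightarrow> g dvd x"
    "\<And>p. is_prime p \<Longrightarrow> \<exists>x\<in>X. \<not> g * p dvd x"
proof -
  \<comment> \<open>\<open>Q\<close> holds the cofactors in \<open>x0\<close> of the common divisors
    of \<open>X\<close>. A minimal cofactor \<open>h\<close> belongs to a maximal common divisor: if
    \<open>g * p\<close> still divided everything, \<open>p\<close> could be moved from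
    \<open>h\<close> to \<open>g\<close>.\<close>
  define Q where "Q = {h \<in> H. \<exists>g\<in>H. x0 = g * h \<and> (\<forall>x\<in>X. g dvd x)}"
  have "x0 \<in> Q" using X one_mem by (auto simp: Q_def intro!: bexI[of _ 1])
  then obtain h where h: "h \<in> Q" "\<And>h'. (h', h) \<in> {(b, a). b dvd a \<and> \<not> a dvd b} \<Longrightarrow> h' \<notin> Q"
    by (rule wfE_min[OF wf_strict_dvd]) blast
  then obtain g where g: "g \<in> H" "x0 = g * h" "\<And>x. x \<in> X \<Longrightarrow> g dvd x" and hH: "h \<in> H"
    by (auto simp: Q_def)
  have nz: "g \<noteq> 0" "h \<noteq> 0" using g X by auto
  have "\<exists>x\<in>X. \<not> g * p dvd x" if p: "is_prime p" for p
  proof (rule ccontr)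
    assume "\<not> (\<exists>x\<in>X. \<not> g * p dvd x)"
    then have *: "\<And>x. x \<in> X \<Longrightarrow> g * p dvd x" by auto
    then obtain k where "g * h = g * (p * k)" using g(2) X(2) by (metis dvdE mult.assoc)
    then have "p dvd h" using cancel[OF nz(1)] by auto
    then obtain h' where h': "h' \<in> H" "h = p * h'"
      using quotient_mem[of p h] p hH prime_mem prime_nonzero by blast
    have "h' \<in> Q" using h' g * mult_mem[OF g(1) prime_mem[OF p]]
      by (auto simp: Q_def mult.assoc intro!: bexI[of _ "g * p"])
    moreover have "\<not> h dvd h'" using strict_dvd_mult[of h' p] h' nz prime_not_unit[OF p] by fastforce
    ultimately show False using h(2)[of h'] h' by auto
  qed
  then show thesis using that g nz by blast
qed

lemma prime_part:
  assumes "is_prime p" "g \<in> H" "g \<noteq> 0"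
  obtains k g' where "g = p ^ k * g'" "g' \<in> H" "g' \<noteq> 0" "\<not> p dvd g'"
proof -
  have "\<exists>k g'. g = p ^ k * g' \<and> g' \<in> H \<and> g' \<noteq> 0 \<and> \<not> p dvd g'"
    using wf_strict_dvd assms(2,3)
  proof (induction g rule: wf_induct_rule)
    case (less g)
    show ?case
    proof (cases "p dvd g")
      case True
      then obtain h where h: "h \<in> H" "g = p * h"
        using quotient_mem[of p g] assms(1) less.prems prime_mem prime_nonzero by blast
      moreover have "\<not> g dvd h"
        using strict_dvd_mult[of h p] h less.prems prime_not_unit[OF assms(1)] by fastforce
      ultimately obtain k g' where "h = p ^ k * g'" "g' \<in> H" "g' \<noteq> 0" "\<not> p dvd g'"
        using less.IH[of h] less.prems by auto
      then show ?thesis using h by (intro exI[of _ "Suc k"] exI[of _ g']) (auto simp: mult.assoc)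
    next
      case False
      then show ?thesis using less.prems by (intro exI[of _ 0] exI[of _ g]) auto
    qed
  qed
  then show thesis using that by blast
qed

end

text \<open>Along an infinite descent the principal ideals would grow strictly, against the
  ascending chain condition.\<close>

lemma wf_strict_dvd_poly: "wf {(b, a :: nat ^ 'n \<Rightarrow>\<^sub>0 'k::field). b dvd a \<and> \<not> a dvd b}"
  unfolding wf_iff_no_infinite_down_chain
proof safe
  fix f :: "nat \<Rightarrow> nat ^ 'n \<Rightarrow>\<^sub>0 'k"
  assume f: "\<forall>i. (f (Suc i), f i) \<in> {(b, a). b dvd a \<and> \<not> a dvd b}"
  have "noetherian_on (UNIV :: (nat ^ 'n \<Rightarrow>\<^sub>0 'k) set)"
    using noetherian_polys_in[of UNIV] by (simp add: polys_in_UNIV)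
  then have "\<exists>N. \<forall>k\<ge>N. {x. f k dvd x} = {x. f N dvd x}"
  proof (rule noetherian_onD)
    show "{x. f k dvd x} \<subseteq> {x. f (Suc k) dvd x}" for k using f by (auto intro: dvd_trans)
  qed (auto simp: ideal_of_def)
  then obtain N where N: "\<forall>k\<ge>N. {x. f k dvd x} = {x. f N dvd x}" ..
  have "{x. f (Suc N) dvd x} = {x. f N dvd x}" by (rule N[rule_format]) (rule le_SucI, rule le_refl)
  then have "f N dvd f (Suc N)" by (metis dvd_refl mem_Collect_eq)
  moreover have "\<not> f N dvd f (Suc N)" using f by simp
  ultimately show False by simp
qed

section \<open>Gradings of the polynomial ring by classes of exponents\<close>

locale exponent_grading =
  fixes rel :: "nat ^ 'n \<Rightarrow> nat ^ 'n \<Rightarrow> bool"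
  assumes equivp_rel: "equivp rel"
    and rel_add_right: "rel (e + g) (f + g) \<longleftrightarrow> rel e f"
begin

text \<open>A degree is a class of exponents modulo \<open>rel\<close>, named by a representative
  \<open>e\<close>; no grading group is formed, and the equivalence in \<open>rel_add_right\<close>
  supplies cancellation. Zero is homogeneous of every degree.\<close>

definition hom_at :: "nat ^ 'n \<Rightarrow> (nat ^ 'n \<Rightarrow>\<^sub>0 'k::field) \<Rightarrow> bool" where
  "hom_at e p \<longleftrightarrow> (\<forall>f\<in>keys p. rel f e)"

definition homs :: "'n set \<Rightarrow> (nat ^ 'n \<Rightarrow>\<^sub>0 'k::field) set" where
  "homs I = {p \<in> polys_in I. \<exists>e. hom_at e p}"

lemma rel_refl: "rel e e" and rel_sym: "rel e f \<Longrightarrow> rel f e" and rel_trans: "rel e f \<Longrightarrow> rel f g \<Longrightarrow> rel e g"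
  using equivp_rel by (auto simp: equivp_reflp elim: equivp_symp equivp_transp)

lemma rel_add_left: "rel (g + e) (g + f) \<longleftrightarrow> rel e f"
  using rel_add_right[of e g f] by (simp add: add.commute)

lemma rel_add: "rel e e' \<Longrightarrow> rel f f' \<Longrightarrow> rel (e + f) (e' + f')"
  by (meson rel_add_left rel_add_right rel_trans)

lemma hom_at_mult: "hom_at e p \<Longrightarrow> hom_at f q \<Longrightarrow> hom_at (e + f) (p * q)"
  unfolding hom_at_def using keys_mult[of p q] rel_add by fastforce

lemma hom_at_diff: "hom_at e p \<Longrightarrow> hom_at e q \<Longrightarrow> hom_at e (p - q)"
  unfolding hom_at_def using keys_diff[of p q] by fastforce

lemma hom_at_0: "hom_at e 0"
  by (simp add: hom_at_def)

lemma homs_0: "0 \<in> homs I" and homs_1: "1 \<in> homs I"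
  by (auto simp: homs_def polys_in_closed hom_at_def rel_refl intro: exI[of _ 0])

lemma homs_mult: "p \<in> homs I \<Longrightarrow> q \<in> homs I \<Longrightarrow> p * q \<in> homs I"
  by (auto simp: homs_def polys_in_closed intro: hom_at_mult)

lemma homs_mono: "I \<subseteq> J \<Longrightarrow> homs I \<subseteq> homs J"
  using polys_in_mono by (auto simp: homs_def)

text \<open>Given \<open>b = a * s\<close>, keep only the terms of \<open>s\<close> that involve
  variables of \<open>I\<close> and complement the degree of \<open>a\<close> to that of
  \<open>b\<close>. Projecting \<open>a * s\<close> to the degree and variables of \<open>b\<close>
  changes nothing, and it acts on \<open>s\<close> alone.\<close>

lemma homs_quotient:
  assumes "a \<in> homs I" "b \<in> homs I" "a \<noteq> 0" "a dvd b"
  shows "\<exists>c\<in>homs I. b = a * c"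
proof (cases "b = 0")
  case True
  then show ?thesis using homs_0 by (intro bexI[of _ 0]) auto
next
  case False
  obtain s where s: "b = a * s" using assms by auto
  obtain ea eb where e: "hom_at ea a" "hom_at eb b" using assms by (auto simp: homs_def)
  define T where "T = {f. rel (ea + f) eb \<and> (\<forall>j. j \<notin> I \<longrightarrow> f $ j = 0)}"
  define B where "B = {g. rel g eb \<and> (\<forall>j. j \<notin> I \<longrightarrow> g $ j = 0)}"
  have "restr B (a * s) = a * restr T s"
  proof (rule restr_mult)
    fix g f assume g: "g \<in> keys a"
    then have "rel (g + f) (ea + f)" using e by (simp add: hom_at_def rel_add_right)
    then have "rel (g + f) eb \<longleftrightarrow> rel (ea + f) eb" by (meson rel_trans rel_sym)
    moreover have "j \<notin> I \<Longrightarrow> g $ j = 0" for j using g assms by (auto simp: homs_def polys_in_def)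
    ultimately show "g + f \<in> B \<longleftrightarrow> f \<in> T" by (auto simp: B_def T_def)
  qed
  moreover have "restr B b = b"
    using e assms by (intro restr_id) (auto simp: B_def hom_at_def homs_def polys_in_def)
  moreover have "restr T s \<in> homs I"
  proof -
    have "\<exists>f0. hom_at f0 (restr T s)"
    proof (cases "restr T s = 0")
      case False
      then obtain f0 where "f0 \<in> keys (restr T s)" by fastforce
      then have "f0 \<in> T" by (auto simp: keys_restr)
      then have "rel f f0" if "f \<in> T" for f using that unfolding T_def
        by (metis (lifting) mem_Collect_eq rel_add_left rel_sym rel_trans)
      then show ?thesis by (auto simp: hom_at_def keys_restr)
    qed (simp add: hom_at_0)
    then show ?thesis by (auto simp: homs_def polys_in_def keys_restr T_def)
  qed
  ultimately show ?thesis using s by metis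
qed

lemma divisibility_monoid_homs: "divisibility_monoid (homs I :: (nat ^ 'n \<Rightarrow>\<^sub>0 'k::field) set)"
proof
  show "a * b = 0 \<Longrightarrow> a = 0 \<or> b = 0" for a b :: "nat ^ 'n \<Rightarrow>\<^sub>0 'k" by (simp add: poly_mult_eq_0_iff)
  show "wf {(b, a :: nat ^ 'n \<Rightarrow>\<^sub>0 'k). b dvd a \<and> \<not> a dvd b}" by (rule wf_strict_dvd_poly)
qed (fact homs_1 homs_mult homs_quotient)+

end

section \<open>Homogeneous polynomials form a factorial monoid\<close>

lemma deg_less_mono: "d \<le> d' \<Longrightarrow> deg_less i d \<subseteq> deg_less i d'"
  by (auto simp: deg_less_def)

lemma (in divisibility_monoid) irredD:
  "irred f \<Longrightarrow> a \<in> H \<Longrightarrow> b \<in> H \<Longrightarrow> f = a * b \<Longrightarrow> a dvd 1 \<or> b dvd 1"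
  by (simp add: irred_def)

lemma var_pow_nonzero: "var_pow (i::'n) d \<noteq> (0 :: nat ^ 'n \<Rightarrow>\<^sub>0 'k::comm_ring_1)"
proof
  assume "var_pow i d = (0 :: nat ^ 'n \<Rightarrow>\<^sub>0 'k::comm_ring_1)"
  then have "lookup (var_pow i d) (axis i d) = (0::'k)" by simp
  then show False by (simp add: var_pow_def)
qed

lemma deg_less_of_coeff_at_0:
  assumes "p \<in> deg_less i (Suc d)" "coeff_at i d p = 0" shows "p \<in> deg_less i d"
  using deg_less_decomp[OF assms(1)] assms(2) by simp

context exponent_grading
begin

lemma hom_at_restr: "hom_at e p \<Longrightarrow> hom_at e (restr T p)"
  by (simp add: hom_at_def keys_restr)

lemma hom_at_unique:
  assumes "hom_at e p" "hom_at f p" "p \<noteq> 0" shows "rel e f"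
proof -
  obtain g where "g \<in> keys p" using assms(3) by fastforce
  then show ?thesis using assms(1,2) rel_sym rel_trans unfolding hom_at_def by blast
qed

lemma hom_at_rel: "hom_at e p \<Longrightarrow> rel e f \<Longrightarrow> hom_at f p"
  using rel_trans unfolding hom_at_def by blast

lemma hom_at_var_pow: "hom_at (axis i d) (var_pow i d)"
  by (auto simp: hom_at_def rel_refl dest!: keys_var_pow)

lemma coeff_at_homs:
  assumes "p \<in> homs (insert i I)" shows "coeff_at i d p \<in> homs I"
proof -
  obtain e where e: "hom_at e p" using assms by (auto simp: homs_def)
  have "\<exists>f. hom_at f (coeff_at i d p)"
  proof (cases "coeff_at i d p = 0")
    case False
    then obtain f where "f \<in> keys (coeff_at i d p)" by fastforce
    then have f: "rel (f + axis i d) e" using e by (simp add: keys_coeff_at hom_at_def)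
    have "hom_at f (coeff_at i d p)"
      unfolding hom_at_def
    proof
      fix g assume "g \<in> keys (coeff_at i d p)"
      then have "rel (g + axis i d) e" using e by (simp add: keys_coeff_at hom_at_def)
      then show "rel g f" using f rel_sym rel_trans rel_add_right by blast
    qed
    then show ?thesis by blast
  qed (simp add: hom_at_0)
  then show ?thesis using assms by (auto simp: homs_def intro: coeff_at_in)
qed

lemma homs_decomp:
  assumes "p \<in> homs (insert i I)"
  shows "p - coeff_at i d p * var_pow i d \<in> homs (insert i I)"
proof -
  obtain e where e: "hom_at e p" using assms by (auto simp: homs_def)
  have "coeff_at i d p * var_pow i d \<in> polys_in (insert i I)"
    using assms by (auto simp: homs_def restr_eq_coeff_at[symmetric] polys_in_def keys_restr)
  moreover have "hom_at e (p - coeff_at i d p * var_pow i d)"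
    using e by (auto simp: restr_eq_coeff_at[symmetric] intro: hom_at_diff hom_at_restr)
  ultimately show ?thesis using assms by (auto simp: homs_def intro: polys_in_diff)
qed

text \<open>Long division by \<open>m\<close> in variable \<open>i\<close>. The leading coefficient
  \<open>l\<close> of \<open>m\<close> need not be a unit, so each round multiplies \<open>u\<close>
  by \<open>l\<close>, and \<open>c\<close> collects these factors. Degrees are carried along
  because the remainder has to be homogeneous again.\<close>

lemma pseudo_division:
  fixes m u :: "nat ^ 'n \<Rightarrow>\<^sub>0 'k::field"
  assumes i: "i \<notin> I" and m: "m \<in> polys_in (insert i I)" "hom_at \<mu> m"
    and deg: "m \<in> deg_less i (Suc e)" "m \<notin> deg_less i e"
    and u: "u \<in> polys_in (insert i I)" "hom_at \<beta> u" "u \<in> deg_less i d"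
  shows "\<exists>c \<gamma> r. c \<in> homs I \<and> c \<noteq> 0 \<and> hom_at \<gamma> c \<and> r \<in> polys_in (insert i I) \<and>
           hom_at (\<gamma> + \<beta>) r \<and> r \<in> deg_less i e \<and> m dvd c * u - r"
  using u
proof (induction d arbitrary: u \<beta>)
  case 0
  then have "u \<in> deg_less i e" using deg_less_mono[of 0 e i] by auto
  then show ?case
    using 0 homs_1 by (intro exI[of _ 1] exI[of _ 0] exI[of _ u]) (auto simp: hom_at_def rel_refl)
next
  case (Suc d)
  show ?case
  proof (cases "Suc d \<le> e")
    case True
    then have "u \<in> deg_less i e" using Suc.prems deg_less_mono[of "Suc d" e i] by auto
    then show ?thesis
      using Suc.prems homs_1 by (intro exI[of _ 1] exI[of _ 0] exI[of _ u]) (auto simp: hom_at_def rel_refl)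
  next
    case False
    \<comment> \<open>In this case \<open>e \<le> d\<close>, so the truncated subtraction is
      exact.\<close>
    then have ed: "d = d - e + e" by simp
    define l k where "l = coeff_at i e m" and "k = coeff_at i d u"
    define v where "v = k * var_pow i (d - e)"
    \<comment> \<open>The top terms of \<open>l * u\<close> and \<open>v * m\<close> agree and
      cancel. Both products have degree \<open>a + \<beta>\<close>: for the second one,
      \<open>rel\<mu>\<close> and \<open>rel\<beta>\<close> read the degrees of \<open>m\<close> and
      \<open>u\<close> off their top terms.\<close>
    define u1 where "u1 = l * u - v * m"
    have lI: "l \<in> homs I" and kI: "k \<in> homs I"
      using m Suc.prems by (auto simp: l_def k_def homs_def intro!: coeff_at_homs[unfolded homs_def mem_Collect_eq])
    then obtain a b where a: "hom_at a l" and b: "hom_at b k" by (auto simp: homs_def)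
    have lP: "l \<in> polys_in I" and kP: "k \<in> polys_in I" using lI kI by (auto simp: homs_def)
    have l0: "l \<noteq> 0" using deg deg_less_of_coeff_at_0 by (auto simp: l_def)
    have "hom_at \<mu> (l * var_pow i e)"
      unfolding l_def restr_eq_coeff_at[symmetric] using m by (intro hom_at_restr)
    moreover have "hom_at (a + axis i e) (l * var_pow i e)"
      using a hom_at_var_pow by (rule hom_at_mult)
    moreover have nz: "c * var_pow i j \<noteq> 0" if "c \<noteq> 0" for c :: "nat ^ 'n \<Rightarrow>\<^sub>0 'k" and j
      using that by (simp add: poly_mult_eq_0_iff var_pow_nonzero)
    ultimately have rel\<mu>: "rel \<mu> (a + axis i e)" using l0 hom_at_unique by blast
    have vm: "hom_at (a + \<beta>) (v * m)"
    proof (cases "k = 0")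
      case False
      have "hom_at \<beta> (k * var_pow i d)"
        unfolding k_def restr_eq_coeff_at[symmetric] using Suc.prems by (intro hom_at_restr)
      moreover have "hom_at (b + axis i d) (k * var_pow i d)"
        using b hom_at_var_pow by (rule hom_at_mult)
      ultimately have rel\<beta>: "rel (b + axis i d) \<beta>" using nz[OF False] hom_at_unique by blast
      have "hom_at (b + axis i (d - e) + \<mu>) (v * m)"
        unfolding v_def using b hom_at_var_pow m by (intro hom_at_mult)
      moreover have "rel (b + axis i (d - e) + \<mu>) (b + axis i (d - e) + (a + axis i e))"
        using rel\<mu> by (simp add: rel_add_left)
      moreover have "b + axis i (d - e) + (a + axis i e) = a + (b + axis i d)"
        using ed by (simp add: vec_eq_iff axis_def)
      moreover have "rel (a + (b + axis i d)) (a + \<beta>)" using rel\<beta> by (simp add: rel_add_left)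
      ultimately show ?thesis by (metis hom_at_rel)
    qed (simp add: v_def hom_at_0)
    have u1h: "hom_at (a + \<beta>) u1"
      unfolding u1_def using hom_at_diff[OF hom_at_mult[OF a Suc.prems(2)] vm] .
    have sub: "polys_in I \<subseteq> polys_in (insert i I)" by (intro polys_in_mono) auto
    have u1P: "u1 \<in> polys_in (insert i I)"
      unfolding u1_def v_def using lP kP sub m Suc.prems
      by (intro polys_in_closed var_pow_in) auto
    have vd: "v \<in> deg_less i (Suc (d - e))"
      unfolding v_def using kP i by (intro mult_const_deg_less) (auto simp: deg_less_def dest!: keys_var_pow)
    have "v * m \<in> deg_less i (Suc (d - e) + e)"
      using vd deg by (intro deg_less_mult) (auto simp: deg_less_def)
    moreover have "l * u \<in> deg_less i (Suc d)"
      using lP i Suc.prems by (intro mult_const_deg_less)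
    ultimately have "u1 \<in> deg_less i (Suc d)"
      unfolding u1_def using ed by (intro deg_less_diff) auto
    moreover have "coeff_at i d u1 = 0"
    proof -
      have "coeff_at i (d - e + e) (v * m) = coeff_at i (d - e) v * l"
        unfolding l_def using vd deg by (intro coeff_at_mult)
      moreover have "coeff_at i (d - e) v = k"
        unfolding v_def using polys_in_keys[OF kP i] by (rule coeff_at_var_pow)
      ultimately show ?thesis
        unfolding u1_def coeff_at_diff coeff_at_mult_in[OF lP i] using ed
        by (simp add: k_def[symmetric] mult.commute)
    qed
    ultimately have "u1 \<in> deg_less i d" by (rule deg_less_of_coeff_at_0)
    from Suc.IH[OF u1P u1h this] obtain c \<gamma> r where c: "c \<in> homs I" "c \<noteq> 0" "hom_at \<gamma> c"
      "r \<in> polys_in (insert i I)" "hom_at (\<gamma> + (a + \<beta>)) r" "r \<in> deg_less i e" "m dvd c * u1 - r"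
      by blast
    have eq: "c * l * u - r = c * u1 - r + m * (c * v)"
      by (simp add: u1_def algebra_simps)
    have "m dvd c * l * u - r" unfolding eq by (rule dvd_add[OF c(7) dvd_triv_left])
    moreover have "hom_at (\<gamma> + a + \<beta>) r" using c(5) by (simp add: add.assoc)
    moreover have "c * l \<noteq> 0" using c l0 by (simp add: poly_mult_eq_0_iff)
    ultimately show ?thesis
      using c homs_mult[OF c(1) lI] hom_at_mult[OF c(3) a] by blast
  qed
qed

end

text \<open>The parameter \<open>K\<close> only fixes the field of coefficients.\<close>

locale grading_step = exponent_grading rel
  for rel :: "nat ^ 'n \<Rightarrow> nat ^ 'n \<Rightarrow> bool" +
  fixes i :: 'n and I :: "'n set" and K :: "'k::field itself"
  assumes i: "i \<notin> I"
    and factorial: "factorial_monoid (homs I :: (nat ^ 'n \<Rightarrow>\<^sub>0 'k) set)"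
begin

interpretation A: factorial_monoid "homs I :: (nat ^ 'n \<Rightarrow>\<^sub>0 'k) set"
  by (rule factorial)

interpretation B: divisibility_monoid "homs (insert i I) :: (nat ^ 'n \<Rightarrow>\<^sub>0 'k) set"
  by (rule divisibility_monoid_homs)

lemma homs_sub: "p \<in> homs I \<Longrightarrow> p \<in> homs (insert i I)"
  using homs_mono[of I "insert i I"] by auto

text \<open>Gauss's lemma: if \<open>p\<close> divides \<open>a * b\<close>, it divides the product
  of the leading coefficients in variable \<open>i\<close>, hence one of them. Removing that leading
  term lowers the sum of the degree bounds, on which the induction runs.\<close>

lemma prime_lift:
  assumes p: "A.is_prime p" shows "B.is_prime p"
proof -
  have pI: "p \<in> polys_in I" using A.prime_mem[OF p] by (simp add: homs_def)
  have "p dvd a \<or> p dvd b"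
    if "a \<in> homs (insert i I)" "b \<in> homs (insert i I)" "p dvd a * b"
      "a \<in> deg_less i d" "b \<in> deg_less i d'" for a b d d'
    using that
  proof (induction "d + d'" arbitrary: a b d d' rule: less_induct)
    case less
    show ?case
    proof (cases "d = 0 \<or> d' = 0")
      case True
      then show ?thesis using less.prems by (auto simp: deg_less_zero_iff)
    next
      case False
      then obtain j j' where j: "d = Suc j" "d' = Suc j'" by (meson not0_implies_Suc)
      define c t where "c = coeff_at i j a" and "t = a - c * var_pow i j"
      define c' t' where "c' = coeff_at i j' b" and "t' = b - c' * var_pow i j'"
      have t: "t \<in> deg_less i j" "t \<in> homs (insert i I)" and t': "t' \<in> deg_less i j'" "t' \<in> homs (insert i I)"
        using less.prems j deg_less_decomp homs_decomp by (auto simp: t_def t'_def c_def c'_def)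
      obtain s where s: "a * b = p * s" using less.prems by auto
      have "c * c' = coeff_at i (j + j') (p * s)"
        unfolding c_def c'_def s[symmetric] using less.prems j by (intro coeff_at_mult[symmetric]) auto
      then have "p dvd c * c'" by (simp add: coeff_at_mult_in[OF pI i])
      moreover have "c \<in> homs I" "c' \<in> homs I"
        using less.prems by (auto simp: c_def c'_def coeff_at_homs)
      ultimately consider "p dvd c" | "p dvd c'" using A.prime_dvd_multD[OF p] by blast
      then show ?thesis
      proof cases
        case 1
        then have "p dvd t * b" using less.prems(3) by (simp add: t_def left_diff_distrib mult.assoc)
        then have "p dvd t \<or> p dvd b"
          using less.hyps[of j d' t b] less.prems t j by auto
        moreover have "p dvd a" if "p dvd t"
          using dvd_add[OF that dvd_mult2[OF 1, of "var_pow i j"]] by (simp add: t_def)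
        ultimately show ?thesis by blast
      next
        case 2
        then have "p dvd a * t'" using less.prems(3) by (simp add: t'_def right_diff_distrib)
        then have "p dvd a \<or> p dvd t'"
          using less.hyps[of d j' a t'] less.prems t' j by auto
        moreover have "p dvd b" if "p dvd t'"
          using dvd_add[OF that dvd_mult2[OF 2, of "var_pow i j'"]] by (simp add: t'_def)
        ultimately show ?thesis by blast
      qed
    qed
  qed
  then have "p dvd a \<or> p dvd b"
    if "a \<in> homs (insert i I)" "b \<in> homs (insert i I)" "p dvd a * b" for a b
    using that deg_less_exists[of a i] deg_less_exists[of b i] by blast
  then show ?thesis
    using homs_sub[OF A.prime_mem[OF p]] A.prime_nonzero[OF p] A.prime_not_unit[OF p]
    unfolding B.is_prime_def by blast
qed

text \<open>Cancel the primes of \<open>c\<close> from \<open>c * g = f * v\<close> one by one: each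
  remains prime after adjoining the variable and does not divide \<open>f\<close>, so it divides
  \<open>v\<close>.\<close>

lemma dvd_of_const_mult:
  fixes c f g :: "nat ^ 'n \<Rightarrow>\<^sub>0 'k"
  assumes "c \<in> homs I" "c \<noteq> 0" "f \<in> homs (insert i I)" "f \<noteq> 0" "g \<in> homs (insert i I)" "f dvd c * g"
    and coprime: "\<And>p. A.is_prime p \<Longrightarrow> \<not> p dvd f"
  shows "f dvd g"
  using assms(1,2,6)
proof (induction c rule: A.factor_induct)
  case (unit c)
  then obtain c' where "1 = c * c'" by auto
  then have "g = c' * (c * g)" by (simp add: mult.assoc[symmetric] mult.commute)
  then show ?case using unit by (metis dvd_mult)
next
  case (prime p c)
  have pB: "B.is_prime p" using prime.hyps(1) by (rule prime_lift)
  have cg: "c * g \<in> homs (insert i I)" using B.mult_mem[OF homs_sub[OF prime.hyps(2)] assms(5)] .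
  then have "p * c * g \<in> homs (insert i I)"
    using B.mult_mem[OF B.prime_mem[OF pB] cg] by (simp add: mult.assoc)
  then obtain v where v: "v \<in> homs (insert i I)" "p * c * g = f * v"
    using B.quotient_mem[OF assms(3) _ assms(4) prime.prems] by blast
  have "p dvd f * v" unfolding v(2)[symmetric] by (simp add: mult.assoc)
  then have "p dvd v" using B.prime_dvd_multD[OF pB assms(3) v(1)] coprime[OF prime.hyps(1)] by blast
  then obtain v' where "v = p * v'" by auto
  then have "p * (c * g) = p * (f * v')" using v(2) by (simp only: mult.assoc mult.left_commute[of f p])
  then have "c * g = f * v'" unfolding B.cancel[OF B.prime_nonzero[OF pB]] .
  then show ?case using prime.IH by simp
qed

text \<open>Each prime of \<open>c\<close> divides \<open>m\<close> or \<open>q\<close> and is moved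
  into \<open>c1\<close> or \<open>c2\<close>. What remains is a factorization of \<open>f\<close>
  itself, to which irreducibility of \<open>f\<close> can be applied.\<close>

lemma strip_const:
  fixes c m q f :: "nat ^ 'n \<Rightarrow>\<^sub>0 'k"
  assumes "c \<in> homs I" "c \<noteq> 0" "m \<in> homs (insert i I)" "q \<in> homs (insert i I)" "c * f = m * q"
  shows "\<exists>m' q' c1 c2. m' \<in> homs (insert i I) \<and> q' \<in> homs (insert i I) \<and> c1 \<in> homs I \<and> c1 \<noteq> 0 \<and>
           m = c1 * m' \<and> q = c2 * q' \<and> f = m' * q'"
  using assms
proof (induction c arbitrary: m q rule: A.factor_induct)
  case (unit c)
  then obtain c' where c': "c' \<in> homs I" "1 = c * c'"
    using A.quotient_mem[OF unit(1) A.one_mem] by fastforce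
  have "f = c' * (c * f)" using c'(2) by (simp add: mult.assoc[symmetric] mult.commute)
  then have "f = (c' * m) * q" using unit by (simp add: mult.assoc)
  moreover have "m = c * (c' * m)" using c'(2) by (simp add: mult.assoc[symmetric])
  moreover have "c' * m \<in> homs (insert i I)" using B.mult_mem[OF homs_sub[OF c'(1)] unit(3)] .
  moreover have "c \<noteq> 0" using c'(2) by auto
  ultimately show ?case
    using unit by (intro exI[of _ "c' * m"] exI[of _ q] exI[of _ c] exI[of _ 1]) auto
next
  case (prime p c)
  have pB: "B.is_prime p" using prime.hyps(1) by (rule prime_lift)
  have p0: "p \<noteq> 0" and pI: "p \<in> homs I"
    using prime.hyps(1) A.prime_nonzero A.prime_mem by blast+
  have "p dvd m * q" unfolding prime.prems(3)[symmetric] by (simp add: mult.assoc)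
  then consider "p dvd m" | "p dvd q" using B.prime_dvd_multD[OF pB prime.prems(1,2)] by blast
  then show ?case
  proof cases
    case 1
    then obtain m0 where m0: "m0 \<in> homs (insert i I)" "m = p * m0"
      using B.quotient_mem[OF homs_sub[OF pI] prime.prems(1) p0] by blast
    have "p * (c * f) = p * (m0 * q)"
      using prime.prems(3) unfolding m0(2) by (simp only: mult.assoc)
    then have "c * f = m0 * q" unfolding B.cancel[OF p0] .
    from prime.IH[OF m0(1) prime.prems(2) this] obtain m' q' c1 c2 where "m' \<in> homs (insert i I)" "q' \<in> homs (insert i I)" "c1 \<in> homs I" "c1 \<noteq> 0"
      "m0 = c1 * m'" "q = c2 * q'" "f = m' * q'"
      by blast
    moreover from this have "m = p * c1 * m'" unfolding m0(2) by (simp only: mult.assoc)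
    ultimately show ?thesis
      using A.mult_mem[OF pI] p0 poly_mult_eq_0_iff[of p c1] by blast
  next
    case 2
    then obtain q0 where q0: "q0 \<in> homs (insert i I)" "q = p * q0"
      using B.quotient_mem[OF homs_sub[OF pI] prime.prems(2) p0] by blast
    have "p * (c * f) = p * (m * q0)"
      using prime.prems(3) unfolding q0(2) by (simp only: mult.assoc mult.left_commute[of m p])
    then have "c * f = m * q0" unfolding B.cancel[OF p0] .
    from prime.IH[OF prime.prems(1) q0(1) this] obtain m' q' c1 c2 where "m' \<in> homs (insert i I)" "q' \<in> homs (insert i I)" "c1 \<in> homs I" "c1 \<noteq> 0"
      "m = c1 * m'" "q0 = c2 * q'" "f = m' * q'"
      by blast
    moreover from this have "q = p * c2 * q'" unfolding q0(2) by (simp only: mult.assoc)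
    ultimately show ?thesis by blast
  qed
qed

text \<open>If no prime of \<open>homs I\<close> divides \<open>f\<close> and \<open>f\<close> divides \<open>g h\<close>, take a nonzero \<open>m\<close> of least
  degree among the \<open>u\<close> with \<open>f\<close> dividing \<open>u h\<close>. Pseudo-division by \<open>m\<close> shows that \<open>m\<close> divides \<open>f\<close> up
  to a coefficient, so that \<open>m\<close> is associated to \<open>f\<close> or to \<open>1\<close> up to a coefficient.\<close>

lemma prime_of_irred_step:
  assumes f: "B.irred f" shows "B.is_prime f"
proof (cases "\<exists>p. A.is_prime p \<and> p dvd f")
  \<comment> \<open>A prime \<open>p\<close> of \<open>homs I\<close> dividing the irreducible
    \<open>f\<close> leaves a unit as cofactor, so \<open>f\<close> is an associate of
    \<open>p\<close>, which is prime by \<open>prime_lift\<close>.\<close>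
  case True
  then obtain p where p: "A.is_prime p" "p dvd f" by blast
  then have pB: "B.is_prime p" using prime_lift by blast
  have fH: "f \<in> homs (insert i I)" using f by (simp add: B.irred_def)
  obtain f' where f': "f' \<in> homs (insert i I)" "f = p * f'"
    using B.quotient_mem[OF B.prime_mem[OF pB] fH B.prime_nonzero[OF pB] p(2)] by blast
  then have "f' dvd 1"
    using B.irredD[OF f B.prime_mem[OF pB] f'(1)] f'(2) B.prime_not_unit[OF pB] by simp
  then obtain w where "1 = f' * w" by auto
  then have "p = f * w" using f'(2) by (simp add: mult.assoc)
  then have "f dvd p" by simp
  then show ?thesis using B.prime_of_associated[OF pB fH p(2)] by blast
next
  case False
  then have coprime: "\<not> p dvd f" if "A.is_prime p" for p using that by blast
  have fH: "f \<in> homs (insert i I)" and f0: "f \<noteq> 0" and fu: "\<not> f dvd 1" using f by (auto simp: B.irred_def)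
  have "f dvd g \<or> f dvd h" if g: "g \<in> homs (insert i I)" and h: "h \<in> homs (insert i I)" and "f dvd g * h" for g h
  proof -
    define J where "J = {u \<in> homs (insert i I). f dvd u * h}"
    have gJ: "g \<in> J" and fJ: "f \<in> J" using that fH by (auto simp: J_def)
    have "\<exists>e. \<exists>m\<in>J. m \<noteq> 0 \<and> m \<in> deg_less i (Suc e)"
      using fJ f0 deg_less_Suc_cases[OF f0] by metis
    then obtain e where e: "\<exists>m\<in>J. m \<noteq> 0 \<and> m \<in> deg_less i (Suc e)"
      and e_min: "\<And>e'. e' < e \<Longrightarrow> \<not> (\<exists>m\<in>J. m \<noteq> 0 \<and> m \<in> deg_less i (Suc e'))"
      using exists_least_iff[of "\<lambda>e. \<exists>m\<in>J. m \<noteq> 0 \<and> m \<in> deg_less i (Suc e)"] by auto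
    then obtain m where m: "m \<in> J" "m \<noteq> 0" "m \<in> deg_less i (Suc e)" by blast
    \<comment> \<open>By minimality of \<open>e\<close> no nonzero member of \<open>J\<close> has
      smaller degree; for \<open>e = 0\<close> the degree bound alone forces
      \<open>r = 0\<close>.\<close>
    have zero: "r = 0" if "r \<in> J" "r \<in> deg_less i e" for r
      using e_min[of "e - 1"] that by (cases e) (auto simp: deg_less_zero_iff)
    have mdeg: "m \<notin> deg_less i e" using zero m by blast
    have mH: "m \<in> homs (insert i I)" using m by (simp add: J_def)
    then obtain \<mu> where \<mu>: "hom_at \<mu> m" and mP: "m \<in> polys_in (insert i I)" by (auto simp: homs_def)
    have div: "\<exists>c\<in>homs I. c \<noteq> 0 \<and> m dvd c * u" if u: "u \<in> J" for u
    proof -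
      obtain \<beta> d where \<beta>: "hom_at \<beta> u" "u \<in> polys_in (insert i I)" "u \<in> deg_less i d"
        using u deg_less_exists[of u i] by (auto simp: J_def homs_def)
      from pseudo_division[OF i mP \<mu> m(3) mdeg \<beta>(2,1,3)] obtain c \<gamma> r where
        c: "c \<in> homs I" "c \<noteq> 0" "r \<in> polys_in (insert i I)" "hom_at (\<gamma> + \<beta>) r" "r \<in> deg_less i e"
          "m dvd c * u - r" by blast
      obtain q where q: "c * u - r = m * q" using c(6) by auto
      then have r: "r = c * u - m * q" by (simp add: algebra_simps)
      have "r * h = c * (u * h) - q * (m * h)" unfolding r by (simp add: algebra_simps)
      moreover have "f dvd c * (u * h) - q * (m * h)"
        using u m(1) unfolding J_def by (blast intro: dvd_diff dvd_mult)
      ultimately have "r \<in> J" using c by (auto simp: J_def homs_def)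
      then have "r = 0" using c zero by blast
      then show ?thesis using c by auto
    qed
    obtain c where c: "c \<in> homs I" "c \<noteq> 0" "m dvd c * f" using div[OF fJ] by blast
    have "c * f \<in> homs (insert i I)" using B.mult_mem[OF homs_sub[OF c(1)] fH] .
    then obtain q where q: "q \<in> homs (insert i I)" "c * f = m * q"
      using B.quotient_mem[OF mH _ m(2) c(3)] by blast
    obtain m' q' c1 c2 where s: "m' \<in> homs (insert i I)" "q' \<in> homs (insert i I)" "c1 \<in> homs I" "c1 \<noteq> 0"
      "m = c1 * m'" "q = c2 * q'" "f = m' * q'"
      using strip_const[OF c(1,2) mH q] by blast
    have "m' dvd 1 \<or> q' dvd 1" using B.irredD[OF f s(1,2,7)] .
    then show ?thesis
    proof
      assume "q' dvd 1"
      then obtain w where "1 = q' * w" by auto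
      then have "m' = f * w" using s(7) by (simp add: mult.assoc)
      then have "f dvd m" using s(5) by simp
      moreover obtain d where d: "d \<in> homs I" "d \<noteq> 0" "m dvd d * g" using div[OF gJ] by blast
      ultimately have "f dvd d * g" using dvd_trans by blast
      then have "f dvd g" using dvd_of_const_mult[OF d(1,2) fH f0 g] coprime by blast
      then show ?thesis ..
    next
      assume "m' dvd 1"
      then obtain w where w: "1 = m' * w" by auto
      have "f dvd c1 * m' * h" using m(1) s(5) by (simp add: J_def)
      then have "f dvd w * (c1 * m' * h)" by (rule dvd_mult)
      also have "w * (c1 * m' * h) = (m' * w) * (c1 * h)" by (simp only: ac_simps)
      finally have "f dvd c1 * h" using w by simp
      then have "f dvd h" using dvd_of_const_mult[OF s(3,4) fH f0 h] coprime by blast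
      then show ?thesis ..
    qed
  qed
  then show ?thesis using fH f0 fu by (auto simp: B.is_prime_def)
qed

lemma factorial_step: "factorial_monoid (homs (insert i I) :: (nat ^ 'n \<Rightarrow>\<^sub>0 'k) set)"
  by unfold_locales (rule prime_of_irred_step)

end

context exponent_grading
begin

lemma factorial_homs:
  assumes "finite I" shows "factorial_monoid (homs I :: (nat ^ 'n \<Rightarrow>\<^sub>0 'k::field) set)"
  using assms
proof (induction I rule: finite_induct)
  case empty
  interpret divisibility_monoid "homs {} :: (nat ^ 'n \<Rightarrow>\<^sub>0 'k) set"
    by (rule divisibility_monoid_homs)
  show ?case
  proof unfold_locales
    \<comment> \<open>Elements of \<open>homs {}\<close> are constants, and nonzero constants are
      units: the assumption \<open>irred f\<close> is contradictory.\<close>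
    fix f :: "nat ^ 'n \<Rightarrow>\<^sub>0 'k" assume f: "irred f"
    then have "f \<in> homs {}" unfolding irred_def by blast
    then have "f \<in> polys_in {}" by (simp add: homs_def)
    then obtain k where k: "f = Poly_Mapping.single 0 k" using polys_in_empty by blast
    then have "k \<noteq> 0" using f by (auto simp: irred_def)
    then have "1 = f * Poly_Mapping.single 0 (inverse k)" unfolding k by (simp add: mult_single)
    then have "f dvd 1" by (rule dvdI)
    then show "is_prime f" using f by (simp add: irred_def)
  qed
next
  case (insert i I)
  interpret grading_step rel i I "TYPE('k)"
    by (intro grading_step.intro grading_step_axioms.intro exponent_grading_axioms insert.hyps insert.IH)
  show ?case by (rule factorial_step)
qed

end

section \<open>Rings covered by a factorial monoid\<close>

lemma (in cring) colon_ideal: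
  assumes "ideal q R" "u \<in> carrier R"
  shows "ideal {r \<in> carrier R. r \<otimes> u \<in> q} R"
proof -
  interpret ideal q R by fact
  show ?thesis
  proof (rule idealI)
    show "subgroup {r \<in> carrier R. r \<otimes> u \<in> q} (add_monoid R)"
      by (rule add.subgroupI) (use assms in \<open>auto simp: l_distr l_minus zero_closed a_inv_def[symmetric]\<close>)
    fix r x assume r: "r \<in> {r \<in> carrier R. r \<otimes> u \<in> q}" and x: "x \<in> carrier R"
    then have "x \<otimes> r \<otimes> u = x \<otimes> (r \<otimes> u)" using assms by (simp add: m_assoc)
    also have "\<dots> \<in> q" using r x I_l_closed by blast
    finally show "x \<otimes> r \<in> {r \<in> carrier R. r \<otimes> u \<in> q}" using r x by simp
    then show "r \<otimes> x \<in> {r \<in> carrier R. r \<otimes> u \<in> q}" using r x by (simp add: m_comm)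
  qed (rule ring_axioms)
qed

lemma (in ideal) rcos_eq_iff: "x \<in> carrier R \<Longrightarrow> I +> x = I \<longleftrightarrow> x \<in> I"
  using a_coset_join1[of I x] a_coset_join2[of x I] a_subgroup additive_subgroup.a_subset[OF is_additive_subgroup]
  by (auto simp: additive_subgroup.a_subgroup)

text \<open>The model is a ring graded by a group killed by \<open>D\<close>, with \<open>R\<close>
  embedded by \<open>\<theta>\<close> as the part of degree 0 and \<open>H\<close> the homogeneous
  elements. Degrees are visible only through membership in the image: in \<open>same_degree\<close>,
  both \<open>h\<close> and \<open>s\<close> have the degree inverse to that of \<open>g\<close>, so
  \<open>h ^ (D - 1) * s\<close> has \<open>D\<close> times the degree of \<open>h\<close>, which is
  0.\<close>

locale graded_cover = cring R + factorial_monoid H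
  for R :: "('a, 'r) ring_scheme" (structure) and H :: "'b::comm_ring_1 set" +
  fixes \<theta> :: "'a \<Rightarrow> 'b" and D :: nat
  assumes \<theta>_add: "x \<in> carrier R \<Longrightarrow> y \<in> carrier R \<Longrightarrow> \<theta> (x \<oplus> y) = \<theta> x + \<theta> y"
    and \<theta>_mult: "x \<in> carrier R \<Longrightarrow> y \<in> carrier R \<Longrightarrow> \<theta> (x \<otimes> y) = \<theta> x * \<theta> y"
    and \<theta>_one: "\<theta> \<one> = 1"
    and \<theta>_inj: "inj_on \<theta> (carrier R)"
    and \<theta>_mem: "x \<in> carrier R \<Longrightarrow> \<theta> x \<in> H"
    and D_pos: "0 < D"
    and power_D: "h \<in> H \<Longrightarrow> h ^ D \<in> \<theta> ` carrier R"
    and same_degree: "g \<in> H \<Longrightarrow> h \<in> H \<Longrightarrow> s \<in> H \<Longrightarrow> g \<noteq> 0 \<Longrightarrow> h \<noteq> 0 \<Longrightarrow>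
      g * h \<in> \<theta> ` carrier R \<Longrightarrow> g * s \<in> \<theta> ` carrier R \<Longrightarrow> h ^ (D - 1) * s \<in> \<theta> ` carrier R"
    and noetherian: "(\<And>k::nat. ideal (J k) R) \<Longrightarrow> (\<And>k. J k \<subseteq> J (Suc k)) \<Longrightarrow> \<exists>N. \<forall>k\<ge>N. J k = J N"
begin

lemma \<theta>_zero: "\<theta> \<zero> = 0"
  using \<theta>_add[of \<zero> \<zero>] by simp

lemma \<theta>_eq_iff: "x \<in> carrier R \<Longrightarrow> y \<in> carrier R \<Longrightarrow> \<theta> x = \<theta> y \<longleftrightarrow> x = y"
  using \<theta>_inj by (auto simp: inj_on_def)

lemma \<theta>_eq_0_iff: "x \<in> carrier R \<Longrightarrow> \<theta> x = 0 \<longleftrightarrow> x = \<zero>"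
  using \<theta>_eq_iff[of x \<zero>] \<theta>_zero by simp

lemma \<theta>_minus: "x \<in> carrier R \<Longrightarrow> \<theta> (\<ominus> x) = - \<theta> x"
  using \<theta>_add[of x "\<ominus> x"] \<theta>_zero by (simp add: r_neg eq_neg_iff_add_eq_0 add.commute)

lemma \<theta>_pow: "x \<in> carrier R \<Longrightarrow> \<theta> (x [^] (n::nat)) = \<theta> x ^ n"
  by (induction n) (simp_all add: \<theta>_one \<theta>_mult mult.commute)

lemma wf_ideals: "wf {(J, I). ideal I R \<and> ideal J R \<and> I \<subset> J}"
  unfolding wf_iff_no_infinite_down_chain
proof safe
  fix f assume f: "\<forall>i. (f (Suc i), f i) \<in> {(J, I). ideal I R \<and> ideal J R \<and> I \<subset> J}"
  then have "\<exists>N. \<forall>k\<ge>N. f k = f N" by (intro noetherian) auto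
  then obtain N where N: "\<forall>k\<ge>N. f k = f N" ..
  have "f (Suc N) = f N" by (rule N[rule_format]) simp
  then show False using f[rule_format, of N] by simp
qed

text \<open>A maximal one among the annihilators modulo \<open>q\<close> of those multiples of
  \<open>u\<close> that lie outside \<open>q\<close> is prime. The freedom to start from any
  \<open>u\<close> outside \<open>q\<close> is what the applications use.\<close>

lemma associated_prime_exists:
  assumes q: "ideal q R" and u: "u \<in> carrier R" "u \<notin> q"
  obtains v where "v \<in> carrier R" "u \<otimes> v \<notin> q" "{r \<in> carrier R. r \<otimes> (u \<otimes> v) \<in> q} \<in> Ass R q"
proof -
  interpret q: ideal q R by fact
  define col where "col w = {r \<in> carrier R. r \<otimes> w \<in> q}" for w
  have col: "ideal (col w) R" if "w \<in> carrier R" for w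
    using colon_ideal[OF q that] by (simp add: col_def)
  define Q where "Q = {col (u \<otimes> v) | v. v \<in> carrier R \<and> u \<otimes> v \<notin> q}"
  have "col (u \<otimes> \<one>) \<in> Q" using u by (auto simp: Q_def intro!: exI[of _ \<one>])
  then obtain P where P: "P \<in> Q" "\<And>J. (J, P) \<in> {(J, I). ideal I R \<and> ideal J R \<and> I \<subset> J} \<Longrightarrow> J \<notin> Q"
    by (rule wfE_min[OF wf_ideals]) blast
  then obtain v where v: "v \<in> carrier R" "u \<otimes> v \<notin> q" "P = col (u \<otimes> v)" by (auto simp: Q_def)
  \<comment> \<open>A further factor \<open>a\<close> can only enlarge the annihilator, so
    maximality keeps it equal to \<open>P\<close>.\<close>
  have P_max: "col (u \<otimes> v \<otimes> a) = P" if a: "a \<in> carrier R" "u \<otimes> v \<otimes> a \<notin> q" for a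
  proof -
    have "P \<subseteq> col (u \<otimes> v \<otimes> a)"
      using u v a q.I_r_closed by (auto simp: col_def m_assoc[symmetric])
    moreover have "col (u \<otimes> v \<otimes> a) \<in> Q"
      using u v a by (auto simp: Q_def m_assoc intro!: exI[of _ "v \<otimes> a"])
    ultimately show ?thesis
      using P(2)[of "col (u \<otimes> v \<otimes> a)"] u v a col by auto
  qed
  have "primeideal P R"
  proof (rule primeidealI)
    show "ideal P R" using u v col by simp
    have "\<one> \<notin> P" using u v by (simp add: col_def)
    then show "carrier R \<noteq> P" using one_closed by blast
    fix a b assume ab: "a \<in> carrier R" "b \<in> carrier R" "a \<otimes> b \<in> P"
    show "a \<in> P \<or> b \<in> P"
    proof (rule disjCI)
      assume "b \<notin> P"
      then have "u \<otimes> v \<otimes> b \<notin> q" using ab u v by (simp add: col_def m_comm)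
      from P_max[OF ab(2) this] have "P = col (u \<otimes> v \<otimes> b)" by simp
      moreover have "a \<otimes> (u \<otimes> v \<otimes> b) = a \<otimes> b \<otimes> (u \<otimes> v)"
        using ab u v by (simp add: m_ac)
      ultimately show "a \<in> P" using ab v(3) by (auto simp: col_def)
    qed
  qed (rule is_cring)
  moreover have "P = {r \<in> carrier R. (q +> r) \<otimes>\<^bsub>R Quot q\<^esub> (q +> (u \<otimes> v)) = \<zero>\<^bsub>R Quot q\<^esub>}"
  proof -
    have "(q +> r) \<otimes>\<^bsub>R Quot q\<^esub> (q +> (u \<otimes> v)) = \<zero>\<^bsub>R Quot q\<^esub> \<longleftrightarrow> r \<otimes> (u \<otimes> v) \<in> q"
      if "r \<in> carrier R" for r
      using that u v q.rcoset_mult_add[of r "u \<otimes> v"] q.rcos_eq_iff by (simp add: FactRing_def)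
    then show ?thesis unfolding v(3) col_def by blast
  qed
  moreover have "q +> (u \<otimes> v) \<in> carrier (R Quot q)"
    using u v by (auto simp: FactRing_def A_RCOSETS_def')
  ultimately have "P \<in> Ass R q" unfolding Ass_def by blast
  then show thesis using that v by (simp add: col_def)
qed

definition contr :: "'b \<Rightarrow> 'a set" where
  "contr p = {r \<in> carrier R. p dvd \<theta> r}"

lemma contr_ideal: "ideal (contr p) R"
proof (rule idealI)
  show "subgroup (contr p) (add_monoid R)"
    by (rule add.subgroupI)
      (auto simp: contr_def \<theta>_add \<theta>_zero \<theta>_minus a_inv_def[symmetric] intro: exI[of _ \<zero>])
qed (auto simp: contr_def \<theta>_mult ring_axioms)

lemma contr_prime:
  assumes "is_prime p" shows "primeideal (contr p) R"
proof (rule primeidealI)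
  show "carrier R \<noteq> contr p"
  proof
    assume "carrier R = contr p"
    then have "\<one> \<in> contr p" using one_closed by simp
    then show False using prime_not_unit[OF assms] \<theta>_one by (simp add: contr_def)
  qed
  fix a b assume "a \<in> carrier R" "b \<in> carrier R" "a \<otimes> b \<in> contr p"
  then show "a \<in> contr p \<or> b \<in> contr p"
    using prime_dvd_multD[OF assms \<theta>_mem \<theta>_mem, of a b] by (auto simp: contr_def \<theta>_mult)
qed (rule contr_ideal, rule is_cring)

lemma prime_powD:
  assumes "primeideal P R" "x \<in> carrier R" "x [^] (n::nat) \<in> P" shows "x \<in> P"
  using assms(3)
proof (induction n)
  case 0
  then have "P = carrier R"
    using assms(1) ideal.one_imp_carrier[OF primeideal.axioms(1)] by simp
  then show ?case using assms(2) by simp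
next
  case (Suc n)
  then show ?case using primeideal.I_prime[OF assms(1), of "x [^] n" x] assms(2) by auto
qed

text \<open>Factor \<open>\<theta> f\<close> into primes of \<open>H\<close>. The
  \<open>D\<close>-th powers of the factors come from \<open>R\<close>, so primality of
  \<open>P\<close> puts some \<open>p ^ D\<close> into \<open>P\<close>. If \<open>p\<close> divides
  \<open>\<theta> r\<close>, then \<open>r [^] D\<close> is a multiple of that element, so
  \<open>r\<close> lies in \<open>P\<close>.\<close>

lemma prime_contains_contr:
  assumes P: "primeideal P R" and f: "f \<in> P" "f \<noteq> \<zero>"
  obtains p where "is_prime p" "contr p \<subseteq> P" "contr p \<noteq> {\<zero>}"
proof -
  interpret P: primeideal P R by fact
  have fc: "f \<in> carrier R" using f P.Icarr by blast
  have one: "\<one> \<notin> P" using P.one_imp_carrier P.I_notcarr by auto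
  \<comment> \<open>The induction speaks about \<open>c ^ D\<close> because the factors
    \<open>c\<close> themselves need not come from \<open>R\<close>.\<close>
  have "\<exists>p. is_prime p \<and> p ^ D \<in> \<theta> ` P" if "c \<in> H" "c \<noteq> 0" "c ^ D \<in> \<theta> ` P" for c
    using that
  proof (induction c rule: factor_induct)
    case (unit c)
    obtain w where w: "w \<in> H" "1 = c * w"
      using quotient_mem[OF unit(1) one_mem _ unit(2)] unit(2) by fastforce
    obtain x where x: "x \<in> P" "c ^ D = \<theta> x" using unit by auto
    obtain y where y: "y \<in> carrier R" "w ^ D = \<theta> y" using power_D[OF w(1)] by auto
    have "\<theta> (x \<otimes> y) = \<theta> \<one>"
      using x y P.Icarr by (simp add: \<theta>_mult \<theta>_one power_mult_distrib[symmetric] flip: w(2) x(2) y(2))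
    then have "x \<otimes> y = \<one>" using x y P.Icarr by (simp add: \<theta>_eq_iff)
    then have "\<one> \<in> P" using x y P.I_r_closed by metis
    then show ?case using one by simp
  next
    case (prime p c)
    obtain x where x: "x \<in> carrier R" "p ^ D = \<theta> x" using power_D[OF prime_mem[OF prime.hyps(1)]] by auto
    obtain y where y: "y \<in> carrier R" "c ^ D = \<theta> y" using power_D[OF prime.hyps(2)] by auto
    obtain z where z: "z \<in> P" "(p * c) ^ D = \<theta> z" using prime.prems by auto
    have "\<theta> (x \<otimes> y) = \<theta> z" using x y z by (simp add: \<theta>_mult power_mult_distrib)
    then have "x \<otimes> y \<in> P" using x y z P.Icarr by (simp add: \<theta>_eq_iff)
    then have "x \<in> P \<or> y \<in> P" using P.I_prime x y by blast
    then show ?case using prime x y by auto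
  qed
  moreover have "\<theta> f ^ D \<in> \<theta> ` P"
  proof -
    have "f [^] D = f [^] (D - 1) \<otimes> f" using D_pos by (cases D) auto
    then have "f [^] D \<in> P" using f fc P.I_l_closed by simp
    then show ?thesis using \<theta>_pow[OF fc, of D] by (metis image_eqI)
  qed
  ultimately obtain p where p: "is_prime p" "p ^ D \<in> \<theta> ` P"
    using \<theta>_mem[OF fc] f fc \<theta>_eq_0_iff by blast
  then obtain x where x: "x \<in> P" "\<theta> x = p ^ D" by auto
  have xc: "x \<in> carrier R" using x P.Icarr by blast
  have "contr p \<subseteq> P"
  proof
    fix r assume "r \<in> contr p"
    then have r: "r \<in> carrier R" "p dvd \<theta> r" by (auto simp: contr_def)
    then obtain h where h: "h \<in> H" "\<theta> r = p * h"
      using quotient_mem[OF prime_mem[OF p(1)] \<theta>_mem[OF r(1)] prime_nonzero[OF p(1)]] by blast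
    obtain y where y: "y \<in> carrier R" "h ^ D = \<theta> y" using power_D[OF h(1)] by auto
    have "\<theta> (r [^] D) = \<theta> (x \<otimes> y)"
      using r h x xc y by (simp add: \<theta>_pow \<theta>_mult power_mult_distrib)
    then have "r [^] D = x \<otimes> y" using r xc y by (simp add: \<theta>_eq_iff)
    then have "r [^] D \<in> P" using x y P.I_r_closed by simp
    then show "r \<in> P" using prime_powD[OF P r(1)] by blast
  qed
  moreover have "x \<in> contr p" "x \<noteq> \<zero>"
  proof -
    show "x \<in> contr p" using x xc D_pos by (simp add: contr_def dvd_power)
    have "(1::'b) \<noteq> 0" using prime_not_unit[OF p(1)] by auto
    then show "x \<noteq> \<zero>" using power_nonzero[OF prime_nonzero[OF p(1)]] x \<theta>_zero by metis
  qed
  ultimately show thesis using that[OF p(1)] by blast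
qed

lemma zero_prime:
  assumes "(1::'b) \<noteq> 0" shows "primeideal {\<zero>} R"
proof (rule primeidealI)
  show "carrier R \<noteq> {\<zero>}" using \<theta>_one \<theta>_zero assms one_closed by fastforce
  fix a b assume "a \<in> carrier R" "b \<in> carrier R" "a \<otimes> b \<in> {\<zero>}"
  then show "a \<in> {\<zero>} \<or> b \<in> {\<zero>}"
    using no_zero_div[of "\<theta> a" "\<theta> b"] by (auto simp: \<theta>_mult[symmetric] \<theta>_zero \<theta>_eq_0_iff)
qed (rule zeroideal, rule is_cring)

text \<open>A nonzero \<open>P\<close> contains some nonzero \<open>contr p\<close>; if the
  inclusion were strict, \<open>{\<zero>}\<close>, \<open>contr p\<close>, \<open>P\<close> would be
  a chain of length 2.\<close>

lemma height_one_prime: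
  assumes P: "primeideal P R" and ht: "height R P = 1"
  obtains p where "is_prime p" "P = contr p"
proof -
  define chain where "chain l \<longleftrightarrow>
    (\<exists>Q. (\<forall>i\<le>l. primeideal (Q i) R) \<and> (\<forall>i<l. Q i \<subset> Q (Suc i)) \<and> Q l = P)" for l :: nat
  have height: "height R P = Sup {enat l | l. chain l}" by (simp add: height_def chain_def)
  have ub: "l \<le> 1" if "chain l" for l :: nat
  proof -
    have "enat l \<le> height R P" unfolding height using that by (intro Sup_upper) blast
    then show ?thesis using ht by (simp add: one_enat_def)
  qed
  \<comment> \<open>With only trivial chains the height would be 0. A chain of positive length gives
    a prime strictly below \<open>P\<close>, and thereby a nonzero element of
    \<open>P\<close>.\<close>
  have "\<exists>l>0. chain l"
  proof (rule ccontr)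
    assume "\<not> ?thesis"
    then have "\<And>l. chain l \<Longrightarrow> l = 0" by auto
    then have "height R P \<le> 0" unfolding height by (intro Sup_least) (auto simp: zero_enat_def)
    then show False using ht by simp
  qed
  then obtain l Q where Q: "\<forall>i\<le>l. primeideal (Q i) R" "\<forall>i<l. Q i \<subset> Q (Suc i)" "Q l = P" "0 < l"
    unfolding chain_def by blast
  then have sub: "Q (l - 1) \<subset> P" "primeideal (Q (l - 1)) R" using Q(2)[rule_format, of "l - 1"] by auto
  then have "\<zero> \<in> Q (l - 1)"
    using additive_subgroup.zero_closed ideal.axioms(1) primeideal.axioms(1) by blast
  then obtain f where f: "f \<in> P" "f \<noteq> \<zero>" using sub by blast
  obtain p where p: "is_prime p" "contr p \<subseteq> P" "contr p \<noteq> {\<zero>}" using prime_contains_contr[OF P f] .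
  have "contr p = P"
  proof (rule ccontr)
    assume neq: "contr p \<noteq> P"
    have "(1::'b) \<noteq> 0" using prime_not_unit[OF p(1)] by auto
    note z = zero_prime[OF this]
    have "\<zero> \<in> contr p" using \<theta>_zero by (simp add: contr_def)
    then have s: "{\<zero>} \<subset> contr p" "contr p \<subset> P" using p neq by auto
    have "chain 2"
      unfolding chain_def by (rule exI[of _ "\<lambda>i. if i = 0 then {\<zero>} else if i = 1 then contr p else P"])
        (use z s contr_prime[OF p(1)] P in \<open>auto simp: less_Suc_eq numeral_2_eq_2\<close>)
    then show False using ub[of 2] by simp
  qed
  then show thesis using that p by blast
qed

text \<open>Suppose \<open>g\<close> divides \<open>\<theta> u\<close> with \<open>u\<close> outside
  \<open>q\<close>. By purity some multiple \<open>u'\<close> of \<open>u\<close> has annihilator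
  \<open>contr p\<close> modulo \<open>q\<close>. Maximality of \<open>g\<close> gives
  \<open>x\<close> in \<open>q\<close> with \<open>\<theta> x = g * h\<close> and \<open>p\<close>
  not dividing \<open>h\<close>; yet \<open>h ^ D\<close> annihilates \<open>u'\<close>.\<close>

lemma maximal_common_divisor_ideal:
  assumes q: "pure_height R q 1"
    and g: "g \<in> H" "g \<noteq> 0" "\<And>x. x \<in> q \<Longrightarrow> g dvd \<theta> x"
    and g_max: "\<And>p. is_prime p \<Longrightarrow> \<exists>x\<in>q. \<not> g * p dvd \<theta> x"
  shows "q = contr g"
proof
  interpret q: ideal q R using q by (simp add: pure_height_def)
  show "q \<subseteq> contr g" using g q.Icarr by (auto simp: contr_def)
  show "contr g \<subseteq> q"
  proof (rule ccontr)
    assume "\<not> contr g \<subseteq> q"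
    then obtain u where u: "u \<in> carrier R" "g dvd \<theta> u" "u \<notin> q" by (auto simp: contr_def)
    obtain v where v: "v \<in> carrier R" "u \<otimes> v \<notin> q"
      and P: "{r \<in> carrier R. r \<otimes> (u \<otimes> v) \<in> q} \<in> Ass R q" (is "?P \<in> _")
      using associated_prime_exists[OF q.is_ideal u(1,3)] by blast
    have "primeideal ?P R" "height R ?P = 1"
      using P q by (auto simp: pure_height_def Ass_def one_enat_def)
    then obtain p where p: "is_prime p" "?P = contr p" using height_one_prime by blast
    define u' where "u' = u \<otimes> v"
    have u': "u' \<in> carrier R" "g dvd \<theta> u'" using u v by (auto simp: u'_def \<theta>_mult)
    obtain s where s: "s \<in> H" "\<theta> u' = g * s"
      using quotient_mem[OF g(1) \<theta>_mem[OF u'(1)] g(2) u'(2)] by blast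
    obtain x where x: "x \<in> q" "\<not> g * p dvd \<theta> x" using g_max[OF p(1)] by blast
    have xc: "x \<in> carrier R" using x q.Icarr by blast
    obtain h where h: "h \<in> H" "\<theta> x = g * h"
      using quotient_mem[OF g(1) \<theta>_mem[OF xc] g(2) g(3)[OF x(1)]] by blast
    have ph: "\<not> p dvd h" using x(2) mult_dvd_mono[OF dvd_refl[of g], of p h] unfolding h(2) by blast
    then have "h \<noteq> 0" by auto
    \<comment> \<open>With \<open>\<theta> u' = g * s\<close>, the identity is
      \<open>h ^ D * (g * s) = (g * h) * (h ^ (D - 1) * s)\<close>. Both \<open>h ^ D\<close> and
      the last factor come from \<open>R\<close>, so the right-hand side is a multiple of
      \<open>x\<close> in \<open>R\<close>.\<close>
    have "h ^ (D - 1) * s \<in> \<theta> ` carrier R"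
      using same_degree[OF g(1) h(1) s(1) g(2) \<open>h \<noteq> 0\<close>] h s xc u' by (metis image_eqI)
    then obtain t where t: "t \<in> carrier R" "\<theta> t = h ^ (D - 1) * s" by auto
    obtain y where y: "y \<in> carrier R" "\<theta> y = h ^ D" using power_D[OF h(1)] by auto
    have "h ^ D = h * h ^ (D - 1)" using D_pos by (cases D) auto
    then have "\<theta> (y \<otimes> u') = \<theta> (x \<otimes> t)"
      using y u' xc t s h by (simp add: \<theta>_mult ac_simps)
    then have "y \<otimes> u' = x \<otimes> t" using y u' xc t by (simp add: \<theta>_eq_iff)
    then have "y \<in> ?P" using y x t q.I_r_closed by (simp add: u'_def)
    then have "p dvd h ^ D" using p(2) y by (auto simp: contr_def)
    then show False using prime_dvd_powerD[OF p(1) h(1)] ph by blast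
  qed
qed

text \<open>If \<open>y\<close> were outside \<open>q\<close>, some multiple of \<open>y\<close>
  would have an associated prime as annihilator modulo \<open>q\<close>, and \<open>w\<close> would
  lie in it. So \<open>w\<close> is a nonzerodivisor modulo \<open>q\<close>.\<close>

lemma mem_of_nonassociated_mult:
  assumes q: "ideal q R" and w: "w \<in> carrier R - \<Union>(Ass R q)" and y: "y \<in> carrier R" "w \<otimes> y \<in> q"
  shows "y \<in> q"
proof (rule ccontr)
  assume "y \<notin> q"
  then obtain v where v: "v \<in> carrier R" "{r \<in> carrier R. r \<otimes> (y \<otimes> v) \<in> q} \<in> Ass R q"
    using associated_prime_exists[OF q y(1)] by blast
  have "w \<otimes> (y \<otimes> v) = w \<otimes> y \<otimes> v" using w v y by (simp add: m_assoc)
  then have "w \<otimes> (y \<otimes> v) \<in> q" using ideal.I_r_closed[OF q y(2) v(1)] by simp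
  then show False using v w by blast
qed

lemma ideal_power_ideal:
  assumes "ideal q R" shows "ideal (ideal_power R q n) R"
proof (induction n)
  case 0
  then show ?case by (simp add: ideals_set_def nat_pow_def oneideal)
next
  case (Suc n)
  then show ?case using ideal_prod_is_ideal[OF Suc.IH assms] by (simp add: ideals_set_def nat_pow_def)
qed

lemma pow_mem_ideal_power:
  assumes "f \<in> q" shows "f [^] n \<in> ideal_power R q n"
  using assms ideal_prod.prod[of "f [^] n" "ideal_power R q n" f q R for n]
  by (induction n) (auto simp: ideals_set_def nat_pow_def)

lemma ideal_power_dvd:
  assumes "ideal q R" "\<And>x. x \<in> q \<Longrightarrow> g dvd \<theta> x" "x \<in> ideal_power R q n"
  shows "g ^ n dvd \<theta> x"
  using assms(3)
proof (induction n arbitrary: x)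
  case (Suc n)
  have x: "x \<in> ideal_prod R (ideal_power R q n) q"
    using Suc.prems by (simp add: ideals_set_def nat_pow_def)
  have sub: "ideal_prod R (ideal_power R q n) q \<subseteq> carrier R"
    by (intro ideal_prod_in_carrier ideal_power_ideal assms)
  from x show ?case
  proof (induction x rule: ideal_prod.induct)
    case (prod i j)
    have "i \<in> carrier R" "j \<in> carrier R"
      using prod ideal.Icarr[OF ideal_power_ideal[OF assms(1)]] ideal.Icarr[OF assms(1)] by blast+
    then have "\<theta> (i \<otimes> j) = \<theta> i * \<theta> j" by (rule \<theta>_mult)
    then show ?case using mult_dvd_mono[OF Suc.IH[OF prod(1)] assms(2)[OF prod(2)]]
      by (simp add: mult.commute)
  next
    case (sum s1 s2)
    then have "\<theta> (s1 \<oplus> s2) = \<theta> s1 + \<theta> s2" using sub by (intro \<theta>_add) auto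
    then show ?case using sum by simp
  qed
qed simp

end

section \<open>Elimination of the localization from symbolic powers\<close>

lemma (in cring) symbolic_powerD:
  assumes q: "ideal q R" "q \<noteq> carrier R" and J: "ideal (ideal_power R q n) R"
    and r: "r \<in> symbolic_power R q n"
  obtains w where "r \<in> carrier R" "w \<in> carrier R - \<Union>(Ass R q)" "w \<otimes> r \<in> ideal_power R q n"
proof -
  define W where "W = carrier R - \<Union>(Ass R q)"
  define \<phi> where "\<phi> = (\<lambda>r. frac R W r \<one>)"
  define J where "J = ideal_power R q n"
  define L where "L = localization R W"
  have prime: "primeideal P R" if "P \<in> Ass R q" for P using that by (simp add: Ass_def)
  have W: "W \<subseteq> carrier R" "\<one> \<in> W" "\<And>s t. s \<in> W \<Longrightarrow> t \<in> W \<Longrightarrow> s \<otimes> t \<in> W"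
  proof -
    show "W \<subseteq> carrier R" by (auto simp: W_def)
    have "\<one> \<notin> P" if "P \<in> Ass R q" for P
      using prime[OF that] ideal.one_imp_carrier[OF primeideal.axioms(1)] primeideal.I_notcarr by metis
    then show "\<one> \<in> W" by (auto simp: W_def)
    show "s \<otimes> t \<in> W" if "s \<in> W" "t \<in> W" for s t
      using that prime primeideal.I_prime unfolding W_def by fastforce
  qed
  note loc = localization_cring[OF is_cring W, folded L_def \<phi>_def]
  note eq = frac_rel_equiv[OF is_cring W]
  interpret L: cring L by (rule loc)
  interpret \<phi>: ring_hom_cring R L \<phi>
    by (intro ring_hom_cringI ring_hom_ringI2 ring_axioms L.ring_axioms is_cring L.is_cring loc)
  have ideal_J: "ideal J R" using assms(3) by (simp add: J_def)
  interpret J: ideal J R by (rule ideal_J)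
  have frac_eq: "frac R W a s = frac R W b t"
    if "a \<in> carrier R" "b \<in> carrier R" "s \<in> W" "t \<in> W" "v \<in> W" "v \<otimes> (t \<otimes> a) = v \<otimes> (s \<otimes> b)" for a b s t v
    unfolding frac_def using that by (intro equiv_class_eq[OF eq]) (auto simp: frac_rel_def)
  have Wc: "s \<in> carrier R" if "s \<in> W" for s using that W by auto
  \<comment> \<open>Every fraction is cleared by its denominator. The product is evaluated from the
    union that defines it: all pairs of representatives give the class \<open>\<phi> a\<close>, and
    \<open>mem\<close> shows that the union is not empty.\<close>
  have clear: "\<exists>t\<in>W. \<exists>a\<in>carrier R. \<phi> t \<otimes>\<^bsub>L\<^esub> x = \<phi> a" if x: "x \<in> carrier L" for x
  proof -
    obtain a t where at: "a \<in> carrier R" "t \<in> W" "x = frac_rel R W `` {(a, t)}"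
      using x by (auto simp: L_def localization_def elim!: quotientE)
    have mem: "(t, \<one>) \<in> \<phi> t" "(a, t) \<in> x"
      using at W Wc by (auto simp: \<phi>_def frac_def frac_rel_def)
    have frac_a: "frac R W (b \<otimes> c) (s \<otimes> s') = \<phi> a" if bs: "(b, s) \<in> \<phi> t" "(c, s') \<in> x" for b s c s'
    proof -
      obtain u where u: "u \<in> W" "u \<otimes> (s \<otimes> t) = u \<otimes> (\<one> \<otimes> b)" "b \<in> carrier R" "s \<in> W"
        using bs(1) at by (auto simp: \<phi>_def frac_def frac_rel_def)
      obtain v where v: "v \<in> W" "v \<otimes> (s' \<otimes> a) = v \<otimes> (t \<otimes> c)" "c \<in> carrier R" "s' \<in> W"
        using bs(2) at by (auto simp: frac_rel_def)
      have c: "u \<in> carrier R" "v \<in> carrier R" "s \<in> carrier R" "s' \<in> carrier R" "t \<in> carrier R"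
        using u v at Wc by auto
      have "u \<otimes> v \<otimes> (\<one> \<otimes> (b \<otimes> c)) = (u \<otimes> (\<one> \<otimes> b)) \<otimes> (v \<otimes> c)"
        using c u(3) v(3) by (simp add: m_ac)
      also have "\<dots> = (u \<otimes> s) \<otimes> (v \<otimes> (t \<otimes> c))"
        unfolding u(2)[symmetric] using c v(3) by (simp add: m_ac)
      also have "\<dots> = u \<otimes> v \<otimes> (s \<otimes> s' \<otimes> a)"
        unfolding v(2)[symmetric] using c at(1) by (simp add: m_ac)
      finally show ?thesis
        unfolding \<phi>_def using u v at W by (intro frac_eq) auto
    qed
    have "\<phi> t \<otimes>\<^bsub>L\<^esub> x = (\<Union>p\<in>\<phi> t. \<Union>p'\<in>x. frac R W (fst p \<otimes> fst p') (snd p \<otimes> snd p'))"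
      by (simp add: L_def localization_def case_prod_beta)
    also have "\<dots> = (\<Union>p\<in>\<phi> t. \<Union>p'\<in>x. \<phi> a)"
      using frac_a by (intro SUP_cong refl) auto
    also have "\<dots> = \<phi> a" using mem by blast
    finally show ?thesis using at by blast
  qed
  \<comment> \<open>\<open>K\<close> collects the fractions that some denominator carries into the
    image of \<open>J\<close>. It is an ideal containing that image, so minimality of the generated
    ideal replaces a description of its elements.\<close>
  define K where "K = {x \<in> carrier L. \<exists>s\<in>W. \<phi> s \<otimes>\<^bsub>L\<^esub> x \<in> \<phi> ` J}"
  have K_I: "x \<in> K" if "x \<in> carrier L" "s \<in> W" "\<phi> s \<otimes>\<^bsub>L\<^esub> x \<in> \<phi> ` J" for x s
    using that unfolding K_def by blast
  have "ideal K L"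
  proof (rule idealI)
    show "ring L" by (rule L.ring_axioms)
    show "subgroup K (add_monoid L)"
    proof (rule L.add.subgroupI)
      show "K \<subseteq> carrier L" by (auto simp: K_def)
      have "\<zero>\<^bsub>L\<^esub> \<in> K" using W Wc J.zero_closed
        by (auto simp: K_def intro!: bexI[of _ "\<one>"] image_eqI[of _ _ "\<zero>"])
      then show "K \<noteq> {}" by auto
      fix x assume "x \<in> K"
      then obtain s j where s: "x \<in> carrier L" "s \<in> W" "j \<in> J" "\<phi> s \<otimes>\<^bsub>L\<^esub> x = \<phi> j"
        by (auto simp: K_def)
      then have "\<phi> s \<otimes>\<^bsub>L\<^esub> (\<ominus>\<^bsub>L\<^esub> x) = \<phi> (\<ominus> j)"
        using Wc J.Icarr by (simp add: L.r_minus)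
      then have "\<phi> s \<otimes>\<^bsub>L\<^esub> (\<ominus>\<^bsub>L\<^esub> x) \<in> \<phi> ` J" using J.a_inv_closed[OF s(3)] by blast
      then show "\<ominus>\<^bsub>L\<^esub> x \<in> K" using K_I[OF L.a_inv_closed] s by blast
      fix y assume "y \<in> K"
      then obtain t k where t: "y \<in> carrier L" "t \<in> W" "k \<in> J" "\<phi> t \<otimes>\<^bsub>L\<^esub> y = \<phi> k"
        by (auto simp: K_def)
      have c: "s \<in> carrier R" "t \<in> carrier R" "j \<in> carrier R" "k \<in> carrier R"
        using s t Wc J.Icarr by auto
      have "\<phi> (s \<otimes> t) \<otimes>\<^bsub>L\<^esub> (x \<oplus>\<^bsub>L\<^esub> y) = \<phi> t \<otimes>\<^bsub>L\<^esub> (\<phi> s \<otimes>\<^bsub>L\<^esub> x) \<oplus>\<^bsub>L\<^esub> \<phi> s \<otimes>\<^bsub>L\<^esub> (\<phi> t \<otimes>\<^bsub>L\<^esub> y)"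
        using s(1) t(1) c by (simp add: L.r_distr L.m_ac)
      also have "\<dots> = \<phi> (t \<otimes> j \<oplus> s \<otimes> k)" using s(4) t(4) c by simp
      also have "\<dots> \<in> \<phi> ` J" using s t c J.I_l_closed J.a_closed by (intro imageI) auto
      finally have "\<phi> (s \<otimes> t) \<otimes>\<^bsub>L\<^esub> (x \<oplus>\<^bsub>L\<^esub> y) \<in> \<phi> ` J" .
      then show "x \<oplus>\<^bsub>L\<^esub> y \<in> K" using K_I[OF L.a_closed W(3)] s t by blast
    qed
    fix x y assume x: "x \<in> K" and y: "y \<in> carrier L"
    then obtain s j where s: "x \<in> carrier L" "s \<in> W" "j \<in> J" "\<phi> s \<otimes>\<^bsub>L\<^esub> x = \<phi> j"
      by (auto simp: K_def)
    obtain t a where t: "t \<in> W" "a \<in> carrier R" "\<phi> t \<otimes>\<^bsub>L\<^esub> y = \<phi> a" using clear[OF y] by blast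
    have c: "s \<in> carrier R" "t \<in> carrier R" "j \<in> carrier R" using s t Wc J.Icarr by auto
    have "\<phi> (s \<otimes> t) \<otimes>\<^bsub>L\<^esub> (y \<otimes>\<^bsub>L\<^esub> x) = (\<phi> t \<otimes>\<^bsub>L\<^esub> y) \<otimes>\<^bsub>L\<^esub> (\<phi> s \<otimes>\<^bsub>L\<^esub> x)"
      using s(1) y c by (simp add: L.m_ac)
    also have "\<dots> = \<phi> (a \<otimes> j)" using s t c by simp
    also have "\<dots> \<in> \<phi> ` J" using s t J.I_l_closed by (intro imageI) auto
    finally have "\<phi> (s \<otimes> t) \<otimes>\<^bsub>L\<^esub> (y \<otimes>\<^bsub>L\<^esub> x) \<in> \<phi> ` J" .
    then show "y \<otimes>\<^bsub>L\<^esub> x \<in> K" using K_I[OF L.m_closed W(3)] s t y by blast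
    then show "x \<otimes>\<^bsub>L\<^esub> y \<in> K" using s(1) y by (simp add: L.m_comm)
  qed
  moreover have "\<phi> ` J \<subseteq> K"
    using W Wc J.Icarr by (auto simp: K_def intro!: bexI[of _ "\<one>"])
  moreover have r': "r \<in> carrier R" "\<phi> r \<in> Idl\<^bsub>L\<^esub> (\<phi> ` J)"
    using r by (auto simp: symbolic_power_def Let_def W_def L_def \<phi>_def J_def)
  ultimately have "\<phi> r \<in> K" using L.genideal_minimal by blast
  then obtain s j where s: "s \<in> W" "j \<in> J" "\<phi> s \<otimes>\<^bsub>L\<^esub> \<phi> r = \<phi> j" by (auto simp: K_def)
  then have "\<phi> (s \<otimes> r) = \<phi> j" using Wc r' by simp
  \<comment> \<open>Equality of fractions holds only up to another factor \<open>t\<close> from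
    \<open>W\<close>, so the multiplier obtained in the end is \<open>t \<otimes> s\<close>.\<close>
  then have "((s \<otimes> r, \<one>), (j, \<one>)) \<in> frac_rel R W"
    unfolding \<phi>_def frac_def using eq_equiv_class[OF _ eq] W J.Icarr s(2) by auto
  then obtain t where t: "t \<in> W" "t \<otimes> (s \<otimes> r) = t \<otimes> j"
    using s Wc r' J.Icarr by (auto simp: frac_rel_def)
  then have "t \<otimes> s \<otimes> r \<in> J" using s Wc r' J.I_l_closed by (simp add: m_assoc)
  then show thesis using that[of "t \<otimes> s"] r' s t W(3) by (auto simp: J_def W_def)
qed

context graded_cover
begin

theorem symbolic_power_subset:
  assumes q: "pure_height R q 1"
  shows "symbolic_power R q (D * a) \<subseteq> ideal_power R q a"
proof
  fix r assume r: "r \<in> symbolic_power R q (D * a)"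
  have qi: "ideal q R" and qc: "q \<noteq> carrier R" using q by (auto simp: pure_height_def)
  interpret q: ideal q R by (rule qi)
  obtain w where rc: "r \<in> carrier R" and w: "w \<in> carrier R - \<Union>(Ass R q)" "w \<otimes> r \<in> ideal_power R q (D * a)"
    using symbolic_powerD[OF qi qc ideal_power_ideal[OF qi] r] by blast
  have "\<one> \<notin> q" using q.one_imp_carrier qc by auto
  then obtain v where v: "v \<in> carrier R" "\<one> \<otimes> v \<notin> q" "{r \<in> carrier R. r \<otimes> (\<one> \<otimes> v) \<in> q} \<in> Ass R q" (is "?P \<in> _")
    using associated_prime_exists[OF qi one_closed] by blast
  have "primeideal ?P R" "height R ?P = 1"
    using v(3) q by (auto simp: pure_height_def Ass_def one_enat_def)
  then obtain p0 where p0: "is_prime p0" "?P = contr p0" using height_one_prime by blast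
  have one_nz: "(1::'b) \<noteq> 0" using prime_not_unit[OF p0(1)] by auto
  \<comment> \<open>A maximal common divisor requires \<open>q\<close> to be nonzero. The element
    with image \<open>p0 ^ D\<close> annihilates \<open>v\<close> modulo \<open>q\<close>, and its
    product with \<open>v\<close> is a nonzero member of \<open>q\<close>.\<close>
  have "\<exists>x\<in>q. x \<noteq> \<zero>"
  proof -
    obtain y where y: "y \<in> carrier R" "\<theta> y = p0 ^ D" using power_D[OF prime_mem[OF p0(1)]] by auto
    then have "y \<in> contr p0" using D_pos by (simp add: contr_def dvd_power)
    then have "y \<otimes> v \<in> q" using p0(2) v(1) by auto
    moreover have "y \<noteq> \<zero>" using power_nonzero[OF prime_nonzero[OF p0(1)] one_nz] y \<theta>_zero by metis
    moreover have "v \<noteq> \<zero>" using v q.zero_closed by auto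
    moreover have "\<theta> (y \<otimes> v) = \<theta> y * \<theta> v" using y v by (simp add: \<theta>_mult)
    ultimately show ?thesis
      using no_zero_div[of "\<theta> y" "\<theta> v"] y v \<theta>_zero \<theta>_eq_0_iff by metis
  qed
  then obtain x0 where x0: "x0 \<in> q" "x0 \<noteq> \<zero>" by blast
  have X: "\<theta> ` q \<subseteq> H" "\<theta> x0 \<in> \<theta> ` q" "\<theta> x0 \<noteq> 0"
    using x0 \<theta>_eq_0_iff \<theta>_mem q.Icarr by auto
  obtain g where g0: "g \<in> H" "g \<noteq> 0" "\<And>x. x \<in> \<theta> ` q \<Longrightarrow> g dvd x"
    "\<And>p. is_prime p \<Longrightarrow> \<exists>x\<in>\<theta> ` q. \<not> g * p dvd x"
    by (rule maximal_common_divisor[OF X]) (rule that; blast)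
  then have g: "g \<in> H" "g \<noteq> 0" "\<And>x. x \<in> q \<Longrightarrow> g dvd \<theta> x"
    and g_max: "\<And>p. is_prime p \<Longrightarrow> \<exists>x\<in>q. \<not> g * p dvd \<theta> x"
    by simp_all
  have q_eq: "q = contr g" using maximal_common_divisor_ideal[OF q g g_max] .
  have wc: "w \<in> carrier R" using w by simp
  \<comment> \<open>Otherwise write \<open>g = p ^ k * g'\<close> with \<open>p\<close> not dividing
    \<open>g'\<close>. Then \<open>g\<close> divides \<open>\<theta> w ^ k * g' ^ D\<close>, where
    the exponent \<open>D\<close> makes the element come from \<open>R\<close>, so it lies in
    \<open>q\<close>. Cancelling \<open>w\<close> modulo \<open>q\<close> leaves
    \<open>g' ^ D\<close>, which \<open>g\<close> and hence \<open>p\<close> would divide.\<close>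
  have coprime: "\<not> p dvd \<theta> w" if p: "is_prime p" "p dvd g" for p
  proof
    assume "p dvd \<theta> w"
    obtain k g' where g': "g = p ^ k * g'" "g' \<in> H" "g' \<noteq> 0" "\<not> p dvd g'"
      using prime_part[OF p(1) g(1,2)] .
    obtain y where y: "y \<in> carrier R" "\<theta> y = g' ^ D" using power_D[OF g'(2)] by auto
    have "g dvd \<theta> w ^ k * g' ^ D"
    proof -
      have "g' dvd g' ^ D" using D_pos by (simp add: dvd_power)
      then show ?thesis
        unfolding g'(1) by (rule mult_dvd_mono[OF dvd_power_same[OF \<open>p dvd \<theta> w\<close>]])
    qed
    moreover have "\<theta> (w [^] k \<otimes> y) = \<theta> w ^ k * g' ^ D"
      using \<theta>_mult[OF nat_pow_closed[OF wc] y(1)] \<theta>_pow[OF wc] y(2) by simp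
    moreover have "w [^] k \<otimes> y \<in> carrier R" using wc y(1) by simp
    ultimately have *: "w [^] k \<otimes> y \<in> q" unfolding q_eq contr_def by simp
    have "y \<in> q" using *
    proof (induction k)
      case (Suc k)
      have "w \<otimes> (w [^] k \<otimes> y) = w [^] Suc k \<otimes> y"
        using wc y(1) m_assoc[of w "w [^] k" y] m_comm[of w "w [^] k"] by simp
      then have wq: "w \<otimes> (w [^] k \<otimes> y) \<in> q" using Suc.prems by simp
      have "w [^] k \<otimes> y \<in> carrier R" using wc y(1) by simp
      from mem_of_nonassociated_mult[OF qi w(1) this wq] show ?case by (rule Suc.IH)
    qed (use y in simp)
    then have "g dvd g' ^ D" unfolding q_eq contr_def y(2)[symmetric] by blast
    then have "p dvd g' ^ D" by (rule dvd_trans[OF p(2)])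
    then show False using prime_dvd_powerD[OF p(1) g'(2)] g'(4) by blast
  qed
  have "g ^ (D * a) dvd \<theta> w * \<theta> r"
    using ideal_power_dvd[OF qi g(3) w(2)] wc rc by (simp add: \<theta>_mult)
  moreover have "\<not> p dvd \<theta> w" if "is_prime p" "p dvd g ^ (D * a)" for p
    using coprime[OF that(1)] prime_dvd_powerD[OF that(1) g(1) that(2)] by blast
  ultimately have "g ^ (D * a) dvd \<theta> r"
    using dvd_of_coprime[OF power_mem[OF g(1)] power_nonzero[OF g(2) one_nz] \<theta>_mem[OF wc] \<theta>_mem[OF rc]] by blast
  then obtain s where s: "s \<in> H" "\<theta> r = g ^ (D * a) * s"
    using quotient_mem[OF power_mem[OF g(1)] \<theta>_mem[OF rc] power_nonzero[OF g(2) one_nz]] by blast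
  obtain f where f: "f \<in> carrier R" "\<theta> f = g ^ D" using power_D[OF g(1)] by auto
  have fa: "\<theta> (f [^] a) = g ^ (D * a)" using f by (simp add: \<theta>_pow power_mult)
  \<comment> \<open>\<open>same_degree\<close> with \<open>h = 1\<close>: the quotient
    \<open>s\<close> of two elements of degree 0 has degree 0 and so comes from
    \<open>R\<close>.\<close>
  have "1 ^ (D - 1) * s \<in> \<theta> ` carrier R"
  proof (rule same_degree[OF power_mem[OF g(1)] one_mem s(1) power_nonzero[OF g(2) one_nz] one_nz])
    show "g ^ (D * a) * 1 \<in> \<theta> ` carrier R" using fa f by (metis image_eqI mult_1_right nat_pow_closed)
    show "g ^ (D * a) * s \<in> \<theta> ` carrier R" using s rc by (metis image_eqI)
  qed
  then obtain t where t: "t \<in> carrier R" "\<theta> t = s" by auto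
  have "\<theta> r = \<theta> (f [^] a \<otimes> t)" using \<theta>_mult[OF nat_pow_closed[OF f(1)] t(1)] s(2) t(2) fa by simp
  then have "r = f [^] a \<otimes> t" using rc t f by (simp add: \<theta>_eq_iff)
  moreover have "f \<in> q" using f dvd_power[of D g] D_pos unfolding q_eq contr_def by simp
  ultimately show "r \<in> ideal_power R q a"
    using ideal.I_r_closed[OF ideal_power_ideal[OF qi] pow_mem_ideal_power t(1)] by simp
qed

end

section \<open>Lattice points of a simplicial cone\<close>

definition push :: "('a \<Rightarrow> 'b) \<Rightarrow> ('a \<Rightarrow>\<^sub>0 'k::comm_ring_1) \<Rightarrow> 'b \<Rightarrow>\<^sub>0 'k" where
  "push f p = (\<Sum>m\<in>keys p. Poly_Mapping.single (f m) (lookup p m))"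

lemma push_superset:
  assumes "finite A" "keys p \<subseteq> A"
  shows "push f p = (\<Sum>m\<in>A. Poly_Mapping.single (f m) (lookup p m))"
  unfolding push_def using assms by (intro sum.mono_neutral_left) (auto simp: in_keys_iff)

lemma push_add: "push f (p + q) = push f p + push f q"
proof -
  have "push f r = (\<Sum>m\<in>keys p \<union> keys q. Poly_Mapping.single (f m) (lookup r m))"
    if "r \<in> {p, q, p + q}" for r
    using that keys_add[of p q] by (intro push_superset) auto
  then show ?thesis by (simp add: lookup_add single_add sum.distrib)
qed

lemma push_0: "push f 0 = 0"
  by (simp add: push_def)

lemma push_sum: "push f (\<Sum>x\<in>A. g x) = (\<Sum>x\<in>A. push f (g x))"
  by (induction A rule: infinite_finite_induct) (simp_all add: push_0 push_add)

lemma push_single: "push f (Poly_Mapping.single m c) = Poly_Mapping.single (f m) c"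
  by (simp add: push_def)

lemma sum_singles: "(\<Sum>m\<in>keys p. Poly_Mapping.single m (lookup p m)) = p"
proof (rule poly_mapping_eqI)
  fix k
  have "lookup (\<Sum>m\<in>keys p. Poly_Mapping.single m (lookup p m)) k
      = (\<Sum>m\<in>keys p. if m = k then lookup p m else 0)"
    by (simp add: lookup_sum lookup_single when_def)
  then show "lookup (\<Sum>m\<in>keys p. Poly_Mapping.single m (lookup p m)) k = lookup p k"
    by (simp add: in_keys_iff)
qed

text \<open>Additivity is asked only on the exponents that occur, since \<open>coords\<close>
  truncates to natural numbers and is additive on the cone points only.\<close>

lemma push_mult:
  assumes "\<And>m n. m \<in> keys p \<Longrightarrow> n \<in> keys q \<Longrightarrow> f (m + n) = f m + f n"
  shows "push f (p * q) = push f p * push f q"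
proof -
  have "p * q = (\<Sum>m\<in>keys p. \<Sum>n\<in>keys q. Poly_Mapping.single (m + n) (lookup p m * lookup q n))"
    by (subst sum_singles[of p, symmetric], subst sum_singles[of q, symmetric])
      (simp only: sum_product mult_single)
  then have "push f (p * q)
      = (\<Sum>m\<in>keys p. \<Sum>n\<in>keys q. Poly_Mapping.single (f (m + n)) (lookup p m * lookup q n))"
    by (simp only: push_sum push_single)
  also have "\<dots> = push f p * push f q"
    unfolding push_def sum_product by (intro sum.cong refl) (simp add: assms mult_single)
  finally show ?thesis .
qed

lemma keys_push: "keys (push f p) \<subseteq> f ` keys p"
proof
  fix e assume "e \<in> keys (push f p)"
  then have "(\<Sum>m\<in>keys p. lookup (Poly_Mapping.single (f m) (lookup p m)) e) \<noteq> 0"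
    by (simp add: push_def in_keys_iff lookup_sum)
  then obtain m where "m \<in> keys p" "lookup (Poly_Mapping.single (f m) (lookup p m)) e \<noteq> 0"
    by (meson sum.neutral)
  then show "e \<in> f ` keys p" by (auto simp: lookup_single when_def split: if_splits)
qed

lemma lookup_push:
  assumes "inj_on f S" "keys p \<subseteq> S" "m \<in> S"
  shows "lookup (push f p) (f m) = lookup p m"
proof -
  have "lookup (push f p) (f m) = (\<Sum>n\<in>keys p. if n = m then lookup p n else 0)"
    unfolding push_def lookup_sum using assms
    by (intro sum.cong) (auto simp: lookup_single when_def inj_on_def)
  then show ?thesis by (simp add: in_keys_iff)
qed

lemma push_inj_on:
  assumes "inj_on f S" shows "inj_on (push f) {p. keys p \<subseteq> S}"
proof (rule inj_onI)
  fix p q assume *: "p \<in> {p. keys p \<subseteq> S}" "q \<in> {p. keys p \<subseteq> S}" "push f p = push f q"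
  show "p = q"
  proof (rule poly_mapping_eqI)
    fix m
    show "lookup p m = lookup q m"
    proof (cases "m \<in> S")
      case True
      then show ?thesis using lookup_push[OF assms] * by (metis mem_Collect_eq)
    next
      case False
      then have "m \<notin> keys p" "m \<notin> keys q" using * by auto
      then show ?thesis by (simp add: in_keys_iff)
    qed
  qed
qed

lemma push_image:
  fixes f :: "'a \<Rightarrow> 'b"
  shows "push f ` {p :: 'a \<Rightarrow>\<^sub>0 'k::comm_ring_1. keys p \<subseteq> S} = {p. keys p \<subseteq> f ` S}"
proof safe
  fix p :: "'a \<Rightarrow>\<^sub>0 'k::comm_ring_1" and x assume "x \<in> keys (push f p)" "keys p \<subseteq> S"
  then show "x \<in> f ` S" using keys_push[of f p] by blast
next
  fix p :: "'b \<Rightarrow>\<^sub>0 'k" assume p: "keys p \<subseteq> f ` S"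
  define q where "q = push (inv_into S f) p"
  have "inv_into S f ` keys p \<subseteq> S" using p by (auto intro!: inv_into_into)
  then have "keys q \<subseteq> S" unfolding q_def using keys_push by (rule subset_trans[rotated])
  moreover have "push f q = (\<Sum>m\<in>keys p. Poly_Mapping.single m (lookup p m))"
    unfolding q_def push_def[of "inv_into S f"] push_sum push_single
    using p by (intro sum.cong refl arg_cong2[of _ _ _ _ Poly_Mapping.single] f_inv_into_f) auto
  then have "push f q = p" by (simp only: sum_singles)
  ultimately show "p \<in> push f ` {p. keys p \<subseteq> S}" by blast
qed

lemma det_of_int: "det (\<chi> i j. real_of_int (A $ i $ j)) = real_of_int (det (A :: int ^ 'n ^ 'n))"
  by (simp add: det_def)

text \<open>Cramer's rule divides by the determinant, so it is applied over the reals; its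
  numerators are determinants of integer matrices and form the preimage \<open>m\<close>.\<close>

lemma det_mult_in_range:
  fixes A :: "int ^ 'n ^ 'n"
  assumes "det A \<noteq> 0"
  shows "\<exists>m. A *v m = (\<chi> i. det A * x $ i)"
proof -
  define AR where "AR = (\<chi> i j. real_of_int (A $ i $ j))"
  have dAR: "det AR = real_of_int (det A)" by (simp add: AR_def det_of_int)
  define m where "m = (\<chi> k. det (\<chi> i j. if j = k then x $ i else A $ i $ j))"
  define xR where "xR = (\<chi> i. real_of_int (x $ i))"
  define y where "y = (\<chi> k. det (\<chi> i j. if j = k then xR $ i else AR $ i $ j) / det AR)"
  have "AR *v y = xR" unfolding y_def using cramer[of AR _ xR] dAR assms by simp
  have y: "det A * y $ k = real_of_int (m $ k)" for k
  proof -
    have "(\<chi> i j. if j = k then xR $ i else AR $ i $ j)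
        = (\<chi> i j. real_of_int ((\<chi> i j. if j = k then x $ i else A $ i $ j) $ i $ j))"
      by (simp add: vec_eq_iff xR_def AR_def)
    then have "det (\<chi> i j. if j = k then xR $ i else AR $ i $ j) = real_of_int (m $ k)"
      using det_of_int[of "\<chi> i j. if j = k then x $ i else A $ i $ j"] by (simp add: m_def)
    then show ?thesis using dAR assms by (simp add: y_def)
  qed
  have "(A *v m) $ i = det A * x $ i" for i
  proof -
    have "real_of_int ((A *v m) $ i) = (\<Sum>j\<in>UNIV. AR $ i $ j * (det A * y $ j))"
      by (simp add: matrix_vector_mult_def AR_def y)
    also have "\<dots> = det A * (AR *v y) $ i"
      by (simp add: matrix_vector_mult_def sum_distrib_left mult.left_commute)
    also have "\<dots> = real_of_int (det A * x $ i)"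
      unfolding \<open>AR *v y = xR\<close> by (simp add: xR_def)
    finally show ?thesis by (simp only: of_int_eq_iff)
  qed
  then show ?thesis by (auto simp: vec_eq_iff)
qed

section \<open>The grading defined by the image lattice of an integer matrix\<close>

locale lattice_map =
  fixes V :: "int ^ 'n ^ 'n"
  assumes det_nonzero: "det V \<noteq> 0"
begin

definition emb :: "nat ^ 'n \<Rightarrow> int ^ 'n" where
  "emb e = (\<chi> i. int (e $ i))"

definition rel :: "nat ^ 'n \<Rightarrow> nat ^ 'n \<Rightarrow> bool" where
  "rel e f \<longleftrightarrow> emb e - emb f \<in> range (\<lambda>m. V *v m)"

definition cone_points :: "(int ^ 'n) set" where
  "cone_points = {m. \<forall>i. 0 \<le> (V *v m) $ i}"

definition coords :: "int ^ 'n \<Rightarrow> nat ^ 'n" where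
  "coords m = (\<chi> i. nat ((V *v m) $ i))"

lemma emb_add: "emb (e + f) = emb e + emb f" and emb_0: "emb 0 = 0"
  by (simp_all add: emb_def vec_eq_iff)

lemma emb_inj: "emb e = emb f \<longleftrightarrow> e = f"
  by (simp add: emb_def vec_eq_iff)

lemma emb_coords: "m \<in> cone_points \<Longrightarrow> emb (coords m) = V *v m"
  by (simp add: emb_def coords_def cone_points_def vec_eq_iff)

lemma range_add: "x \<in> range (\<lambda>m. V *v m) \<Longrightarrow> y \<in> range (\<lambda>m. V *v m) \<Longrightarrow> x + y \<in> range (\<lambda>m. V *v m)"
  by (auto simp: matrix_vector_mult_add_rdistrib matrix_vector_right_distrib[symmetric])

lemma range_uminus: "x \<in> range (\<lambda>m. V *v m) \<Longrightarrow> - x \<in> range (\<lambda>m. V *v m)"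
proof (elim rangeE)
  fix m assume "x = V *v m"
  then have "- x = V *v (- m)"
    by (simp add: matrix_vector_mult_def vec_eq_iff sum_negf)
  then show ?thesis by blast
qed

sublocale exponent_grading rel
proof
  show "equivp rel"
  proof (rule equivpI)
    show "reflp rel" by (rule reflpI) (auto simp: rel_def intro: range_eqI[of _ _ 0])
    show "symp rel"
    proof (rule sympI)
      fix e f assume "rel e f"
      then have "- (emb e - emb f) \<in> range (\<lambda>m. V *v m)" unfolding rel_def by (rule range_uminus)
      then show "rel f e" by (simp add: rel_def)
    qed
    show "transp rel"
    proof (rule transpI)
      fix e f g assume "rel e f" "rel f g"
      then have "(emb e - emb f) + (emb f - emb g) \<in> range (\<lambda>m. V *v m)" unfolding rel_def by (rule range_add)
      then show "rel e g" by (simp add: rel_def)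
    qed
  qed
  show "rel (e + g) (f + g) \<longleftrightarrow> rel e f" for e f g by (simp add: rel_def emb_add)
qed

text \<open>A vector \<open>V *v m\<close> with natural coordinates has \<open>m\<close> in the
  cone, so the exponents of degree 0 are exactly those of the semigroup ring.\<close>

lemma rel_0_iff: "rel e 0 \<longleftrightarrow> e \<in> coords ` cone_points"
proof
  assume "rel e 0"
  then obtain m where m: "emb e = V *v m" by (auto simp: rel_def emb_0)
  then have "m \<in> cone_points" unfolding cone_points_def m[symmetric] by (simp add: emb_def m[symmetric])
  then show "e \<in> coords ` cone_points" using m emb_coords emb_inj by (metis image_eqI)
qed (auto simp: rel_def emb_0 emb_coords)

lemma coords_add: "m \<in> cone_points \<Longrightarrow> n \<in> cone_points \<Longrightarrow> coords (m + n) = coords m + coords n"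
  by (simp add: coords_def cone_points_def vec_eq_iff matrix_vector_right_distrib nat_add_distrib)

lemma coords_inj: "inj_on coords cone_points"
proof (rule inj_onI)
  fix m n assume mn: "m \<in> cone_points" "n \<in> cone_points" "coords m = coords n"
  then have "V *v m = V *v n" by (metis emb_coords)
  then have *: "V *v (m - n) = 0"
    by (simp add: matrix_vector_mult_def vec_eq_iff right_diff_distrib sum_subtractf)
  define VR where "VR = (\<chi> i j. real_of_int (V $ i $ j))"
  have "VR *v (\<chi> i. real_of_int ((m - n) $ i)) = 0"
  proof -
    have "(\<Sum>j\<in>UNIV. V $ i $ j * (m - n) $ j) = 0" for i
      using * by (simp add: matrix_vector_mult_def vec_eq_iff)
    then have "real_of_int (\<Sum>j\<in>UNIV. V $ i $ j * (m - n) $ j) = 0" for i by simp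
    then show ?thesis by (simp add: matrix_vector_mult_def VR_def vec_eq_iff)
  qed
  moreover have "det VR \<noteq> 0" using det_nonzero by (simp add: VR_def det_of_int)
  ultimately have "(\<chi> i. real_of_int ((m - n) $ i)) = 0"
    by (metis invertible_det_nz matrix_left_invertible_ker invertible_left_inverse)
  then show "m = n" by (simp add: vec_eq_iff)
qed

text \<open>Cramer's rule gives the multiple by \<open>det V\<close>; the absolute value is harmless
  because the image of \<open>V\<close> is closed under negation.\<close>

lemma rel_multiple:
  "rel (\<chi> i. nat \<bar>det V\<bar> * e $ i) 0"
proof -
  obtain m where m: "V *v m = (\<chi> i. det V * emb e $ i)" using det_mult_in_range[OF det_nonzero] by blast
  have "emb (\<chi> i. nat \<bar>det V\<bar> * e $ i) = V *v m \<or> emb (\<chi> i. nat \<bar>det V\<bar> * e $ i) = - (V *v m)"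
    unfolding m by (auto simp: emb_def vec_eq_iff abs_if)
  then show ?thesis using range_uminus[of "V *v m"] by (auto simp: rel_def emb_0)
qed

lemma hom_at_power: "hom_at e h \<Longrightarrow> hom_at (\<chi> i. n * e $ i) (h ^ n)"
proof (induction n)
  case 0
  then show ?case by (simp add: hom_at_def rel_refl zero_vec_def[symmetric])
next
  case (Suc n)
  have "(\<chi> i. Suc n * e $ i) = e + (\<chi> i. n * e $ i)" by (simp add: vec_eq_iff)
  then show ?case using hom_at_mult[OF Suc.prems Suc.IH[OF Suc.prems]] by simp
qed

lemma image_push_coords: "push coords ` {p. keys p \<subseteq> cone_points} = {p. hom_at 0 p}"
  unfolding push_image by (auto simp: hom_at_def rel_0_iff)

lemma hom_at_0_homs: "hom_at 0 p \<Longrightarrow> p \<in> homs UNIV"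
  by (auto simp: homs_def polys_in_UNIV)

lemma graded_cover_semigroup_ring:
  "graded_cover (semigroup_ring cone_points :: (int ^ 'n \<Rightarrow>\<^sub>0 'k::field) ring) (homs UNIV) (push coords) (nat \<bar>det V\<bar>)"
proof -
  let ?R = "semigroup_ring cone_points :: (int ^ 'n \<Rightarrow>\<^sub>0 'k) ring"
  let ?D = "nat \<bar>det V\<bar>"
  note [simp] = semigroup_ring_def
  have "0 \<in> cone_points" by (simp add: cone_points_def)
  moreover have "m + n \<in> cone_points" if "m \<in> cone_points" "n \<in> cone_points" for m n
    using that by (simp add: cone_points_def matrix_vector_right_distrib)
  ultimately interpret R: cring ?R by (rule semigroup_ring_cring)
  interpret H: factorial_monoid "homs UNIV :: (nat ^ 'n \<Rightarrow>\<^sub>0 'k) set"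
    by (rule factorial_homs) simp
  have image: "push coords ` carrier ?R = {p. hom_at 0 p}" using image_push_coords by simp
  have power: "hom_at 0 (h ^ ?D)" if "hom_at e h" for e and h :: "nat ^ 'n \<Rightarrow>\<^sub>0 'k"
    using hom_at_rel[OF hom_at_power[OF that] rel_multiple] .
  show ?thesis
  proof unfold_locales
    fix x y assume xy: "x \<in> carrier ?R" "y \<in> carrier ?R"
    show "push coords (x \<oplus>\<^bsub>?R\<^esub> y) = push coords x + push coords y" by (simp add: push_add)
    show "push coords (x \<otimes>\<^bsub>?R\<^esub> y) = push coords x * push coords y"
      using xy by (auto intro!: push_mult coords_add)
  next
    have "coords 0 = 0" by (simp add: coords_def vec_eq_iff)
    then show "push coords \<one>\<^bsub>?R\<^esub> = 1"
      using push_single[of coords 0 1] by simp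
    show "inj_on (push coords) (carrier ?R)" using push_inj_on[OF coords_inj] by simp
    fix x assume "x \<in> carrier ?R"
    then have "push coords x \<in> push coords ` carrier ?R" by (rule imageI)
    then show "push coords x \<in> homs UNIV" unfolding image by (auto intro: hom_at_0_homs)
  next
    show "0 < ?D" using det_nonzero by simp
    fix h :: "nat ^ 'n \<Rightarrow>\<^sub>0 'k" assume "h \<in> homs UNIV"
    then show "h ^ ?D \<in> push coords ` carrier ?R" unfolding image using power by (auto simp: homs_def)
  next
    fix g h s :: "nat ^ 'n \<Rightarrow>\<^sub>0 'k"
    assume h: "g \<in> homs UNIV" "h \<in> homs UNIV" "s \<in> homs UNIV" "g \<noteq> 0" "h \<noteq> 0"
      "g * h \<in> push coords ` carrier ?R" "g * s \<in> push coords ` carrier ?R"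
    obtain a b c where abc: "hom_at a g" "hom_at b h" "hom_at c s" using h by (auto simp: homs_def)
    have "hom_at 0 (h ^ (?D - 1) * s)"
    proof (cases "s = 0")
      case False
      \<comment> \<open>Nonzero homogeneous polynomials have a unique degree, so
        \<open>a + b\<close> and \<open>a + c\<close> are both of degree 0 and \<open>c\<close>
        agrees with \<open>b\<close>. The total degree is then \<open>?D\<close> times
        \<open>b\<close>.\<close>
      have "rel (a + b) 0" "rel (a + c) 0"
        using h False abc unfolding image
        by (auto intro!: hom_at_unique[OF hom_at_mult] simp: poly_mult_eq_0_iff)
      then have "rel (a + c) (a + b)" using rel_sym rel_trans by blast
      then have "rel c b" by (simp add: rel_add_left)
      then have "rel ((\<chi> i. (?D - 1) * b $ i) + c) ((\<chi> i. (?D - 1) * b $ i) + b)"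
        by (simp add: rel_add_left)
      also have "(\<chi> i. (?D - 1) * b $ i) + b = (\<chi> i. ?D * b $ i)"
      proof -
        have "(?D - 1) * k + k = ?D * k" for k
          using det_nonzero by (cases ?D) auto
        then show ?thesis by (simp add: vec_eq_iff)
      qed
      finally have "rel ((\<chi> i. (?D - 1) * b $ i) + c) 0" using rel_multiple rel_trans by blast
      then show ?thesis using hom_at_rel[OF hom_at_mult[OF hom_at_power[OF abc(2)] abc(3)]] by blast
    qed (simp add: hom_at_0)
    then show "h ^ (?D - 1) * s \<in> push coords ` carrier ?R" unfolding image by simp
  next
    fix J :: "nat \<Rightarrow> (int ^ 'n \<Rightarrow>\<^sub>0 'k) set"
    assume J: "\<And>k. ideal (J k) ?R" and mono: "\<And>k. J k \<subseteq> J (Suc k)"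
    define Z :: "(nat ^ 'n) set" where "Z = {e. rel e 0}"
    \<comment> \<open>\<open>E k\<close> is an ideal of the polynomial ring whose contraction is \<open>J k\<close>: taking the component of
      degree \<open>0\<close> is linear over the subring of degree \<open>0\<close>.\<close>
    define E where "E k = {s. \<forall>t. restr Z (t * s) \<in> push coords ` J k}" for k
    have Jc: "J k \<subseteq> carrier ?R" for k using ideal.Icarr[OF J] by blast
    have img: "push coords x + push coords y \<in> push coords ` J k" if "x \<in> J k" "y \<in> J k" for x y k
      using additive_subgroup.a_closed[OF ideal.axioms(1)[OF J] that] by (auto simp: push_add[symmetric])
    have "\<exists>N. \<forall>k\<ge>N. E k = E N"
    proof (rule noetherian_onD)
      show "noetherian_on (UNIV :: (nat ^ 'n \<Rightarrow>\<^sub>0 'k) set)"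
        using noetherian_polys_in[of UNIV] by (simp add: polys_in_UNIV)
      show "ideal_of UNIV (E k)" for k
        unfolding ideal_of_def
      proof (intro conjI ballI)
        have "0 \<in> J k" using additive_subgroup.zero_closed[OF ideal.axioms(1)[OF J]] by simp
        then show "0 \<in> E k" by (auto simp: E_def restr_0 push_0 intro!: image_eqI[of _ _ 0])
        fix x y assume x: "x \<in> E k" and y: "y \<in> E k"
        have "restr Z (t * (x + y)) \<in> push coords ` J k" for t
        proof -
          obtain u v where "u \<in> J k" "v \<in> J k" "restr Z (t * x) = push coords u" "restr Z (t * y) = push coords v"
            using x y unfolding E_def by blast
          then show ?thesis using img unfolding distrib_left restr_add by simp
        qed
        then show "x + y \<in> E k" unfolding E_def by blast
      next
        fix r x assume x: "x \<in> E k"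
        have "restr Z (t * r * x) \<in> push coords ` J k" for t using x unfolding E_def by blast
        then show "r * x \<in> E k" unfolding E_def mult.assoc by blast
      qed simp
      show "E k \<subseteq> E (Suc k)" for k using image_mono[OF mono[of k], of "push coords"] unfolding E_def by blast
    qed
    then obtain N where N: "\<And>k. N \<le> k \<Longrightarrow> E k = E N" by blast
    have JE: "J k = {x \<in> carrier ?R. push coords x \<in> E k}" for k
    proof safe
      fix x assume x: "x \<in> J k"
      then show xc: "x \<in> carrier ?R" using Jc by blast
      have hx: "hom_at 0 (push coords x)" using xc image by blast
      show "push coords x \<in> E k"
        unfolding E_def
      proof safe
        fix t :: "nat ^ 'n \<Rightarrow>\<^sub>0 'k"
        have "restr Z (push coords x * t) = push coords x * restr Z t"
        proof (rule restr_mult)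
          fix e f assume "e \<in> keys (push coords x)"
          then have "rel (e + f) (0 + f)" using hx by (simp add: hom_at_def rel_add_right del: add_0)
          then show "e + f \<in> Z \<longleftrightarrow> f \<in> Z" 
            unfolding Z_def mem_Collect_eq add_0 by (meson rel_sym rel_trans)
        qed
        moreover have "restr Z t \<in> push coords ` carrier ?R"
          unfolding image by (simp add: hom_at_def keys_restr Z_def)
        then obtain y where y: "y \<in> carrier ?R" "restr Z t = push coords y" by blast
        moreover have "push coords x * push coords y = push coords (x * y)"
          using xc y(1) by (intro push_mult[symmetric] coords_add) auto
        moreover have "x * y \<in> J k" using ideal.I_r_closed[OF J x y(1)] by simp
        ultimately show "restr Z (t * push coords x) \<in> push coords ` J k"
          by (simp add: mult.commute)
      qed
    next
      fix x assume x: "x \<in> carrier ?R" "push coords x \<in> E k"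
      have "restr Z (1 * push coords x) \<in> push coords ` J k" using x(2) unfolding E_def by blast
      moreover have "restr Z (push coords x) = push coords x"
      proof (rule restr_id)
        have "hom_at 0 (push coords x)" using x(1) image by blast
        then show "keys (push coords x) \<subseteq> Z" by (auto simp: hom_at_def Z_def)
      qed
      ultimately obtain y where "y \<in> J k" "push coords x = push coords y" by auto
      then show "x \<in> J k"
        using push_inj_on[OF coords_inj] x(1) Jc[of k] unfolding inj_on_def by (metis (no_types, lifting) mem_Collect_eq partial_object.select_convs(1) semigroup_ring_def subsetD)
    qed
    have "J k = J N" if "N \<le> k" for k
      unfolding JE[of k] JE[of N] N[OF that] ..
    then show "\<exists>N. \<forall>k\<ge>N. J k = J N" by blast
  qed
qed

end

section \<open>The dual of a simplicial cone\<close>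

lemma convex_Cone:
  fixes B :: "(real ^ 'n) set"
  shows "convex (Cone B)"
  unfolding convex_def
proof (intro ballI allI impI)
  fix x y and u v :: real assume "x \<in> Cone B" "y \<in> Cone B" and uv: "0 \<le> u" "0 \<le> v" "u + v = 1"
  then obtain a b where a: "x = (\<Sum>w\<in>B. a w *\<^sub>R w)" "\<forall>w\<in>B. 0 \<le> a w"
    and b: "y = (\<Sum>w\<in>B. b w *\<^sub>R w)" "\<forall>w\<in>B. 0 \<le> b w" by (auto simp: Cone_def)
  have "u *\<^sub>R x + v *\<^sub>R y = (\<Sum>w\<in>B. (u * a w + v * b w) *\<^sub>R w)"
    by (simp add: a b scaleR_sum_right sum.distrib scaleR_add_left)
  moreover have "\<forall>w\<in>B. 0 \<le> u * a w + v * b w" using a b uv by simp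
  ultimately show "u *\<^sub>R x + v *\<^sub>R y \<in> Cone B"
    unfolding Cone_def by (intro CollectI exI[of _ "\<lambda>w. u * a w + v * b w"] conjI)
qed

lemma Cone_subset_span: "Cone B \<subseteq> span B"
  by (force simp: Cone_def intro: span_sum span_mul span_base)

lemma scale_mem_Cone:
  assumes "finite B" "b \<in> B" "0 \<le> t" shows "t *\<^sub>R b \<in> Cone B"
proof -
  have "(\<Sum>w\<in>B. (if w = b then t else 0) *\<^sub>R w) = (\<Sum>w\<in>B. if w = b then t *\<^sub>R b else 0)"
    by (intro sum.cong) auto
  also have "\<dots> = t *\<^sub>R b" using assms by simp
  finally show ?thesis
    using assms(3) unfolding Cone_def by (intro CollectI exI[of _ "\<lambda>w. if w = b then t else 0"]) auto
qed

text \<open>By independence there is a functional that vanishes at \<open>b\<close> and equals 1 at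
  the other generators. It is nonnegative on the cone, and its zeros there form the ray through
  \<open>b\<close>.\<close>

lemma ray_of_independent_Cone:
  fixes B :: "(real ^ 'n) set"
  assumes B: "finite B" "independent B" and b: "b \<in> B"
  shows "{t *\<^sub>R b | t. 0 \<le> t} \<in> rays (Cone B)"
proof -
  let ?F = "{t *\<^sub>R b | t. 0 \<le> t}"
  obtain f where f: "linear f" "\<And>v. v \<in> B \<Longrightarrow> f v = (if v = b then 0 else 1::real)"
    using linear_independent_extend[OF B(2), of "\<lambda>v. if v = b then 0 else 1"] by blast
  \<comment> \<open>\<open>adjoint f 1\<close> is the vector representing \<open>f\<close> as an
    inner product, in the form that a supporting hyperplane needs.\<close>
  define c where "c = adjoint f 1"
  have c: "c \<bullet> x = f x" for x using adjoint_works[OF f(1), of x 1] by (simp add: c_def inner_commute)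
  have fsum: "f (\<Sum>w\<in>B. a w *\<^sub>R w) = (\<Sum>w\<in>B - {b}. a w)" for a
  proof -
    have "f (\<Sum>w\<in>B. a w *\<^sub>R w) = (\<Sum>w\<in>B. a w * f w)"
      using f(1) by (simp add: linear_sum linear_scale)
    also have "\<dots> = (\<Sum>w\<in>B - {b}. a w * f w)"
      using B(1) b f(2) by (simp add: sum.remove)
    also have "\<dots> = (\<Sum>w\<in>B - {b}. a w)" using f(2) by (intro sum.cong) auto
    finally show ?thesis .
  qed
  have "(Cone B \<inter> {x. c \<bullet> x = 0}) face_of Cone B"
  proof (rule face_of_Int_supporting_hyperplane_ge[OF convex_Cone])
    fix x assume "x \<in> Cone B"
    then show "c \<bullet> x \<ge> 0" by (auto simp: Cone_def c fsum intro!: sum_nonneg)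
  qed
  moreover have "Cone B \<inter> {x. c \<bullet> x = 0} = ?F"
  proof safe
    fix x assume x: "x \<in> Cone B" "c \<bullet> x = 0"
    then obtain a where a: "x = (\<Sum>w\<in>B. a w *\<^sub>R w)" "\<forall>w\<in>B. 0 \<le> a w" by (auto simp: Cone_def)
    then have "(\<Sum>w\<in>B - {b}. a w) = 0" using x(2) by (simp add: c fsum)
    then have "\<forall>w\<in>B - {b}. a w = 0" using a(2) B(1) by (subst (asm) sum_nonneg_eq_0_iff) auto
    then have "x = a b *\<^sub>R b" unfolding a(1) using B(1) b by (simp add: sum.remove)
    then show "\<exists>t. x = t *\<^sub>R b \<and> 0 \<le> t" using a(2) b by blast
  next
    fix t :: real assume "0 \<le> t"
    then show "t *\<^sub>R b \<in> Cone B" using scale_mem_Cone[OF B(1) b] by blast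
    show "c \<bullet> t *\<^sub>R b = 0" using c f(2)[OF b] by simp
  qed
  moreover have "aff_dim ?F = 1"
  proof -
    have b0: "b \<noteq> 0" using B(2) b dependent_zero by blast
    have "0 \<in> ?F" by (intro CollectI exI[of _ 0]) simp
    then have "aff_dim ?F = int (dim ?F)" by (intro aff_dim_zero hull_inc)
    moreover have "dim ?F = 1"
    proof -
      have "b \<in> ?F" by (intro CollectI exI[of _ 1]) simp
      then have "span {b} \<subseteq> span ?F" by (intro span_mono) simp
      moreover have "?F \<subseteq> span {b}" by (auto simp: span_singleton)
      then have "span ?F \<subseteq> span {b}" by (rule span_minimal) (rule subspace_span)
      ultimately have "span ?F = span {b}" by (rule subset_antisym[rotated])
      from arg_cong[OF this, of dim] have "dim ?F = dim {b}" by (simp only: dim_span)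
      then show ?thesis using b0 by (simp add: dim_singleton)
    qed
    ultimately show ?thesis by simp
  qed
  ultimately show ?thesis by (simp add: rays_def)
qed

lemma primitive_multiple:
  fixes g :: "int ^ 'n"
  assumes "g \<noteq> 0"
  obtains p d where "primitive_vector p" "0 < d" "of_lattice g = real_of_int d *\<^sub>R of_lattice p"
proof -
  define d where "d = (GCD i\<in>UNIV. g $ i)"
  have "d \<noteq> 0" using assms by (auto simp: d_def vec_eq_iff)
  moreover have "0 \<le> d" by (simp add: d_def)
  ultimately have d: "0 < d" by simp
  define p :: "int ^ 'n" where "p = (\<chi> i. g $ i div d)"
  have g: "g $ i = d * p $ i" for i
    unfolding p_def using Gcd_dvd[of "g $ i" "range (($) g)"] by (simp add: d_def)
  have "d = Gcd ((*) d ` range (($) p))" unfolding d_def[symmetric] image_image g[symmetric] by (simp add: d_def)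
  also have "\<dots> = d * Gcd (range (($) p))" using d by (simp add: Gcd_mult abs_mult)
  finally have "primitive_vector p" using d by (simp add: primitive_vector_def)
  moreover have "of_lattice g = real_of_int d *\<^sub>R of_lattice p"
    by (simp add: of_lattice_def vec_eq_iff g)
  ultimately show thesis using that d by blast
qed

lemma inner_of_lattice: "of_lattice m \<bullet> of_lattice v = real_of_int (\<Sum>i\<in>UNIV. m $ i * v $ i)"
  by (simp add: of_lattice_def inner_vec_def)

text \<open>Independent generators span rays of \<open>\<sigma>\<close>, so each is a positive
  multiple of a row of \<open>V\<close>; conversely the rows lie in \<open>\<sigma>\<close>. Hence
  the rows span the space and impose the same inequalities as the whole cone.\<close>

lemma simplicial_dual_cone:
  fixes \<sigma> :: "(real ^ 'n) set" and V :: "int ^ 'n ^ 'n"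
  assumes full: "full_dimensional_cone \<sigma>" and simp: "simplicial_cone \<sigma>"
    and V: "range (\<lambda>i. V $ i) = primitive_generators \<sigma>"
  shows "det V \<noteq> 0" and "of_lattice m \<in> dual_cone \<sigma> \<longleftrightarrow> (\<forall>i. 0 \<le> (V *v m) $ i)"
proof -
  obtain G where G: "lattice_generators G \<sigma>" "independent (of_lattice ` G)"
    using simp by (auto simp: simplicial_cone_def)
  define B where "B = of_lattice ` G"
  have B: "finite B" "independent B" "\<sigma> = Cone B" using G by (auto simp: B_def lattice_generators_def)
  have gen: "\<exists>i t. 0 < t \<and> b = t *\<^sub>R of_lattice (V $ i)" if b: "b \<in> B" for b
  proof -
    obtain g where g: "g \<in> G" "b = of_lattice g" using b by (auto simp: B_def)
    then have "g \<noteq> 0" using G by (auto simp: lattice_generators_def)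
    then obtain p d where p: "primitive_vector p" "0 < d" "of_lattice g = real_of_int d *\<^sub>R of_lattice p"
      by (rule primitive_multiple)
    then have "of_lattice p = (1 / real_of_int d) *\<^sub>R b" using g by simp
    then have "of_lattice p \<in> {t *\<^sub>R b | t. 0 \<le> t}"
      using p(2) by (intro CollectI exI[of _ "1 / real_of_int d"]) simp
    then have "\<exists>F\<in>rays \<sigma>. of_lattice p \<in> F"
      unfolding B(3) by (rule bexI) (rule ray_of_independent_Cone[OF B(1,2) b])
    then have "p \<in> primitive_generators \<sigma>" using p(1) unfolding primitive_generators_def by simp
    then obtain i where "p = V $ i" using V by blast
    then show ?thesis using p g by (intro exI[of _ i] exI[of _ "real_of_int d"]) simp
  qed
  have V_mem: "of_lattice (V $ i) \<in> \<sigma>" for i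
  proof -
    have "V $ i \<in> primitive_generators \<sigma>" using V by blast
    then obtain F where "F face_of \<sigma>" "of_lattice (V $ i) \<in> F"
      unfolding primitive_generators_def rays_def by auto
    then show ?thesis using face_of_imp_subset by blast
  qed
  define VR where "VR = (\<chi> i j. real_of_int (V $ i $ j))"
  have row: "row i VR = of_lattice (V $ i)" for i
    by (simp add: row_def VR_def of_lattice_def vec_eq_iff)
  \<comment> \<open>Full dimension is witnessed by a possibly different generating set; its members
    lie in the cone and therefore in the span of \<open>B\<close>.\<close>
  have "UNIV = span B"
  proof -
    obtain G' where G': "lattice_generators G' \<sigma>" "span (of_lattice ` G') = UNIV"
      using full by (auto simp: full_dimensional_cone_def)
    have "of_lattice ` G' \<subseteq> span B"
    proof
      fix x assume x: "x \<in> of_lattice ` G'"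
      have "1 *\<^sub>R x \<in> Cone (of_lattice ` G')"
        using G'(1) x by (intro scale_mem_Cone) (auto simp: lattice_generators_def)
      then show "x \<in> span B"
        using G'(1) B(3) Cone_subset_span[of B] by (auto simp: lattice_generators_def)
    qed
    then have "span (of_lattice ` G') \<subseteq> span B" by (rule span_minimal) (rule subspace_span)
    then show ?thesis using G'(2) by auto
  qed
  also have "span B \<subseteq> span (rows VR)"
  proof (rule span_minimal)
    show "B \<subseteq> span (rows VR)"
    proof
      fix b assume "b \<in> B"
      then obtain i t where "b = t *\<^sub>R row i VR" using gen row by metis
      moreover have "row i VR \<in> rows VR" by (auto simp: rows_def)
      ultimately show "b \<in> span (rows VR)" by (simp add: span_mul span_base)
    qed
  qed (rule subspace_span)
  finally have "det VR \<noteq> 0"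
    by (metis invertible_det_nz invertible_left_inverse matrix_left_invertible_span_rows top.extremum_uniqueI)
  then show "det V \<noteq> 0" by (simp add: VR_def det_of_int)
  have inner: "of_lattice m \<bullet> of_lattice (V $ i) = real_of_int ((V *v m) $ i)" for i
    by (simp add: inner_of_lattice matrix_vector_mult_def mult.commute)
  show "of_lattice m \<in> dual_cone \<sigma> \<longleftrightarrow> (\<forall>i. 0 \<le> (V *v m) $ i)"
  proof
    assume "of_lattice m \<in> dual_cone \<sigma>"
    then have "0 \<le> of_lattice m \<bullet> of_lattice (V $ i)" for i using V_mem by (auto simp: dual_cone_def)
    then show "\<forall>i. 0 \<le> (V *v m) $ i" by (simp add: inner)
  next
    assume *: "\<forall>i. 0 \<le> (V *v m) $ i"
    have "0 \<le> of_lattice m \<bullet> b" if b: "b \<in> B" for b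
    proof -
      obtain i t where "0 < t" "b = t *\<^sub>R of_lattice (V $ i)" using gen[OF b] by blast
      then show ?thesis using * by (simp add: inner)
    qed
    then show "of_lattice m \<in> dual_cone \<sigma>"
      unfolding dual_cone_def B(3) Cone_def by (auto simp: inner_sum_right intro!: sum_nonneg)
  qed
qed

section \<open>Symbolic powers in toric rings\<close>

theorem theorem1p3:
  fixes \<sigma> :: "(real ^ 'n) set"
    and R :: "(int ^ 'n \<Rightarrow>\<^sub>0 'k::alg_closed_field) ring"
    and V :: "int ^ 'n ^ 'n"
    and \<qq> :: "(int ^ 'n \<Rightarrow>\<^sub>0 'k) set"
    and D a :: nat
  assumes "strongly_convex_rational_polyhedral_cone \<sigma>"
    and "full_dimensional_cone \<sigma>"
    and "simplicial_cone \<sigma>"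
    and "R = toric_ring \<sigma>"
    and "bij_betw (\<lambda>i. V $ i) UNIV (primitive_generators \<sigma>)"
    and "D = nat \<bar>det V\<bar>"
    and "pure_height R \<qq> 1"
    and "0 < a"
  shows "symbolic_power R \<qq> (D * a) \<subseteq> ideal_power R \<qq> a"
proof -
  have V: "range (\<lambda>i. V $ i) = primitive_generators \<sigma>"
    using assms(5) by (simp add: bij_betw_def)
  note dual = simplicial_dual_cone[OF assms(2,3) V]
  interpret lattice_map V by unfold_locales (rule dual(1))
  \<comment> \<open>The facet inequalities of the dual cone are the sign conditions on
    \<open>V *v m\<close> that define \<open>cone_points\<close>.\<close>
  have R: "R = semigroup_ring cone_points"
    unfolding assms(4) toric_ring_def cone_points_def by (simp only: dual(2))
  interpret graded_cover R "homs UNIV" "push coords" D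
    unfolding R assms(6) by (rule graded_cover_semigroup_ring)
  show ?thesis by (rule symbolic_power_subset[OF assms(7)])
qed

end
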